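(* Let $\mathbf{z}$ be the ternary sequence defined as follows. Define morphisms $f,g:\{0,1,2\}^*\to\{0,1,2\}^*$ by $f(0)=01,\ f(1)=022,\ f(2)=02$ and $g(0)=20,\ g(1)=21,\ g(2)=2$; let $\mathbf{y}=g(f^\omega(0))=y_0y_1y_2\cdots$; let $A=00101101$, $B=001$, $C=00202202$, $D=002$; and let $\mathbf{z}=\tau(y_0)\tau(y_1)\cdots$, where $\tau(y_{2i})$ equals $B,A,AA$ according as $y_{2i}=0,1,2$, and $\tau(y_{2i+1})$ equals $D,C,CC$ according as $y_{2i+1}=0,1,2$. Let $R$ be the reversal antimorphism of $\{0,1,2\}^*$ and $S$ the antimorphism with $S(0)=0$, $S(1)=2$, $S(2)=1$, and let $G=\{I,R,S,RS\}$. Then $\mathbf{z}$ is $G$-rich.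
   Context: $f^\omega(0)$ is the infinite sequence having $f^n(0)$ as a prefix for every $n$. An antimorphism $\Theta$ satisfies $\Theta(uv)=\Theta(v)\Theta(u)$; $R$ fixes every letter, so $R(w_0\cdots w_{n-1})=w_{n-1}\cdots w_0$; $I$ is the identity. A word $w$ is a $\Theta$-palindrome if $\Theta(w)=w$. A factor $w$ of a sequence $\mathbf{u}$ is left (right) special if $aw,bw$ (resp. $wa,wb$) are factors for two distinct letters $a,b$. For a group $G$ of morphisms and antimorphisms under which the language (set of factors) of $\mathbf{u}$ is closed, write $[w]=\{\eta(w):\eta\in G\}$. The graph of symmetries $\Gamma_n(\mathbf{u})$ (for $n\in\mathbb N$) is the undirected multigraph whose vertices are the classes $[w]$ with $w$ a factor of length $n$ that is left or right special; two vertices $[w],[v]$ are joined by an edge $[e]$ (a class of factors) if there is a factor $u\in[e]$ of length $>n$ whose prefix of length $n$ lies in $[w]$, whose suffix of length $n$ lies in $[v]$, and which contains no other special factor of length $n$ besides this prefix and suffix. The sequence $\mathbf{u}$ (with language closed under $G$) is $G$-rich if for every $n\ge 1$: (i) $\Gamma_n(\mathbf{u})$ with loops removed is a tree, and (ii) whenever an edge $[e]$ is a loop of $\Gamma_n(\mathbf{u})$, $e$ is a $\Theta$-palindrome for some antimorphism $\Theta\in G$. *)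

theory Defs
  imports "HOL-Library.Stream" "HOL-Algebra.Group"
begin

section \<open>Morphisms and antimorphisms of free monoids\<close>

definition word_morphism :: "('a list \<Rightarrow> 'a list) \<Rightarrow> bool" where
  "word_morphism \<phi> \<longleftrightarrow> (\<forall>u v. \<phi> (u @ v) = \<phi> u @ \<phi> v)"

definition word_antimorphism :: "('a list \<Rightarrow> 'a list) \<Rightarrow> bool" where
  "word_antimorphism \<Theta> \<longleftrightarrow> (\<forall>u v. \<Theta> (u @ v) = \<Theta> v @ \<Theta> u)"

definition symmetry_group :: "('a list \<Rightarrow> 'a list) set \<Rightarrow> bool" where
  "symmetry_group G \<longleftrightarrow>
     group \<lparr>carrier = G, monoid.mult = (\<circ>), one = id\<rparr> \<and>
     (\<forall>\<eta>\<in>G. word_morphism \<eta> \<or> word_antimorphism \<eta>)"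

definition morphic_extension :: "('a \<Rightarrow> 'b list) \<Rightarrow> 'a list \<Rightarrow> 'b list" where
  "morphic_extension h w = concat (map h w)"

text \<open>The sequence having all iterates of \<open>\<phi>\<close> on the letter \<open>a\<close> as prefixes. It is meaningful only
  if \<open>\<phi>\<close> prolongs \<open>a\<close> and the iterates grow; see \<open>ex1_omega_power_f\<close> below.\<close>

definition omega_power :: "('a list \<Rightarrow> 'a list) \<Rightarrow> 'a \<Rightarrow> 'a stream" where
  "omega_power \<phi> a = (THE x. \<forall>n. stake (length ((\<phi> ^^ n) [a])) x = (\<phi> ^^ n) [a])"


section \<open>Factors of sequences\<close>

definition lang :: "'a stream \<Rightarrow> 'a list set" where
  "lang u = {stake n (sdrop i u) | i n. True}"

definition left_special :: "'a stream \<Rightarrow> 'a list \<Rightarrow> bool" where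
  "left_special u w \<longleftrightarrow> (\<exists>a b. a \<noteq> b \<and> a # w \<in> lang u \<and> b # w \<in> lang u)"

definition right_special :: "'a stream \<Rightarrow> 'a list \<Rightarrow> bool" where
  "right_special u w \<longleftrightarrow> (\<exists>a b. a \<noteq> b \<and> w @ [a] \<in> lang u \<and> w @ [b] \<in> lang u)"

definition special :: "'a stream \<Rightarrow> 'a list \<Rightarrow> bool" where
  "special u w \<longleftrightarrow> w \<in> lang u \<and> (left_special u w \<or> right_special u w)"

definition closed_under :: "('a list \<Rightarrow> 'a list) set \<Rightarrow> 'a stream \<Rightarrow> bool" where
  "closed_under G u \<longleftrightarrow> (\<forall>\<eta>\<in>G. \<forall>w\<in>lang u. \<eta> w \<in> lang u)"

definition sym_class :: "('a list \<Rightarrow> 'a list) set \<Rightarrow> 'a list \<Rightarrow> 'a list set" where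
  "sym_class G w = {\<eta> w | \<eta>. \<eta> \<in> G}"


section \<open>Undirected multigraphs\<close>

text \<open>\<open>joins \<Gamma> e x y\<close> says that the edge \<open>e\<close> has end vertices \<open>x\<close> and \<open>y\<close>; it is meant to be symmetric
  in \<open>x\<close> and \<open>y\<close>. Parallel edges are allowed. The trees of the theory \<open>Digraph_Component\<close> in the
  AFP entry on graph theory are not used because their acyclicity concerns directed cycles only.\<close>

record ('v, 'e) multigraph =
  verts :: "'v set"
  edges :: "'e set"
  joins :: "'e \<Rightarrow> 'v \<Rightarrow> 'v \<Rightarrow> bool"

definition is_loop :: "('v, 'e) multigraph \<Rightarrow> 'e \<Rightarrow> bool" where
  "is_loop \<Gamma> e \<longleftrightarrow> (\<exists>x\<in>verts \<Gamma>. joins \<Gamma> e x x)"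

definition remove_loops :: "('v, 'e) multigraph \<Rightarrow> ('v, 'e) multigraph" where
  "remove_loops \<Gamma> = \<Gamma>\<lparr>edges := {e \<in> edges \<Gamma>. \<not> is_loop \<Gamma> e}\<rparr>"

definition is_walk :: "('v, 'e) multigraph \<Rightarrow> 'v list \<Rightarrow> 'e list \<Rightarrow> bool" where
  "is_walk \<Gamma> vs es \<longleftrightarrow>
     length vs = Suc (length es) \<and> set vs \<subseteq> verts \<Gamma> \<and> set es \<subseteq> edges \<Gamma> \<and>
     (\<forall>i<length es. joins \<Gamma> (es ! i) (vs ! i) (vs ! Suc i))"

text \<open>Two parallel edges form a cycle of length 2.\<close>

definition is_cycle :: "('v, 'e) multigraph \<Rightarrow> 'v list \<Rightarrow> 'e list \<Rightarrow> bool" where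
  "is_cycle \<Gamma> vs es \<longleftrightarrow>
     is_walk \<Gamma> vs es \<and> es \<noteq> [] \<and> hd vs = last vs \<and> distinct (tl vs) \<and> distinct es"

definition multigraph_connected :: "('v, 'e) multigraph \<Rightarrow> bool" where
  "multigraph_connected \<Gamma> \<longleftrightarrow>
     verts \<Gamma> \<noteq> {} \<and>
     (\<forall>x\<in>verts \<Gamma>. \<forall>y\<in>verts \<Gamma>. \<exists>vs es. is_walk \<Gamma> vs es \<and> hd vs = x \<and> last vs = y)"

definition is_tree :: "('v, 'e) multigraph \<Rightarrow> bool" where
  "is_tree \<Gamma> \<longleftrightarrow> multigraph_connected \<Gamma> \<and> (\<nexists>vs es. is_cycle \<Gamma> vs es)"


section \<open>Graphs of symmetries and richness\<close>

text \<open>"No other special factor" is meant for occurrences: in a simple path no special factor of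
  length \<open>n\<close> occurs strictly between the prefix and the suffix, not even a further occurrence of the
  prefix or suffix itself.\<close>

definition simple_path :: "'a stream \<Rightarrow> nat \<Rightarrow> 'a list \<Rightarrow> bool" where
  "simple_path u n e \<longleftrightarrow>
     e \<in> lang u \<and> length e > n \<and>
     special u (take n e) \<and> special u (drop (length e - n) e) \<and>
     (\<forall>i. 0 < i \<and> i < length e - n \<longrightarrow> \<not> special u (take n (drop i e)))"

definition symmetry_graph ::
  "('a list \<Rightarrow> 'a list) set \<Rightarrow> 'a stream \<Rightarrow> nat \<Rightarrow> ('a list set, 'a list set) multigraph" where
  "symmetry_graph G u n =
     \<lparr>verts = {sym_class G w | w. length w = n \<and> special u w},
      edges = {sym_class G e | e. simple_path u n e},
      joins = (\<lambda>c x y. \<exists>e\<in>c. simple_path u n e \<and>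
                 {sym_class G (take n e), sym_class G (drop (length e - n) e)} = {x, y})\<rparr>"

definition G_rich :: "('a list \<Rightarrow> 'a list) set \<Rightarrow> 'a stream \<Rightarrow> bool" where
  "G_rich G u \<longleftrightarrow>
     symmetry_group G \<and> closed_under G u \<and>
     (\<forall>n\<ge>1.
        is_tree (remove_loops (symmetry_graph G u n)) \<and>
        (\<forall>c\<in>edges (symmetry_graph G u n). is_loop (symmetry_graph G u n) c \<longrightarrow>
           (\<forall>e\<in>c. \<exists>\<Theta>\<in>G. word_antimorphism \<Theta> \<and> \<Theta> e = e)))"


section \<open>The ternary sequence\<close>

datatype letter = L0 | L1 | L2

fun f_letter :: "letter \<Rightarrow> letter list" where
  "f_letter L0 = [L0, L1]"
| "f_letter L1 = [L0, L2, L2]"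
| "f_letter L2 = [L0, L2]"

fun g_letter :: "letter \<Rightarrow> letter list" where
  "g_letter L0 = [L2, L0]"
| "g_letter L1 = [L2, L1]"
| "g_letter L2 = [L2]"

abbreviation f_morphism :: "letter list \<Rightarrow> letter list" where
  "f_morphism \<equiv> morphic_extension f_letter"

text \<open>\<open>flat\<close> concatenates the words of a sequence, so \<open>flat (smap h x)\<close> is the image of the
  sequence \<open>x\<close> under the morphism given by \<open>h\<close> on letters (here all images are nonempty).\<close>

definition y_seq :: "letter stream" where
  "y_seq = flat (smap g_letter (omega_power f_morphism L0))"

definition word_A :: "letter list" where "word_A = [L0, L0, L1, L0, L1, L1, L0, L1]"
definition word_B :: "letter list" where "word_B = [L0, L0, L1]"
definition word_C :: "letter list" where "word_C = [L0, L0, L2, L0, L2, L2, L0, L2]"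
definition word_D :: "letter list" where "word_D = [L0, L0, L2]"

definition tau :: "nat \<Rightarrow> letter \<Rightarrow> letter list" where
  "tau k a =
     (if even k then (case a of L0 \<Rightarrow> word_B | L1 \<Rightarrow> word_A | L2 \<Rightarrow> word_A @ word_A)
      else (case a of L0 \<Rightarrow> word_D | L1 \<Rightarrow> word_C | L2 \<Rightarrow> word_C @ word_C))"

definition z_seq :: "letter stream" where
  "z_seq = flat (smap (\<lambda>k. tau k (y_seq !! k)) nats)"

fun swap_letter :: "letter \<Rightarrow> letter" where
  "swap_letter L0 = L0"
| "swap_letter L1 = L2"
| "swap_letter L2 = L1"

definition R_sym :: "letter list \<Rightarrow> letter list" where
  "R_sym w = rev w"

definition S_sym :: "letter list \<Rightarrow> letter list" where
  "S_sym w = rev (map swap_letter w)"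

definition G_sym :: "(letter list \<Rightarrow> letter list) set" where
  "G_sym = {id, R_sym, S_sym, R_sym \<circ> S_sym}"


section \<open>Well-definedness of the fixed point\<close>

lemma f_morphism_append: "f_morphism (u @ v) = f_morphism u @ f_morphism v"
  by (simp add: morphic_extension_def)

lemma f_pow_append: "(f_morphism ^^ n) (u @ v) = (f_morphism ^^ n) u @ (f_morphism ^^ n) v"
  by (induction n) (simp_all add: f_morphism_append)

lemma length_f_pow_ge: "length ((f_morphism ^^ n) w) \<ge> length w"
proof (induction n)
  case (Suc n)
  have "length (f_morphism v) \<ge> length v" for v
  proof (induction v)
    case (Cons a v)
    then show ?case by (cases a) (simp_all add: morphic_extension_def)
  qed simp
  from this[of "(f_morphism ^^ n) w"] Suc show ?case by simp
qed simp

lemma f_pow_Suc: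
  "(f_morphism ^^ Suc n) [L0] = (f_morphism ^^ n) [L0] @ (f_morphism ^^ n) [L1]"
  using f_pow_append[of n "[L0]" "[L1]"]
  by (simp add: funpow_swap1 morphic_extension_def)

lemma length_f_pow: "length ((f_morphism ^^ n) [L0]) > n"
proof (induction n)
  case (Suc n)
  then show ?case
    using length_f_pow_ge[of "[L1]" n] by (simp only: f_pow_Suc length_append) simp
qed simp

lemma f_pow_nth:
  assumes "m \<le> n" "i < length ((f_morphism ^^ m) [L0])"
  shows "(f_morphism ^^ n) [L0] ! i = (f_morphism ^^ m) [L0] ! i
       \<and> i < length ((f_morphism ^^ n) [L0])"
  using assms
proof (induction n rule: dec_induct)
  case (step n)
  then show ?case by (simp only: f_pow_Suc nth_append length_append) simp
qed simp

lemma ex1_omega_power_f: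
  "\<exists>!x. \<forall>n. stake (length ((f_morphism ^^ n) [L0])) x = (f_morphism ^^ n) [L0]"
proof
  let ?x = "smap (\<lambda>i. (f_morphism ^^ i) [L0] ! i) nats"
  show "\<forall>n. stake (length ((f_morphism ^^ n) [L0])) ?x = (f_morphism ^^ n) [L0]"
  proof
    fix n
    show "stake (length ((f_morphism ^^ n) [L0])) ?x = (f_morphism ^^ n) [L0]"
    proof (rule nth_equalityI)
      fix i assume "i < length (stake (length ((f_morphism ^^ n) [L0])) ?x)"
      then have i: "i < length ((f_morphism ^^ n) [L0])" by simp
      have "(f_morphism ^^ i) [L0] ! i = (f_morphism ^^ n) [L0] ! i"
        using f_pow_nth[of i n i] f_pow_nth[of n i i] i length_f_pow[of i]
        by (cases "i \<le> n") simp_all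
      with i show "stake (length ((f_morphism ^^ n) [L0])) ?x ! i = (f_morphism ^^ n) [L0] ! i"
        by simp
    qed simp
  qed
next
  fix x
  assume x: "\<forall>n. stake (length ((f_morphism ^^ n) [L0])) x = (f_morphism ^^ n) [L0]"
  have "x !! i = (f_morphism ^^ i) [L0] ! i" for i
    using x length_f_pow[of i] by (metis stake_nth)
  then have "snth x = (\<lambda>i. (f_morphism ^^ i) [L0] ! i)" by blast
  then show "x = smap (\<lambda>i. (f_morphism ^^ i) [L0] ! i) nats"
    using stream_smap_nats[of x] by simp
qed

end

theory Submission
  imports Defs
begin

text \<open>If every complete return word to a \<open>G\<close>-palindrome is a \<open>G\<close>-palindrome, then so is every complete return
  word to a class \<open>[w]\<close>: look at its longest palindromic suffix. Hence a loop of the graph of symmetries is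
  a palindrome, and every excursion from a vertex \<open>X\<close> starts and ends with the same edge; since this also
  holds for the returns to the other vertices, a vertex is only visited on excursions through one edge
  at \<open>X\<close>, so the graph has no cycle.

  For the ternary sequence the complete returns are found by desubstitution. It is coded by the fixed point
  \<open>x\<close> of \<open>f\<close> with blocks \<open>AAD\<close>, \<open>AAC\<close>, \<open>AA\<close> for \<open>0\<close>, \<open>1\<close>, \<open>2\<close>, where \<open>1\<close> and \<open>2\<close> are exchanged after every block
  \<open>AA\<close>. Palindromes that contain \<open>AA\<close> without its first two letters correspond to palindromes of \<open>x\<close>, and palindromes of
  \<open>x\<close> to shorter ones under \<open>f\<close>. The remaining palindromes of the ternary sequence have length at most 36 and
  are checked by computation.\<close>

section \<open>Factors at positions\<close>

text \<open>The obstacle in desubstitution is the fringe of a palindrome, the letters outside the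
  complete images in it. Either it determines the two neighbours of the preimage \<open>v\<close>;
  then \<open>v\<close> is enlarged by them and the palindrome is a trimmed image. Or it is already
  forced by \<open>v\<close>; then the palindrome is an extended image. The argument closes because
  nothing lies in between: when the fringe only shows that the neighbours are not \<open>0\<close>,
  the ends of \<open>v\<close> decide, since in the fixed point zeros are never adjacent and
  \<open>1\<close> stands only between zeros. Trimming and extending are the offsets
  \<open>e\<close> and \<open>a\<close> of \<open>X_transfer\<close> and \<open>Z_transfer\<close>.
  In the fixed point this is an induction on the length: \<open>f\<close> at least doubles lengths,
  so even an enlarged preimage is shorter. The ternary sequence then needs a single desubstitution.
  The exchange of \<open>1\<close> and \<open>2\<close> is carried along as a sign, the parity of
  the number of letters \<open>2\<close> read so far. This parity is preserved by \<open>f\<close>,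
  and the parity of a palindrome of the fixed point tells whether its image is an \<open>R\<close>-
  or an \<open>S\<close>-palindrome.\<close>

definition fac :: "'a stream \<Rightarrow> nat \<Rightarrow> nat \<Rightarrow> 'a list" where
  "fac u i n = stake n (sdrop i u)"

lemma length_fac [simp]: "length (fac u i n) = n"
  by (simp add: fac_def)

lemma nth_fac [simp]: "k < n \<Longrightarrow> fac u i n ! k = u !! (i + k)"
  by (simp add: fac_def sdrop_snth add.commute)

lemma take_fac: "m \<le> n \<Longrightarrow> take m (fac u i n) = fac u i m"
  by (rule nth_equalityI) simp_all

lemma drop_fac: "drop m (fac u i n) = fac u (i + m) (n - m)"
  by (rule nth_equalityI) (simp_all add: add.assoc)

lemma fac_add: "fac u i (m + n) = fac u i m @ fac u (i + m) n"
  by (rule nth_equalityI) (auto simp: nth_append add.assoc)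

lemma fac_eq_iff: "fac u i n = fac v j n \<longleftrightarrow> (\<forall>k<n. u !! (i + k) = v !! (j + k))"
  by (auto simp: list_eq_iff_nth_eq)

lemma lang_iff: "w \<in> lang u \<longleftrightarrow> (\<exists>i. w = fac u i (length w))"
proof
  assume "w \<in> lang u"
  then obtain i n where "w = fac u i n" by (auto simp: lang_def fac_def)
  then show "\<exists>i. w = fac u i (length w)" by auto
next
  assume "\<exists>i. w = fac u i (length w)"
  then show "w \<in> lang u" unfolding lang_def fac_def by blast
qed

lemma fac_in_lang [simp]: "fac u i n \<in> lang u"
  by (auto simp: lang_iff)

lemma subfactor_in_lang: "p @ w @ s \<in> lang u \<Longrightarrow> w \<in> lang u"
proof -
  assume "p @ w @ s \<in> lang u"
  then obtain i where "p @ w @ s = fac u i (length p + (length w + length s))"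
    by (auto simp: lang_iff)
  then have "w = fac u (i + length p) (length w)"
    by (simp add: fac_add)
  then show ?thesis by (auto simp: lang_iff)
qed

lemma hd_fac: "0 < n \<Longrightarrow> hd (fac u i n) = u !! i"
  by (cases n) (simp_all add: fac_def)

lemma fac_0 [simp]: "fac u i 0 = []"
  by (simp add: fac_def)

lemma stake_prefix: "n \<le> m \<Longrightarrow> stake n s = take n (stake m s)"
  by (rule nth_equalityI) simp_all

lemma stake_map: "stake i s = map ((!!) s) [0..<i]"
  by (rule nth_equalityI) simp_all

lemma fac_map: "fac s i n = map ((!!) s) [i..<i + n]"
  by (rule nth_equalityI) simp_all

lemma fac_1: "fac s i (Suc 0) = [s !! i]" "fac s i 1 = [s !! i]"
  by (simp_all add: fac_map)

lemma fac_Suc: "fac s i (Suc n) = s !! i # fac s (Suc i) n"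
  using fac_add[of s i 1 n] by (simp add: fac_1)

lemma fac_sub:
  assumes "fac s i n = fac t j n" "k + l \<le> n"
  shows "fac s (i + k) l = fac t (j + k) l"
  using assms by (auto simp: fac_eq_iff add.assoc)

section \<open>Sequences all of whose returns to symmetric palindromes are palindromes\<close>

text \<open>\<open>recurrent\<close> moves occurrences as far to the right as desired.
  \<open>letter_pal\<close> makes the last letter of any word a palindromic suffix, so that a
  longest one exists.\<close>

locale symmetric_sequence =
  fixes G :: "('a list \<Rightarrow> 'a list) set" and u :: "'a stream"
  assumes length_sym: "\<eta> \<in> G \<Longrightarrow> length (\<eta> w) = length w"
    and id_in: "id \<in> G"
    and comp_in: "\<eta> \<in> G \<Longrightarrow> \<theta> \<in> G \<Longrightarrow> \<eta> \<circ> \<theta> \<in> G"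
    and inverse_in: "\<eta> \<in> G \<Longrightarrow> \<exists>\<theta>\<in>G. \<forall>w. \<theta> (\<eta> w) = w"
    and morph_or_anti: "\<eta> \<in> G \<Longrightarrow> word_morphism \<eta> \<or> word_antimorphism \<eta>"
    and closed: "\<eta> \<in> G \<Longrightarrow> w \<in> lang u \<Longrightarrow> \<eta> w \<in> lang u"
    and recurrent: "\<exists>j\<ge>N. fac u j n = fac u i n"
    and letter_pal: "\<exists>\<Theta>\<in>G. word_antimorphism \<Theta> \<and> \<Theta> [a] = [a]"
begin

definition gpal :: "'a list \<Rightarrow> bool" where
  "gpal w \<longleftrightarrow> (\<exists>\<Theta>\<in>G. word_antimorphism \<Theta> \<and> \<Theta> w = w)"

definition cls :: "nat \<Rightarrow> nat \<Rightarrow> 'a list set" where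
  "cls n i = sym_class G (fac u i n)"

lemma self_in_class: "w \<in> sym_class G w"
  using id_in by (auto simp: sym_class_def intro!: exI[of _ id])

lemma class_image:
  assumes "\<eta> \<in> G"
  shows "sym_class G (\<eta> w) = sym_class G w"
proof -
  obtain \<theta> where \<theta>: "\<theta> \<in> G" "\<forall>w. \<theta> (\<eta> w) = w"
    using inverse_in[OF assms] by blast
  have "sym_class G (\<eta> w) \<subseteq> sym_class G w"
  proof
    fix v assume "v \<in> sym_class G (\<eta> w)"
    then obtain \<zeta> where "\<zeta> \<in> G" "v = \<zeta> (\<eta> w)" by (auto simp: sym_class_def)
    then have "\<zeta> \<circ> \<eta> \<in> G" "v = (\<zeta> \<circ> \<eta>) w" using comp_in assms by auto
    then show "v \<in> sym_class G w" unfolding sym_class_def by blast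
  qed
  moreover have "sym_class G w \<subseteq> sym_class G (\<eta> w)"
  proof
    fix v assume "v \<in> sym_class G w"
    then obtain \<zeta> where "\<zeta> \<in> G" "v = \<zeta> w" by (auto simp: sym_class_def)
    then have "\<zeta> \<circ> \<theta> \<in> G" "v = (\<zeta> \<circ> \<theta>) (\<eta> w)"
      using \<theta> comp_in by auto
    then show "v \<in> sym_class G (\<eta> w)" unfolding sym_class_def by blast
  qed
  ultimately show ?thesis by blast
qed

lemma class_eq_iff: "sym_class G v = sym_class G w \<longleftrightarrow> (\<exists>\<eta>\<in>G. v = \<eta> w)"
proof
  assume "sym_class G v = sym_class G w"
  then have "v \<in> sym_class G w" using self_in_class by blast
  then show "\<exists>\<eta>\<in>G. v = \<eta> w" by (auto simp: sym_class_def)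
qed (auto simp: class_image)

lemma anti_exists: "\<exists>\<Theta>\<in>G. word_antimorphism \<Theta>"
  using letter_pal by blast

lemma sym_fac_morph:
  assumes "\<eta> \<in> G" "word_morphism \<eta>" "\<eta> (fac u i n) = fac u i' n" "k + m \<le> n"
  shows "\<eta> (fac u (i + k) m) = fac u (i' + k) m"
proof -
  have "fac u i n = fac u i k @ fac u (i + k) m @ fac u (i + k + m) (n - k - m)" for i
    using assms(4) fac_add[of u i k "n - k"] fac_add[of u "i + k" m "n - k - m"] by simp
  then have "fac u i' k @ fac u (i' + k) m @ fac u (i' + k + m) (n - k - m)
      = \<eta> (fac u i k) @ \<eta> (fac u (i + k) m) @ \<eta> (fac u (i + k + m) (n - k - m))"
    using assms(2,3) unfolding word_morphism_def by metis
  then show ?thesis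
    using length_sym[OF assms(1)] by simp
qed

lemma sym_fac_anti:
  assumes "\<eta> \<in> G" "word_antimorphism \<eta>" "\<eta> (fac u i n) = fac u i' n" "k + m \<le> n"
  shows "\<eta> (fac u (i + k) m) = fac u (i' + n - k - m) m"
proof -
  have "fac u i n = fac u i k @ fac u (i + k) m @ fac u (i + k + m) (n - k - m)"
    using assms(4) fac_add[of u i k "n - k"] fac_add[of u "i + k" m "n - k - m"] by simp
  then have "\<eta> (fac u i n)
      = \<eta> (fac u (i + k + m) (n - k - m)) @ \<eta> (fac u (i + k) m) @ \<eta> (fac u i k)"
    using assms(2) unfolding word_antimorphism_def by simp
  moreover have "fac u i' n = fac u i' (n - k - m) @ fac u (i' + n - k - m) m @ fac u (i' + n - k) k"
    using assms(4) fac_add[of u i' "n - k - m" "m + k"] fac_add[of u "i' + n - k - m" m k]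
    by (simp add: algebra_simps)
  ultimately show ?thesis
    using length_sym[OF assms(1)] assms(3) by simp
qed

text \<open>The antimorphism that fixes a palindrome reverses the order of its factors, so a factor
  at distance \<open>k\<close> from the left end has the class of its mirror image at distance
  \<open>k\<close> from the right end.\<close>

lemma gpal_reflect:
  assumes "gpal (fac u i n)" "k + m \<le> n"
  shows "cls m (i + n - k - m) = cls m (i + k)"
proof -
  obtain \<Theta> where "\<Theta> \<in> G" "word_antimorphism \<Theta>" "\<Theta> (fac u i n) = fac u i n"
    using assms(1) by (auto simp: gpal_def)
  then have "\<Theta> (fac u (i + k) m) = fac u (i + n - k - m) m"
    using sym_fac_anti assms(2) by blast
  then show ?thesis
    unfolding cls_def using class_image[OF \<open>\<Theta> \<in> G\<close>] by metis
qed

lemma sym_letter: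
  assumes "\<eta> \<in> G" obtains b where "\<eta> [a] = [b]"
  using length_sym[OF assms, of "[a]"] by (auto simp: length_Suc_conv)

lemma sym_inj:
  assumes "\<eta> \<in> G" "\<eta> v = \<eta> w" shows "v = w"
  using inverse_in[OF assms(1)] assms(2) by metis

text \<open>An antimorphism turns left extensions into right ones, so it is the disjunction of left
  and right special that is invariant under \<open>G\<close>.\<close>

lemma special_sym:
  assumes "\<eta> \<in> G" "special u w"
  shows "special u (\<eta> w)"
proof -
  have L: "left_special u (\<eta> w) \<or> right_special u (\<eta> w)"
    if "a \<noteq> b" "a # w \<in> lang u" "b # w \<in> lang u" for a b
  proof -
    obtain a' b' where ab: "\<eta> [a] = [a']" "\<eta> [b] = [b']"
      using sym_letter[OF assms(1)] by metis
    then have ne: "a' \<noteq> b'" using that(1) sym_inj[OF assms(1), of "[a]" "[b]"] by auto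
    have in': "\<eta> ([a] @ w) \<in> lang u" "\<eta> ([b] @ w) \<in> lang u"
      using closed[OF assms(1)] that by auto
    show ?thesis
      using morph_or_anti[OF assms(1)]
    proof
      assume "word_morphism \<eta>"
      then have "a' # \<eta> w \<in> lang u" "b' # \<eta> w \<in> lang u"
        using in' ab by (simp_all only: word_morphism_def) simp_all
      then show ?thesis using ne unfolding left_special_def by blast
    next
      assume "word_antimorphism \<eta>"
      then have "\<eta> w @ [a'] \<in> lang u" "\<eta> w @ [b'] \<in> lang u"
        using in' ab by (simp_all only: word_antimorphism_def)
      then show ?thesis using ne unfolding right_special_def by blast
    qed
  qed
  have R: "left_special u (\<eta> w) \<or> right_special u (\<eta> w)"
    if "a \<noteq> b" "w @ [a] \<in> lang u" "w @ [b] \<in> lang u" for a b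
  proof -
    obtain a' b' where ab: "\<eta> [a] = [a']" "\<eta> [b] = [b']"
      using sym_letter[OF assms(1)] by metis
    then have ne: "a' \<noteq> b'" using that(1) sym_inj[OF assms(1), of "[a]" "[b]"] by auto
    have in': "\<eta> (w @ [a]) \<in> lang u" "\<eta> (w @ [b]) \<in> lang u"
      using closed[OF assms(1)] that by auto
    show ?thesis
      using morph_or_anti[OF assms(1)]
    proof
      assume "word_morphism \<eta>"
      then have "\<eta> w @ [a'] \<in> lang u" "\<eta> w @ [b'] \<in> lang u"
        using in' ab by (simp_all only: word_morphism_def)
      then show ?thesis using ne unfolding right_special_def by blast
    next
      assume "word_antimorphism \<eta>"
      then have "a' # \<eta> w \<in> lang u" "b' # \<eta> w \<in> lang u"
        using in' ab by (simp_all only: word_antimorphism_def) simp_all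
      then show ?thesis using ne unfolding left_special_def by blast
    qed
  qed
  show ?thesis
    using assms(2) closed[OF assms(1)] L R
    unfolding special_def left_special_def[of u w] right_special_def[of u w] by blast
qed

lemma special_class:
  "sym_class G v = sym_class G w \<Longrightarrow> special u v \<longleftrightarrow> special u w"
  by (metis class_eq_iff special_sym)

definition sp :: "nat \<Rightarrow> nat \<Rightarrow> bool" where
  "sp n i \<longleftrightarrow> special u (fac u i n)"

lemma sp_cls: "cls n i = cls n j \<Longrightarrow> sp n i \<longleftrightarrow> sp n j"
  unfolding cls_def sp_def by (rule special_class)

end

text \<open>Palindromic returns are assumed for classes of palindromes, the form in which
  desubstitution gives them; \<open>all_returns\<close> passes to arbitrary classes.\<close>

locale palindromic_returns = symmetric_sequence +
  assumes pal_return: "\<lbrakk>0 < n; i < j; gpal (fac u i n); cls n j = cls n i;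
      \<And>k. i < k \<Longrightarrow> k < j \<Longrightarrow> cls n k \<noteq> cls n i\<rbrakk> \<Longrightarrow> gpal (fac u i (j - i + n))"
begin

text \<open>The longest palindromic suffix of the return word starts at its beginning: otherwise
  it is either long enough to reflect the last occurrence into the interior, or its own
  previous occurrence yields a longer palindromic suffix.\<close>

lemma all_returns:
  assumes n: "0 < n" and ij: "i < j" and c: "cls n j = cls n i"
    and no: "\<And>k. i < k \<Longrightarrow> k < j \<Longrightarrow> cls n k \<noteq> cls n i"
  shows "gpal (fac u i (j - i + n))"
proof -
  \<comment> \<open>The least \<open>k\<close> with \<open>P k\<close> is the start of the longest
    palindromic suffix of the return word.\<close>
  define P where "P k \<longleftrightarrow> i \<le> k \<and> k < j + n \<and> gpal (fac u k (j + n - k))" for k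
  have "P (j + n - 1)"
    using n ij letter_pal
    by (auto simp: P_def gpal_def fac_def)
  then obtain k where k: "P k" "\<And>l. l < k \<Longrightarrow> \<not> P l"
    using LeastI[of P] not_less_Least[of _ P] by metis
  define m where "m = j + n - k"
  have km: "i \<le> k" "0 < m" "gpal (fac u k m)" "k + m = j + n"
    using k(1) by (auto simp: P_def m_def)
  have "k = i"
  proof (rule ccontr)
    assume "k \<noteq> i"
    then have ik: "i < k" using km by simp
    show False
    proof (cases "k < j")
      case True
      \<comment> \<open>A suffix longer than \<open>n\<close> has the last occurrence at its end,
        and reflection brings it to the start \<open>k\<close>.\<close>
      have "cls n (k + m - (j - k) - n) = cls n (k + (j - k))"
        using gpal_reflect[OF km(3), of "j - k" n] True km by simp
      then have "cls n k = cls n j" using True km by simp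
      then show False using no[OF ik True] c by simp
    next
      case False
      obtain \<eta> where \<eta>: "\<eta> \<in> G" "fac u i n = \<eta> (fac u j n)"
        using c unfolding cls_def by (metis class_eq_iff)
      \<comment> \<open>Here the suffix lies inside the last occurrence. The symmetry
        \<open>\<eta>\<close> carries that occurrence to the first one, which therefore contains a
        member of the class of the suffix.\<close>
      have "\<exists>k0. i \<le> k0 \<and> k0 < k \<and> cls m k0 = cls m k"
        using morph_or_anti[OF \<eta>(1)]
      proof
        assume "word_morphism \<eta>"
        then have "\<eta> (fac u (j + (k - j)) m) = fac u (i + (k - j)) m"
          using sym_fac_morph[OF \<eta>(1) _ \<eta>(2)[symmetric], of "k - j" m] False km by simp
        then have "cls m (i + (k - j)) = cls m k"
          unfolding cls_def using class_image[OF \<eta>(1)] False by (metis le_add_diff_inverse not_less)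
        then show ?thesis using ij False by (intro exI[of _ "i + (k - j)"]) auto
      next
        assume "word_antimorphism \<eta>"
        then have "\<eta> (fac u (j + (k - j)) m) = fac u (i + n - (k - j) - m) m"
          using sym_fac_anti[OF \<eta>(1) _ \<eta>(2)[symmetric], of "k - j" m] False km by simp
        moreover have "i + n - (k - j) - m = i" using False km by simp
        ultimately have "cls m i = cls m k"
          unfolding cls_def using class_image[OF \<eta>(1)] False by (metis le_add_diff_inverse not_less)
        then show ?thesis using ik by auto
      qed
      then obtain k0 where k0: "i \<le> k0" "k0 < k" "cls m k0 = cls m k" by blast
      define S where "S = {l. l < k \<and> cls m l = cls m k}"
      define k1 where "k1 = Max S"
      have fin: "finite S" by (simp add: S_def)
      have "k0 \<in> S" using k0 by (simp add: S_def)
      then have k1: "k1 \<in> S" "k0 \<le> k1" using fin unfolding k1_def by (auto intro: Max_in)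
      have no1: "cls m l \<noteq> cls m k1" if "k1 < l" "l < k" for l
      proof
        assume "cls m l = cls m k1"
        then have "l \<in> S" using k1 that by (simp add: S_def)
        then show False using that fin unfolding k1_def by (metis Max_ge not_less)
      qed
      have g: "gpal (fac u k1 m)"
      proof -
        obtain \<zeta> where z: "\<zeta> \<in> G" "fac u k1 m = \<zeta> (fac u k m)"
          using k1 unfolding S_def cls_def by (auto simp: class_eq_iff)
        obtain \<theta> where t: "\<theta> \<in> G" "\<forall>w. \<theta> (\<zeta> w) = w" using inverse_in[OF z(1)] by blast
        obtain \<Theta> where T: "\<Theta> \<in> G" "word_antimorphism \<Theta>" "\<Theta> (fac u k m) = fac u k m"
          using km(3) by (auto simp: gpal_def)
        have zz: "\<zeta> (\<theta> w) = w" for w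
          using t sym_inj[OF t(1)] by metis
        have 1: "\<zeta> \<circ> \<Theta> \<circ> \<theta> \<in> G" using comp_in z t T by blast
        have 2: "(\<zeta> \<circ> \<Theta> \<circ> \<theta>) (fac u k1 m) = fac u k1 m" using z t T by simp
        \<comment> \<open>The inverse of a morphism is a morphism and that of an antimorphism an
          antimorphism; either way the conjugate of \<open>\<Theta>\<close> reverses the
          order.\<close>
        have 3: "word_antimorphism (\<zeta> \<circ> \<Theta> \<circ> \<theta>)"
          using morph_or_anti[OF z(1)]
        proof
          assume a: "word_morphism \<zeta>"
          have "\<theta> (v @ w) = \<theta> v @ \<theta> w" for v w
            using a zz t(2) unfolding word_morphism_def by metis
          then show ?thesis using a T(2) unfolding word_antimorphism_def word_morphism_def by simp
        next
          assume a: "word_antimorphism \<zeta>"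
          have "\<theta> (v @ w) = \<theta> w @ \<theta> v" for v w
            using a zz t(2) unfolding word_antimorphism_def by metis
          then show ?thesis using a T(2) unfolding word_antimorphism_def by simp
        qed
        show ?thesis unfolding gpal_def using 1 2 3 by blast
      qed
      \<comment> \<open>The return from the last earlier occurrence \<open>k1\<close> to
        \<open>k\<close> is a palindromic suffix longer than the longest one.\<close>
      have "gpal (fac u k1 (k - k1 + m))"
        by (rule pal_return) (use k1 km g no1 in \<open>auto simp: S_def\<close>)
      then have "P k1" using k1 k0 km by (auto simp: P_def S_def m_def)
      then show False using k(2)[of k1] k1 by (simp add: S_def)
    qed
  qed
  then show ?thesis using k(1) ij by (simp add: P_def algebra_simps)
qed

end

section \<open>Edges of the graph of symmetries as intervals between consecutive special
  factors\<close>

context palindromic_returns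
begin

definition step :: "nat \<Rightarrow> nat \<Rightarrow> nat \<Rightarrow> bool" where
  "step n i j \<longleftrightarrow> i < j \<and> sp n i \<and> sp n j \<and> (\<forall>k. i < k \<and> k < j \<longrightarrow> \<not> sp n k)"

definition ecls :: "nat \<Rightarrow> nat \<Rightarrow> nat \<Rightarrow> 'a list set" where
  "ecls n i j = sym_class G (fac u i (j - i + n))"

lemma simple_path_iff:
  "simple_path u n e \<longleftrightarrow> (\<exists>i j. step n i j \<and> e = fac u i (j - i + n))"
proof
  assume e: "simple_path u n e"
  then obtain i where i: "e = fac u i (length e)"
    by (auto simp: simple_path_def lang_iff)
  define N where "N = length e"
  have e_fac: "e = fac u i N" using i by (simp add: N_def)
  have nN: "n < N" using e by (simp add: simple_path_def N_def)
  define j where "j = i + (N - n)"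
  have inner: "\<not> sp n k" if "i < k" "k < j" for k
  proof -
    have "\<not> special u (take n (drop (k - i) e))"
      using e that by (simp add: simple_path_def N_def[symmetric] j_def)
    then show ?thesis
      using that nN by (simp add: e_fac drop_fac take_fac sp_def j_def)
  qed
  have "special u (take n e)" "special u (drop (N - n) e)"
    using e by (auto simp: simple_path_def N_def)
  then have "sp n i" "sp n j"
    using nN by (auto simp: e_fac drop_fac take_fac sp_def j_def)
  with inner nN have "step n i j" by (auto simp: step_def j_def)
  moreover have "e = fac u i (j - i + n)" using e_fac nN by (simp add: j_def)
  ultimately show "\<exists>i j. step n i j \<and> e = fac u i (j - i + n)" by blast
next
  assume "\<exists>i j. step n i j \<and> e = fac u i (j - i + n)"
  then obtain i j where ij: "step n i j" and e: "e = fac u i (j - i + n)" by blast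
  have "take n (drop k e) = fac u (i + k) n" if "k \<le> j - i" for k
    using that by (simp add: e drop_fac take_fac)
  from this[of 0] this[of "j - i"] this show "simple_path u n e"
    using ij by (auto simp: simple_path_def e step_def sp_def drop_fac)
qed

lemma sym_fac_exists:
  assumes "\<eta> \<in> G"
  obtains i' where "N0 \<le> i'" "\<eta> (fac u i n) = fac u i' n"
proof -
  have "\<eta> (fac u i n) \<in> lang u" using closed[OF assms] by simp
  then obtain k where "\<eta> (fac u i n) = fac u k n"
    using length_sym[OF assms] by (auto simp: lang_iff)
  then show thesis using recurrent[of N0 n k] that by metis
qed

lemma sym_positions:
  assumes "\<eta> \<in> G" "\<eta> (fac u i N) = fac u i' N"
  shows "word_morphism \<eta> \<Longrightarrow> k + m \<le> N \<Longrightarrow> cls m (i' + k) = cls m (i + k)"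
    and "word_antimorphism \<eta> \<Longrightarrow> k + m \<le> N \<Longrightarrow> cls m (i' + N - k - m) = cls m (i + k)"
  using sym_fac_morph[OF assms(1) _ assms(2)] sym_fac_anti[OF assms(1) _ assms(2)]
    class_image[OF assms(1)]
  unfolding cls_def by metis+

lemma step_shift:
  assumes "step n i j" "\<And>k. k \<le> j - i \<Longrightarrow> cls n (i' + k) = cls n (i + k)"
  shows "step n i' (i' + (j - i))"
proof -
  have sp: "sp n (i' + k) = sp n (i + k)" if "k \<le> j - i" for k
    using assms(2)[OF that] by (rule sp_cls)
  have "\<not> sp n k" if "i' < k" "k < i' + (j - i)" for k
  proof -
    have "i < i + (k - i')" "i + (k - i') < j" using that by linarith+
    then have "\<not> sp n (i + (k - i'))" using assms(1) unfolding step_def by blast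
    then show ?thesis using sp[of "k - i'"] that by simp
  qed
  moreover have "sp n i'" "sp n (i' + (j - i))" "i' < i' + (j - i)"
    using sp[of 0] sp[of "j - i"] assms(1) by (auto simp: step_def)
  ultimately show ?thesis
    by (simp add: step_def)
qed

lemma step_reflect:
  assumes "step n i j" "\<And>k. k \<le> j - i \<Longrightarrow> cls n (i' + (j - i) - k) = cls n (i + k)"
  shows "step n i' (i' + (j - i))"
proof -
  have sp: "sp n (i' + (j - i) - k) = sp n (i + k)" if "k \<le> j - i" for k
    using assms(2)[OF that] by (rule sp_cls)
  have "\<not> sp n k" if "i' < k" "k < i' + (j - i)" for k
  proof -
    define l where "l = i' + (j - i) - k"
    have l: "l \<le> j - i" "i' + (j - i) - l = k" "i < i + l" "i + l < j"
      using that by (auto simp: l_def)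
    then have "\<not> sp n (i + l)" using assms(1) unfolding step_def by blast
    then show ?thesis using sp[of l] l by simp
  qed
  moreover have "sp n i'" "sp n (i' + (j - i))" "i' < i' + (j - i)"
    using sp[of 0] sp[of "j - i"] assms(1) by (auto simp: step_def)
  ultimately show ?thesis
    by (simp add: step_def)
qed

text \<open>Edges are undirected, but reading along positions has a direction: an antimorphism of
  \<open>G\<close> turns an occurrence of the edge round, and recurrence moves it beyond any
  \<open>N0\<close>.\<close>

lemma step_oriented:
  assumes "step n i j"
  shows "\<exists>i'\<ge>N0. \<exists>j'. step n i' j' \<and> ecls n i' j' = ecls n i j \<and> cls n i' = cls n i \<and> cls n j' = cls n j"
    and "\<exists>i'\<ge>N0. \<exists>j'. step n i' j' \<and> ecls n i' j' = ecls n i j \<and> cls n i' = cls n j \<and> cls n j' = cls n i"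
proof -
  let ?N = "j - i + n"
  have ij: "i < j" using assms by (simp add: step_def)
  obtain i' where i': "N0 \<le> i'" "fac u i' ?N = fac u i ?N"
    using recurrent by metis
  have c: "cls n (i' + k) = cls n (i + k)" if "k \<le> j - i" for k
    using sym_positions(1)[OF id_in, of i ?N i' k n] i' that
    by (simp add: word_morphism_def)
  have "step n i' (i' + (j - i))" by (rule step_shift[OF assms c])
  then show "\<exists>i'\<ge>N0. \<exists>j'. step n i' j' \<and> ecls n i' j' = ecls n i j \<and> cls n i' = cls n i \<and> cls n j' = cls n j"
    using i' c[of 0] c[of "j - i"] ij
    by (intro exI[of _ i'] conjI exI[of _ "i' + (j - i)"]) (auto simp: ecls_def)
  obtain \<Theta> where \<Theta>: "\<Theta> \<in> G" "word_antimorphism \<Theta>" using anti_exists by blast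
  obtain i'' where i'': "N0 \<le> i''" "\<Theta> (fac u i ?N) = fac u i'' ?N"
    using sym_fac_exists[OF \<Theta>(1)] by metis
  have c: "cls n (i'' + (j - i) - k) = cls n (i + k)" if "k \<le> j - i" for k
    using sym_positions(2)[OF \<Theta>(1) i''(2) \<Theta>(2), of k n] that by (simp add: algebra_simps)
  have "step n i'' (i'' + (j - i))" by (rule step_reflect[OF assms c])
  moreover have "ecls n i'' (i'' + (j - i)) = ecls n i j"
    using class_image[OF \<Theta>(1), of "fac u i ?N"] i'' by (simp add: ecls_def)
  ultimately show "\<exists>i'\<ge>N0. \<exists>j'. step n i' j' \<and> ecls n i' j' = ecls n i j \<and> cls n i' = cls n j \<and> cls n j' = cls n i"
    using i'' c[of 0] c[of "j - i"] ij
    by (intro exI[of _ i''] conjI exI[of _ "i'' + (j - i)"]) auto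
qed

abbreviation "\<Gamma> \<equiv> symmetry_graph G u"

lemma verts_iff: "X \<in> verts (\<Gamma> n) \<longleftrightarrow> (\<exists>i. sp n i \<and> X = cls n i)"
proof
  assume "X \<in> verts (\<Gamma> n)"
  then obtain w where w: "X = sym_class G w" "length w = n" "special u w"
    by (auto simp: symmetry_graph_def)
  then obtain i where "w = fac u i n" by (auto simp: special_def lang_iff)
  with w show "\<exists>i. sp n i \<and> X = cls n i" by (auto simp: sp_def cls_def)
next
  assume "\<exists>i. sp n i \<and> X = cls n i"
  then obtain i where "special u (fac u i n)" "X = sym_class G (fac u i n)"
    by (auto simp: sp_def cls_def)
  then show "X \<in> verts (\<Gamma> n)"
    unfolding symmetry_graph_def by (auto intro: exI[of _ "fac u i n"])
qed

lemma edges_iff: "c \<in> edges (\<Gamma> n) \<longleftrightarrow> (\<exists>i j. step n i j \<and> c = ecls n i j)"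
  by (auto simp: symmetry_graph_def simple_path_iff ecls_def)

text \<open>The ends do not depend on the representative of the edge: a morphism keeps their classes
  in order and an antimorphism exchanges them, hence the unordered pair.\<close>

lemma joins_iff:
  assumes "step n i j"
  shows "joins (\<Gamma> n) (ecls n i j) X Y \<longleftrightarrow> {cls n i, cls n j} = {X, Y}"
proof -
  have ij: "i < j" using assms by (simp add: step_def)
  have ends: "{sym_class G (take n e), sym_class G (drop (length e - n) e)} = {cls n i, cls n j}"
    if e_in: "e \<in> ecls n i j" for e
  proof -
    let ?N = "j - i + n"
    obtain \<eta> where \<eta>: "\<eta> \<in> G" "e = \<eta> (fac u i ?N)"
      using e_in by (auto simp: ecls_def sym_class_def)
    obtain i' where i': "e = fac u i' ?N" using sym_fac_exists[OF \<eta>(1)] \<eta>(2) by metis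
    then have "{sym_class G (take n e), sym_class G (drop (length e - n) e)}
        = {cls n i', cls n (i' + (j - i))}"
      by (simp add: cls_def take_fac drop_fac)
    also have "\<dots> = {cls n i, cls n j}"
      using morph_or_anti[OF \<eta>(1)]
    proof
      assume "word_morphism \<eta>"
      then show ?thesis
        using sym_positions(1)[OF \<eta>(1), of i ?N i' 0 n] sym_positions(1)[OF \<eta>(1), of i ?N i' "j - i" n]
          \<eta> i' ij by simp
    next
      assume "word_antimorphism \<eta>"
      then show ?thesis
        using sym_positions(2)[OF \<eta>(1), of i ?N i' 0 n] sym_positions(2)[OF \<eta>(1), of i ?N i' "j - i" n]
          \<eta> i' ij by auto
    qed
    finally show ?thesis .
  qed
  have "simple_path u n (fac u i (j - i + n))" using assms simple_path_iff by blast
  moreover have "fac u i (j - i + n) \<in> ecls n i j" by (simp add: ecls_def self_in_class)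
  ultimately show ?thesis
    using ends unfolding symmetry_graph_def by auto
qed

lemma joins_oriented:
  assumes "c \<in> edges (\<Gamma> n)" "joins (\<Gamma> n) c X Y"
  shows "\<exists>i\<ge>N0. \<exists>j. step n i j \<and> c = ecls n i j \<and> cls n i = X \<and> cls n j = Y"
proof -
  obtain i j where ij: "step n i j" "c = ecls n i j" using assms(1) edges_iff by blast
  then have "{cls n i, cls n j} = {X, Y}" using joins_iff assms(2) by simp
  then have "cls n i = X \<and> cls n j = Y \<or> cls n i = Y \<and> cls n j = X"
    by (auto simp: doubleton_eq_iff)
  then show ?thesis
    using step_oriented[OF ij(1), of N0] ij(2) by metis
qed

text \<open>\<open>linked n X c q\<close>: the last visit to \<open>X\<close> before \<open>q\<close> was left through the edge \<open>c\<close>.\<close>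

definition linked :: "nat \<Rightarrow> 'a list set \<Rightarrow> 'a list set \<Rightarrow> nat \<Rightarrow> bool" where
  "linked n X c q \<longleftrightarrow> (\<exists>p p'. p < q \<and> cls n p = X \<and> (\<forall>k. p < k \<and> k \<le> q \<longrightarrow> cls n k \<noteq> X)
      \<and> step n p p' \<and> c = ecls n p p')"

lemma next_special:
  assumes "sp n p" "p < q" "sp n q"
  obtains p' where "step n p p'" "p' \<le> q"
proof -
  define p' where "p' = (LEAST k. p < k \<and> sp n k)"
  have "p < p' \<and> sp n p'" unfolding p'_def by (rule LeastI[of _ q]) (use assms in auto)
  moreover have "\<not> (p < k \<and> sp n k)" if "k < p'" for k
    using that unfolding p'_def by (rule not_less_Least)
  moreover have "p' \<le> q" unfolding p'_def by (rule Least_le) (use assms in auto)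
  ultimately show thesis using that assms(1) by (auto simp: step_def)
qed

lemma prev_special:
  assumes "sp n p" "p < q" "sp n q"
  obtains q' where "step n q' q" "p \<le> q'"
proof -
  define S where "S = {k. k < q \<and> sp n k}"
  have "finite S" "p \<in> S" using assms by (auto simp: S_def)
  then obtain M where M: "M \<in> S" "p \<le> M" "\<And>k. k \<in> S \<Longrightarrow> k \<le> M"
    using Max_in[of S] Max_ge[of S] by blast
  have "\<not> sp n k" if "M < k" "k < q" for k
    using that M(3)[of k] by (auto simp: S_def)
  then have "step n M q" using M assms by (auto simp: step_def S_def)
  then show thesis using that M by blast
qed

lemma step_unique: "step n p p' \<Longrightarrow> step n p p'' \<Longrightarrow> p' = p''"
  unfolding step_def by (metis nat_neq_iff)

lemma last_visit:
  fixes q :: nat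
  assumes "cls n p0 = X" "p0 < q" "cls n q \<noteq> X"
  obtains p where "p0 \<le> p" "p < q" "cls n p = X" "\<And>k. p < k \<Longrightarrow> k \<le> q \<Longrightarrow> cls n k \<noteq> X"
proof -
  define S where "S = {k. k < q \<and> cls n k = X}"
  have "finite S" "p0 \<in> S" using assms by (auto simp: S_def)
  then obtain M where M: "M \<in> S" "p0 \<le> M" "\<And>k. k \<in> S \<Longrightarrow> k \<le> M"
    using Max_in[of S] Max_ge[of S] by blast
  have "cls n k \<noteq> X" if "M < k" "k \<le> q" for k
    using that M(3)[of k] assms(3) by (cases "k = q") (auto simp: S_def)
  then show thesis using that M by (auto simp: S_def)
qed

lemma first_visit:
  fixes q :: nat
  assumes "cls n r0 = X" "q < r0"
  obtains r where "q < r" "r \<le> r0" "cls n r = X" "\<And>k. q < k \<Longrightarrow> k < r \<Longrightarrow> cls n k \<noteq> X"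
proof -
  define r where "r = (LEAST k. q < k \<and> cls n k = X)"
  have "q < r \<and> cls n r = X" unfolding r_def by (rule LeastI[of _ r0]) (use assms in auto)
  moreover have "\<not> (q < k \<and> cls n k = X)" if "k < r" for k
    using that unfolding r_def by (rule not_less_Least)
  moreover have "r \<le> r0" unfolding r_def by (rule Least_le) (use assms in auto)
  ultimately show thesis using that by auto
qed

lemma linked_exists:
  assumes "cls n p0 = X" "p0 < q" "cls n q \<noteq> X" "sp n p0" "sp n q"
  shows "\<exists>c. linked n X c q"
proof -
  obtain p where p: "p0 \<le> p" "p < q" "cls n p = X" "\<And>k. p < k \<Longrightarrow> k \<le> q \<Longrightarrow> cls n k \<noteq> X"
    using last_visit assms(1-3) by metis
  then have "sp n p" using sp_cls[of n p p0] assms by simp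
  then obtain p' where "step n p p'" using next_special p assms by metis
  then show ?thesis using p unfolding linked_def by blast
qed

text \<open>Reflection in the palindrome over the positions \<open>a\<close> to \<open>b\<close>
  sends position \<open>k\<close> to \<open>a + b - k\<close>, so the same edges are met in reverse
  order.\<close>

lemma step_in_palindrome:
  assumes g: "gpal (fac u a (b - a + n))" and "a \<le> i" "step n i j" "j \<le> b"
  shows "step n (a + b - j) (a + b - i)" "ecls n (a + b - j) (a + b - i) = ecls n i j"
proof -
  have ij: "i < j" using assms(3) by (simp add: step_def)
  have c: "cls n (a + b - k) = cls n k" if "a \<le> k" "k \<le> b" for k
    using gpal_reflect[OF g, of "k - a" n] that by (simp add: algebra_simps)
  have "step n (a + b - j) (a + b - j + (j - i))"
  proof (rule step_reflect[OF assms(3)])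
    fix k assume "k \<le> j - i"
    then show "cls n (a + b - j + (j - i) - k) = cls n (i + k)"
      using c[of "i + k"] assms(2,4) ij by (simp add: algebra_simps)
  qed
  then show "step n (a + b - j) (a + b - i)" using ij assms(4) by (simp add: algebra_simps)
  have "cls (j - i + n) (a + (b - a + n) - (i - a) - (j - i + n)) = cls (j - i + n) (a + (i - a))"
    by (rule gpal_reflect[OF g]) (use assms(2,4) ij in simp)
  moreover have "a + (b - a + n) - (i - a) - (j - i + n) = a + b - j"
    using assms(2,4) ij by simp
  ultimately show "ecls n (a + b - j) (a + b - i) = ecls n i j"
    using assms(2,4) ij by (simp add: ecls_def cls_def algebra_simps)
qed

text \<open>Excursions from \<open>X\<close> start and end with the same edge, since they are palindromes; and the
  returns to the class visited at \<open>q\<close> and \<open>r\<close> carry the last edge into \<open>X\<close> to the first edge out of \<open>X\<close>.\<close>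

lemma linked_consecutive:
  assumes n: "0 < n" and qr: "q < r" and same: "cls n r = cls n q"
    and no: "\<And>k. q < k \<Longrightarrow> k < r \<Longrightarrow> cls n k \<noteq> cls n q"
    and spq: "sp n q" and ne: "cls n q \<noteq> X"
    and lq: "linked n X c q" and lr: "linked n X c' r"
  shows "c = c'"
proof -
  obtain p t where p: "p < q" "cls n p = X" "\<And>k. p < k \<Longrightarrow> k \<le> q \<Longrightarrow> cls n k \<noteq> X"
      "step n p t" "c = ecls n p t"
    using lq unfolding linked_def by blast
  obtain p' t' where p': "p' < r" "cls n p' = X" "\<And>k. p' < k \<Longrightarrow> k \<le> r \<Longrightarrow> cls n k \<noteq> X"
      "step n p' t'" "c' = ecls n p' t'"
    using lr unfolding linked_def by blast
  show ?thesis
  proof (cases "p' < q")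
    \<comment> \<open>The last visit to \<open>X\<close> before \<open>r\<close> precedes
      \<open>q\<close>, so it is also the last one before \<open>q\<close>.\<close>
    case True
    then have "\<not> p < p'" "\<not> p' < p"
      using p(1,2) p(3)[of p'] p'(2) p'(3)[of p] qr by auto
    then have "p = p'" by simp
    then show ?thesis using p p' step_unique by blast
  next
    case False
    then have qp': "q < p'" using p'(2) ne by (metis nat_neq_iff)
    obtain s where s: "q < s" "s \<le> p'" "cls n s = X" "\<And>k. q < k \<Longrightarrow> k < s \<Longrightarrow> cls n k \<noteq> X"
      using first_visit[OF p'(2) qp'] by metis
    have sps: "sp n s" using sp_cls[of n s p] s p by (simp add: step_def)
    obtain s' where s': "step n s' s" "q \<le> s'" using prev_special[OF spq s(1) sps] by metis
    have s's: "s' < s" using s' by (simp add: step_def)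
    have gqr: "gpal (fac u q (r - q + n))"
      by (rule all_returns[OF n qr same no])
    \<comment> \<open>The palindrome from \<open>q\<close> to \<open>r\<close> reflects the first
      visit \<open>s\<close> to \<open>X\<close> onto the last one \<open>p'\<close>, and with it
      the edge into \<open>s\<close> onto the edge out of \<open>p'\<close>.\<close>
    have "c' = ecls n s' s"
    proof -
      have refl: "cls n (q + r - k) = cls n k" if "q \<le> k" "k \<le> r" for k
        using gpal_reflect[OF gqr, of "k - q" n] that by (simp add: algebra_simps)
      have "cls n (q + r - s) = X" using refl[of s] s p'(1) by simp
      moreover have "q + r - s \<le> r" using s by simp
      ultimately have "\<not> p' < q + r - s" using p'(3) by blast
      moreover have "\<not> q + r - s < p'"
      proof
        assume a: "q + r - s < p'"
        then have "cls n (q + r - p') \<noteq> X" using s p' by (intro s(4)) simp_all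
        then show False using refl[of p'] qp' p' by simp
      qed
      ultimately have e: "q + r - s = p'" by simp
      have "step n (q + r - s) (q + r - s')" "ecls n (q + r - s) (q + r - s') = ecls n s' s"
        using step_in_palindrome[OF gqr s'(2) s'(1)] s p' by simp_all
      then show ?thesis using e p'(4,5) step_unique by metis
    qed
    \<comment> \<open>The excursion from \<open>p\<close> to \<open>s\<close> is a complete return
      to \<open>X\<close>, hence a palindrome: its last edge is its first.\<close>
    moreover have "c = ecls n s' s"
    proof -
      have ps: "p < s" using p s by simp
      have "cls n k \<noteq> cls n p" if "p < k" "k < s" for k
        using that p s by (cases "k \<le> q") auto
      then have g: "gpal (fac u p (s - p + n))"
        using all_returns[OF n ps] p(2) s(3) by simp
      have "step n (p + s - s) (p + s - s')" "ecls n (p + s - s) (p + s - s') = ecls n s' s"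
        using step_in_palindrome[OF g _ s'(1)] s' p by simp_all
      then show ?thesis using p(4,5) step_unique by (metis diff_add_inverse2)
    qed
    ultimately show ?thesis by simp
  qed
qed

text \<open>Induction along the visits to the class of \<open>q\<close>: from one visit to the next
  the edge is unchanged by \<open>linked_consecutive\<close>.\<close>

lemma linked_unique:
  assumes n: "0 < n" and "q \<le> r" and "cls n r = cls n q" and spq: "sp n q" and ne: "cls n q \<noteq> X"
    and lq: "linked n X c q" and "linked n X c' r"
  shows "c = c'"
  using assms(2,3,7)
proof (induction r arbitrary: c' rule: less_induct)
  case (less r)
  show ?case
  proof (cases "q = r")
    case True
    obtain p t where p: "p < q" "cls n p = X" "\<And>k. p < k \<Longrightarrow> k \<le> q \<Longrightarrow> cls n k \<noteq> X"
        "step n p t" "c = ecls n p t"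
      using lq unfolding linked_def by blast
    obtain p' t' where p': "p' < q" "cls n p' = X" "\<And>k. p' < k \<Longrightarrow> k \<le> q \<Longrightarrow> cls n k \<noteq> X"
        "step n p' t'" "c' = ecls n p' t'"
      using less.prems(3) True unfolding linked_def by blast
    have "\<not> p < p'" "\<not> p' < p"
      using p(1,2) p(3)[of p'] p'(1,2) p'(3)[of p] by auto
    then have "p = p'" by simp
    then show ?thesis using p p' step_unique by blast
  next
    case False
    then have qr: "q < r" using less.prems(1) by simp
    define S where "S = {k. k < r \<and> cls n k = cls n q}"
    have S: "finite S" "q \<in> S" using qr by (auto simp: S_def)
    then obtain q' where q': "q' \<in> S" "q \<le> q'" "\<And>k. k \<in> S \<Longrightarrow> k \<le> q'"
      using Max_in[of S] Max_ge[of S] by blast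
    have no: "cls n k \<noteq> cls n q'" if "q' < k" "k < r" for k
      using that q'(1) q'(3)[of k] by (auto simp: S_def)
    have c: "cls n q' = cls n q" and q'r: "q' < r" using q' by (auto simp: S_def)
    obtain p where p: "p < q" "cls n p = X" "sp n p"
      using lq unfolding linked_def step_def by blast
    obtain c'' where c'': "linked n X c'' q'"
      using linked_exists[OF p(2) _ _ p(3), of q'] p(1) q'(2) c ne sp_cls[OF c] spq by auto
    have "c = c''" using less.IH[OF q'r q'(2) c c''] .
    moreover have "c'' = c'"
      using linked_consecutive[OF n q'r _ no _ _ c'' less.prems(3)] c ne sp_cls[OF c] spq less.prems(2)
      by simp
    ultimately show ?thesis by simp
  qed
qed

section \<open>Loops, connectedness and absence of cycles\<close>

lemma is_loop_iff:
  assumes "step n i j"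
  shows "is_loop (\<Gamma> n) (ecls n i j) \<longleftrightarrow> cls n i = cls n j"
  using assms by (auto simp: is_loop_def joins_iff verts_iff step_def)

text \<open>No special factor occurs inside a step, so a step between two members of one class is a
  complete return to that class.\<close>

lemma loop_palindrome:
  assumes "0 < n" "c \<in> edges (\<Gamma> n)" "is_loop (\<Gamma> n) c" "e \<in> c"
  shows "gpal e"
proof -
  obtain X where "joins (\<Gamma> n) c X X" using assms(3) by (auto simp: is_loop_def)
  from assms(2) obtain i j where ij: "step n i j" "c = ecls n i j" using edges_iff by blast
  obtain \<eta> where \<eta>: "\<eta> \<in> G" "e = \<eta> (fac u i (j - i + n))"
    using assms(4) ij by (auto simp: ecls_def sym_class_def)
  then obtain i' where i': "e = fac u i' (j - i + n)" using sym_fac_exists by metis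
  let ?j' = "i' + (j - i)"
  have cc: "cls n i = cls n j" using is_loop_iff ij assms(3) by simp
  have ij': "i < j" using ij by (simp add: step_def)
  have e: "step n i' ?j'" "cls n i' = cls n ?j'"
    using morph_or_anti[OF \<eta>(1)]
  proof -
    show "step n i' ?j'"
      using morph_or_anti[OF \<eta>(1)]
    proof
      assume m: "word_morphism \<eta>"
      show ?thesis
        by (rule step_shift[OF ij(1)])
          (use sym_positions(1)[OF \<eta>(1), of i "j - i + n" i' _ n] m \<eta> i' in simp)
    next
      assume m: "word_antimorphism \<eta>"
      show ?thesis
        by (rule step_reflect[OF ij(1)])
          (use sym_positions(2)[OF \<eta>(1), of i "j - i + n" i' _ n] m \<eta> i' in \<open>simp add: algebra_simps\<close>)
    qed
    show "cls n i' = cls n ?j'"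
      using morph_or_anti[OF \<eta>(1)]
    proof
      assume "word_morphism \<eta>"
      then show ?thesis
        using sym_positions(1)[OF \<eta>(1), of i "j - i + n" i' 0 n]
          sym_positions(1)[OF \<eta>(1), of i "j - i + n" i' "j - i" n] \<eta> i' ij' cc by simp
    next
      assume "word_antimorphism \<eta>"
      then show ?thesis
        using sym_positions(2)[OF \<eta>(1), of i "j - i + n" i' 0 n]
          sym_positions(2)[OF \<eta>(1), of i "j - i + n" i' "j - i" n] \<eta> i' ij' cc by simp
    qed
  qed
  have "gpal (fac u i' (?j' - i' + n))"
  proof (rule all_returns[OF assms(1)])
    fix k assume "i' < k" "k < ?j'"
    then show "cls n k \<noteq> cls n i'" using e(1) sp_cls[of n k i'] by (auto simp: step_def)
  qed (use e ij' in auto)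
  then show ?thesis using i' by simp
qed

lemma walk_snoc:
  assumes "is_walk g vs es" "joins g e (last vs) y" "y \<in> verts g" "e \<in> edges g"
  shows "is_walk g (vs @ [y]) (es @ [e])"
proof -
  have l: "length vs = Suc (length es)" using assms(1) by (simp add: is_walk_def)
  then have "last vs = vs ! length es" by (metis diff_Suc_1 last_conv_nth length_0_conv nat.simps(3))
  then show ?thesis
    using assms l by (auto simp: is_walk_def nth_append less_Suc_eq)
qed

text \<open>Reading the sequence from left to right is a walk through consecutive special factors;
  steps within one class are loops and are skipped.\<close>

lemma connected_walk:
  assumes "sp n p" "p \<le> q" "sp n q"
  shows "\<exists>vs es. is_walk (remove_loops (\<Gamma> n)) vs es \<and> hd vs = cls n p \<and> last vs = cls n q"
  using assms(2,3)
proof (induction q rule: less_induct)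
  case (less q)
  have vq: "cls n k \<in> verts (remove_loops (\<Gamma> n))" if "sp n k" for k
    using that by (auto simp: remove_loops_def verts_iff)
  show ?case
  proof (cases "p = q")
    case True
    then show ?thesis
      using vq[OF assms(1)] by (intro exI[of _ "[cls n p]"] exI[of _ "[]"]) (simp add: is_walk_def)
  next
    case False
    then obtain q' where q': "step n q' q" "p \<le> q'"
      using prev_special[OF assms(1), of q] less.prems by auto
    then have q'q: "q' < q" "sp n q'" by (auto simp: step_def)
    then obtain vs es where w: "is_walk (remove_loops (\<Gamma> n)) vs es" "hd vs = cls n p" "last vs = cls n q'"
      using less.IH q' by blast
    show ?thesis
    proof (cases "cls n q' = cls n q")
      case True
      then show ?thesis using w by auto
    next
      case False
      then have "\<not> is_loop (\<Gamma> n) (ecls n q' q)" using is_loop_iff q' by simp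
      then have "ecls n q' q \<in> edges (remove_loops (\<Gamma> n))"
        using q' by (auto simp: remove_loops_def edges_iff)
      moreover have "joins (remove_loops (\<Gamma> n)) (ecls n q' q) (last vs) (cls n q)"
        using joins_iff[OF q'(1)] w by (simp add: remove_loops_def)
      ultimately have "is_walk (remove_loops (\<Gamma> n)) (vs @ [cls n q]) (es @ [ecls n q' q])"
        using walk_snoc[OF w(1)] vq less.prems by blast
      moreover have "vs \<noteq> []" using w by (auto simp: is_walk_def)
      ultimately show ?thesis using w by (metis hd_append last_snoc)
    qed
  qed
qed

text \<open>Follow the cycle from \<open>X\<close>. Between inner vertices there is no new visit to
  \<open>X\<close>, so by \<open>uniq\<close> every inner vertex stays linked to \<open>X\<close>
  through the first edge. The last edge, turned round, also leads from \<open>X\<close> to the last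
  inner vertex, so it equals the first one, although the edges of a cycle are distinct.\<close>

lemma no_cycle:
  assumes n: "0 < n"
  shows "\<not> is_cycle (remove_loops (\<Gamma> n)) vs es"
proof
  assume cyc: "is_cycle (remove_loops (\<Gamma> n)) vs es"
  define k where "k = length es"
  have len: "length vs = Suc k" and k0: "0 < k" and d: "distinct (tl vs)" "distinct es"
    and hl: "hd vs = last vs" and v: "set vs \<subseteq> verts (\<Gamma> n)"
    using cyc by (auto simp: is_cycle_def is_walk_def k_def remove_loops_def)
  have e: "es ! i \<in> edges (\<Gamma> n)" "\<not> is_loop (\<Gamma> n) (es ! i)"
    "joins (\<Gamma> n) (es ! i) (vs ! i) (vs ! Suc i)" if "i < k" for i
  proof -
    have "set es \<subseteq> edges (remove_loops (\<Gamma> n))"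
      using cyc by (simp add: is_cycle_def is_walk_def)
    moreover have "es ! i \<in> set es" using that by (simp add: k_def)
    ultimately have "es ! i \<in> edges (remove_loops (\<Gamma> n))" by (rule subsetD)
    then show "es ! i \<in> edges (\<Gamma> n)" "\<not> is_loop (\<Gamma> n) (es ! i)"
      "joins (\<Gamma> n) (es ! i) (vs ! i) (vs ! Suc i)"
      using cyc that by (auto simp: is_cycle_def is_walk_def k_def remove_loops_def)
  qed
  define X where "X = vs ! 0"
  have X: "vs ! 0 = X" "vs ! k = X"
  proof -
    have "vs \<noteq> []" using len by auto
    then show "vs ! 0 = X" "vs ! k = X"
      using hl len by (simp_all add: X_def hd_conv_nth last_conv_nth)
  qed
  have neX: "vs ! i \<noteq> X" if "0 < i" "i < k" for i
  proof -
    have "tl vs ! (i - 1) \<noteq> tl vs ! (k - 1)"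
      using d(1) that len by (subst nth_eq_iff_index_eq) auto
    then show ?thesis using that X len by (simp add: nth_tl)
  qed
  have Xv: "X \<in> verts (\<Gamma> n)" using v len X by (metis nth_mem subsetD zero_less_Suc)
  then obtain x0 where x0: "sp n x0" "cls n x0 = X" by (auto simp: verts_iff)
  have k2: "2 \<le> k"
  proof (rule ccontr)
    assume "\<not> 2 \<le> k"
    then have "k = 1" using k0 by simp
    then have "joins (\<Gamma> n) (es ! 0) X X" using e(3)[of 0] X by simp
    then show False using e(2)[of 0] k0 Xv by (auto simp: is_loop_def)
  qed
  have linked_step: "linked n X c q" if "step n p q" "cls n p = X" "cls n q \<noteq> X" "c = ecls n p q" for c p q
  proof -
    have "cls n j \<noteq> X" if "p < j" "j \<le> q" for j
      using that \<open>step n p q\<close> sp_cls[of n j p] \<open>cls n p = X\<close> \<open>cls n q \<noteq> X\<close>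
      by (cases "j = q") (auto simp: step_def)
    then show ?thesis using that unfolding linked_def by (auto simp: step_def)
  qed
  have uniq: "c = c'" if "linked n X c q" "linked n X c' r" "cls n q = cls n r" "cls n q \<noteq> X" "sp n q" for c c' q r
  proof (cases "q \<le> r")
    case True
    then show ?thesis using linked_unique[OF n True _ that(5,4,1,2)] that by simp
  next
    case False
    then have "r \<le> q" "sp n r" "cls n r \<noteq> X" using that sp_cls[of n q r] by simp_all
    then show ?thesis using linked_unique[OF n \<open>r \<le> q\<close> that(3) _ _ that(2,1)] by simp
  qed
  have main: "\<exists>q. sp n q \<and> cls n q = vs ! i \<and> linked n X (es ! 0) q" if "0 < i" "i < k" for i
    using that
  proof (induction i)
    case (Suc i)
    show ?case
    proof (cases "i = 0")
      case True
      obtain p q where "step n p q" "es ! 0 = ecls n p q" "cls n p = X" "cls n q = vs ! 1"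
        using joins_oriented[OF e(1)[of 0] e(3)[of 0], of 0] k0 X by auto
      moreover have "vs ! 1 \<noteq> X" using neX[of 1] k2 by simp
      ultimately show ?thesis
        using linked_step[of p q] True by (intro exI[of _ q]) (auto simp: step_def)
    next
      case False
      then obtain q where q: "sp n q" "cls n q = vs ! i" "linked n X (es ! 0) q" using Suc by auto
      \<comment> \<open>Taken to the right of \<open>x0\<close>, so that some visit to
        \<open>X\<close> precedes \<open>r\<close>.\<close>
      obtain r r' where r: "Suc x0 \<le> r" "step n r r'" "cls n r = vs ! i" "cls n r' = vs ! Suc i"
        using joins_oriented[OF e(1)[of i] e(3)[of i], of "Suc x0"] Suc.prems by auto
      have neq: "vs ! i \<noteq> X" "vs ! Suc i \<noteq> X" using neX False Suc.prems by auto
      have spr: "sp n r" "sp n r'" "r < r'" using r by (auto simp: step_def)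
      obtain c where c: "linked n X c r"
        using linked_exists[OF x0(2) _ _ x0(1) spr(1)] r neq by auto
      then have "c = es ! 0" using uniq[OF c q(3)] r q neq spr by simp
      then obtain p p' where p: "p < r" "cls n p = X" "\<And>j. p < j \<Longrightarrow> j \<le> r \<Longrightarrow> cls n j \<noteq> X"
          "step n p p'" "es ! 0 = ecls n p p'"
        using c unfolding linked_def by blast
      have "cls n j \<noteq> X" if "p < j" "j \<le> r'" for j
      proof (cases "j \<le> r \<or> j = r'")
        case True
        then show ?thesis using p that r neq by auto
      next
        case False
        then have "\<not> sp n j" using r(2) that by (auto simp: step_def)
        then show ?thesis using sp_cls[of n j x0] x0 by auto
      qed
      then have "linked n X (es ! 0) r'" using p spr unfolding linked_def by (metis less_trans)
      then show ?thesis using spr r by blast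
    qed
  qed simp
  obtain q where q: "sp n q" "cls n q = vs ! (k - 1)" "linked n X (es ! 0) q"
    using main[of "k - 1"] k2 by auto
  have kne: "vs ! (k - 1) \<noteq> X" using neX k2 by simp
  obtain j i where ji: "step n i j" "es ! (k - 1) = ecls n i j" "cls n i = vs ! (k - 1)" "cls n j = X"
    using joins_oriented[OF e(1)[of "k - 1"] e(3)[of "k - 1"], of 0] k2 X by auto
  obtain j' i' where "step n i' j'" "es ! (k - 1) = ecls n i' j'" "cls n i' = X" "cls n j' = vs ! (k - 1)"
    using step_oriented(2)[OF ji(1), of 0] ji by metis
  then have "linked n X (es ! (k - 1)) j'" "cls n j' = vs ! (k - 1)"
    using linked_step kne by metis+
  then have "es ! 0 = es ! (k - 1)" using uniq[OF q(3)] q kne by metis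
  moreover have "0 < length es" "k - 1 < length es" using k2 by (auto simp: k_def)
  ultimately have "0 = k - 1" using nth_eq_iff_index_eq[OF d(2)] by blast
  then show False using k2 by simp
qed

theorem rich_graphs:
  assumes n: "0 < n" and "\<exists>w. length w = n \<and> special u w"
  shows "is_tree (remove_loops (\<Gamma> n))"
    and "\<lbrakk>c \<in> edges (\<Gamma> n); is_loop (\<Gamma> n) c; e \<in> c\<rbrakk> \<Longrightarrow> \<exists>\<Theta>\<in>G. word_antimorphism \<Theta> \<and> \<Theta> e = e"
proof -
  have v: "verts (remove_loops (\<Gamma> n)) = verts (\<Gamma> n)" by (simp add: remove_loops_def)
  have "verts (\<Gamma> n) \<noteq> {}" using assms(2) by (auto simp: symmetry_graph_def)
  moreover have "\<exists>vs es. is_walk (remove_loops (\<Gamma> n)) vs es \<and> hd vs = X \<and> last vs = Y"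
    if XY: "X \<in> verts (\<Gamma> n)" "Y \<in> verts (\<Gamma> n)" for X Y
  proof -
    obtain p where p: "sp n p" "X = cls n p" using XY by (auto simp: verts_iff)
    obtain q0 where q0: "sp n q0" "Y = cls n q0" using XY by (auto simp: verts_iff)
    obtain q where q: "p \<le> q" "fac u q n = fac u q0 n" using recurrent by blast
    then have "Y = cls n q" "sp n q" using q0 by (auto simp: cls_def sp_def)
    then show ?thesis using connected_walk[OF p(1) q(1)] p by auto
  qed
  ultimately show "is_tree (remove_loops (\<Gamma> n))"
    using no_cycle[OF n] by (auto simp: is_tree_def multigraph_connected_def v)
qed (use loop_palindrome[OF n] in \<open>auto simp: gpal_def\<close>)

end

section \<open>Sequences coded by blocks\<close>

text \<open>Blocks depend on the index and not on a letter, so that a block can carry the sign of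
  its position. The locale serves for \<open>X\<close> over itself and for \<open>y_seq\<close> and
  \<open>z_seq\<close> over \<open>X\<close>.\<close>

locale coded =
  fixes s :: "'a stream" and blk :: "nat \<Rightarrow> 'a list"
  assumes blk_ne: "blk i \<noteq> []"
    and prefix: "stake (length (concat (map blk [0..<i]))) s = concat (map blk [0..<i])"
begin

definition pos :: "nat \<Rightarrow> nat" where
  "pos i = length (concat (map blk [0..<i]))"

lemma pos_0 [simp]: "pos 0 = 0"
  by (simp add: pos_def)

lemma pos_Suc: "pos (Suc i) = pos i + length (blk i)"
  by (simp add: pos_def)

lemma pos_less: "i < j \<Longrightarrow> pos i < pos j"
  by (rule lift_Suc_mono_less) (use blk_ne in \<open>simp_all add: pos_Suc\<close>)

lemma pos_less_iff [simp]: "pos i < pos j \<longleftrightarrow> i < j"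
  using pos_less by (metis nat_neq_iff order_less_asym')

lemma pos_le_iff [simp]: "pos i \<le> pos j \<longleftrightarrow> i \<le> j"
  by (meson not_less pos_less_iff)

lemma pos_eq_iff [simp]: "pos i = pos j \<longleftrightarrow> i = j"
  by (metis nat_neq_iff pos_less)

lemma pos_ge: "i \<le> pos i"
proof (induction i)
  case (Suc i)
  have "pos i < pos (Suc i)" by simp
  then show ?case using Suc by linarith
qed simp

lemma snth_pos:
  assumes "k < length (blk i)" shows "s !! (pos i + k) = blk i ! k"
proof -
  have "stake (pos i + length (blk i)) s = concat (map blk [0..<i]) @ blk i"
    using prefix[of "Suc i"] by (simp add: pos_def)
  then have "stake (pos i + length (blk i)) s ! (pos i + k) = blk i ! k"
    by (simp add: nth_append pos_def)
  then show ?thesis using assms by simp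
qed

lemma pos_cases:
  obtains i k where "j = pos i + k" "k < length (blk i)"
proof -
  have "\<exists>i k. j = pos i + k \<and> k < length (blk i)"
  proof (induction j)
    case 0
    then show ?case using blk_ne by (intro exI[of _ 0]) simp
  next
    case (Suc j)
    then obtain i k where ik: "j = pos i + k" "k < length (blk i)" by blast
    show ?case
    proof (cases "Suc k < length (blk i)")
      case True
      then show ?thesis using ik by (metis add_Suc_right)
    next
      case False
      then have "Suc j = pos (Suc i) + 0" using ik by (simp add: pos_Suc)
      then show ?thesis using blk_ne by blast
    qed
  qed
  then show thesis using that by blast
qed

lemma fac_pos: "i \<le> j \<Longrightarrow> fac s (pos i) (pos j - pos i) = concat (map blk [i..<j])"
proof (induction j rule: dec_induct)
  case (step j)
  have e: "pos (Suc j) - pos i = (pos j - pos i) + length (blk j)"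
    using step.hyps(1) by (simp add: pos_Suc)
  have "fac s (pos j) (length (blk j)) = blk j"
    by (rule nth_equalityI) (simp_all add: snth_pos)
  then have "fac s (pos i) (pos (Suc j) - pos i) = concat (map blk [i..<j]) @ blk j"
    unfolding e fac_add using step.IH step.hyps(1) by simp
  then show ?case using step.hyps(1) by simp
qed simp

end

section \<open>Reversal palindromes in terms of positions\<close>

definition pal :: "'a list \<Rightarrow> bool" where
  "pal w \<longleftrightarrow> rev w = w"

lemma pal_fac_iff: "pal (fac s i n) \<longleftrightarrow> (\<forall>k<n. s !! (i + k) = s !! (i + (n - 1 - k)))"
  unfolding pal_def by (auto simp: list_eq_iff_nth_eq rev_nth)

lemma pal_trim:
  assumes "pal (fac s i n)" "2 * d \<le> n"
  shows "pal (fac s (i + d) (n - 2 * d))"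
  unfolding pal_fac_iff
proof (intro allI impI)
  fix k assume k: "k < n - 2 * d"
  then have "s !! (i + (d + k)) = s !! (i + (n - 1 - (d + k)))"
    using assms by (simp add: pal_fac_iff)
  moreover have "n - 1 - (d + k) = d + (n - 2 * d - 1 - k)" using k assms(2) by simp
  ultimately show "s !! (i + d + k) = s !! (i + d + (n - 2 * d - 1 - k))"
    by (simp add: add.assoc)
qed

lemma pal_extend:
  assumes "pal (fac s (i + a) M)" "\<And>k. k < a \<Longrightarrow> s !! (i + k) = s !! (i + (M + 2 * a - 1 - k))"
  shows "pal (fac s i (M + 2 * a))"
  unfolding pal_fac_iff
proof (intro allI impI)
  fix k assume k: "k < M + 2 * a"
  consider "k < a" | "a \<le> k" "k < a + M" | "a + M \<le> k" by linarith
  then show "s !! (i + k) = s !! (i + (M + 2 * a - 1 - k))"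
  proof cases
    case 2
    then have "s !! (i + a + (k - a)) = s !! (i + a + (M - 1 - (k - a)))"
      using assms(1)[unfolded pal_fac_iff, rule_format, of "k - a"] by simp
    moreover have "i + a + (k - a) = i + k" "i + a + (M - 1 - (k - a)) = i + (M + 2 * a - 1 - k)"
      using 2 by auto
    ultimately show ?thesis by (simp only:)
  next
    case 3
    then have "M + 2 * a - 1 - (M + 2 * a - 1 - k) = k" "M + 2 * a - 1 - k < a" using k by auto
    then show ?thesis using assms(2)[of "M + 2 * a - 1 - k"] by (simp only:)
  qed (rule assms(2))
qed

declare snth.simps [simp del]

section \<open>The fixed point of \<open>f\<close>\<close>

definition X :: "letter stream" where
  "X = omega_power f_morphism L0"

lemma stake_X: "stake (length ((f_morphism ^^ n) [L0])) X = (f_morphism ^^ n) [L0]"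
  using theI'[OF ex1_omega_power_f] unfolding X_def omega_power_def by blast

lemma f_morphism_simps [simp]:
  "f_morphism [] = []" "f_morphism (a # w) = f_letter a @ f_morphism w"
  by (simp_all add: morphic_extension_def)

lemma stake_f_morphism:
  "stake (length (f_morphism (stake i X))) X = f_morphism (stake i X)"
proof -
  let ?F = "\<lambda>n. (f_morphism ^^ n) [L0]"
  have "i \<le> length (?F i)" using length_f_pow[of i] by simp
  then have "stake i X = take i (?F i)"
    using stake_prefix[of i "length (?F i)" X] stake_X[of i] by simp
  then have "?F i = stake i X @ drop i (?F i)" by simp
  then have "?F (Suc i) = f_morphism (stake i X) @ f_morphism (drop i (?F i))"
    by (metis f_morphism_append funpow.simps(2) comp_apply)
  then have F: "stake (length (?F (Suc i))) X = f_morphism (stake i X) @ f_morphism (drop i (?F i))"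
    using stake_X[of "Suc i"] by simp
  define m where "m = length (f_morphism (stake i X))"
  have "m \<le> length (?F (Suc i))"
    unfolding m_def using F by (metis length_append length_stake le_add1)
  then have "stake m X = take m (stake (length (?F (Suc i))) X)" by (rule stake_prefix)
  also have "\<dots> = f_morphism (stake i X)" unfolding F by (simp add: m_def)
  finally show ?thesis by (simp only: m_def)
qed

interpretation X: coded X "\<lambda>i. f_letter (X !! i)"
proof
  show "f_letter (X !! i) \<noteq> []" for i by (cases "X !! i") simp_all
  have "concat (map (\<lambda>i. f_letter (X !! i)) [0..<i]) = f_morphism (stake i X)" for i
    by (simp add: stake_map morphic_extension_def comp_def)
  then show "stake (length (concat (map (\<lambda>i. f_letter (X !! i)) [0..<i]))) X
      = concat (map (\<lambda>i. f_letter (X !! i)) [0..<i])" for i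
    using stake_f_morphism by simp
qed

lemma fac_X_pos: "fac X (X.pos p) (X.pos (p + m) - X.pos p) = f_morphism (fac X p m)"
proof -
  have "fac X (X.pos p) (X.pos (p + m) - X.pos p) = concat (map (\<lambda>i. f_letter (X !! i)) [p..<p + m])"
    by (rule X.fac_pos) simp
  also have "\<dots> = f_morphism (fac X p m)"
    by (simp add: fac_map morphic_extension_def comp_def)
  finally show ?thesis .
qed

lemma X_pos [simp]: "X !! X.pos p = L0"
  using X.snth_pos[of 0 p] by (cases "X !! p") simp_all

lemma X_pos1: "X !! Suc (X.pos p) = (if X !! p = L0 then L1 else L2)"
  using X.snth_pos[of 1 p] by (cases "X !! p") simp_all

lemma X_pos2: "X !! p = L1 \<Longrightarrow> X !! (X.pos p + 2) = L2"
  using X.snth_pos[of 2 p] by simp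

lemma X_pos_Suc: "X.pos (Suc p) = X.pos p + (if X !! p = L1 then 3 else 2)"
  by (cases "X !! p") (simp_all add: X.pos_Suc)

lemma X_L0D: assumes "X !! i = L0" obtains p where "i = X.pos p"
proof -
  obtain p k where pk: "i = X.pos p + k" "k < length (f_letter (X !! p))" by (rule X.pos_cases)
  then have "f_letter (X !! p) ! k = L0" using X.snth_pos[of k p] assms by simp
  then have "k = 0" using pk by (cases "X !! p") (auto simp: less_Suc_eq nth_Cons split: nat.splits)
  then show thesis using that pk by simp
qed

lemma X_after_L0: "X !! i = L0 \<Longrightarrow> X !! Suc i \<noteq> L0"
  using X_pos1 by (metis X_L0D letter.distinct(1,3))

lemma X_L1D:
  assumes "X !! i = L1" obtains p where "i = Suc (X.pos p)" "X !! p = L0"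
proof -
  obtain p k where pk: "i = X.pos p + k" "k < length (f_letter (X !! p))" by (rule X.pos_cases)
  then have "f_letter (X !! p) ! k = L1" using X.snth_pos[of k p] assms by simp
  then have "k = 1 \<and> X !! p = L0"
    using pk by (cases "X !! p") (auto simp: less_Suc_eq nth_Cons split: nat.splits)
  then show thesis using that pk by simp
qed

lemma X_around_L1:
  assumes "X !! Suc i = L1" shows "X !! i = L0" "X !! Suc (Suc i) = L0"
proof -
  obtain p where p: "Suc i = Suc (X.pos p)" "X !! p = L0" using X_L1D[OF assms] by blast
  then have "Suc (Suc i) = X.pos (Suc p)" by (simp add: X_pos_Suc)
  then show "X !! i = L0" "X !! Suc (Suc i) = L0" using p X_pos by auto
qed

lemma X_after_L1: "X !! i = L1 \<Longrightarrow> X !! Suc i = L0"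
  using X_pos[of 0] X_around_L1(2) by (cases i) auto

lemma X_before_L2: "X !! Suc i = L2 \<Longrightarrow> X !! i \<noteq> L1"
  using X_after_L1[of i] by auto

lemma X_before_pos:
  "X !! (X.pos (Suc p) - 1) = (if X !! p = L0 then L1 else L2)"
  using X_pos1[of p] X_pos2[of p] by (cases "X !! p") (simp_all add: X_pos_Suc)

lemma X_before2_pos:
  "X !! (X.pos (Suc p) - 2) = (if X !! p = L1 then L2 else L0)"
  using X_pos1[of p] X_pos[of p] by (cases "X !! p") (simp_all add: X_pos_Suc)

text \<open>Every image starts with its only letter \<open>0\<close>, so the \<open>0\<close> after
  \<open>f(v)\<close> shows where the last image ends; without it \<open>02\<close> could be a
  proper prefix of \<open>022\<close>.\<close>

lemma X_decode:
  "fac X (X.pos p) (length (f_morphism v) + 1) = f_morphism v @ [L0] \<Longrightarrow> fac X p (length v) = v"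
proof (induction v arbitrary: p)
  case (Cons a v)
  let ?n = "length (f_morphism v) + 1"
  have eq: "f_letter a @ f_morphism v @ [L0]
      = fac X (X.pos p) (length (f_letter a)) @ fac X (X.pos p + length (f_letter a)) ?n"
    using Cons.prems by (simp add: fac_add[symmetric] add.assoc)
  then have a: "f_letter a = fac X (X.pos p) (length (f_letter a))"
    and v: "fac X (X.pos p + length (f_letter a)) ?n = f_morphism v @ [L0]"
    by (auto dest: append_eq_append_conv[THEN iffD1, rotated])
  have nx: "X !! (X.pos p + length (f_letter a)) = L0"
  proof -
    have "hd (f_morphism v @ [L0]) = L0"
    proof (cases v)
      case (Cons b w)
      then show ?thesis by (cases b) simp_all
    qed simp
    moreover have "hd (fac X (X.pos p + length (f_letter a)) ?n) = X !! (X.pos p + length (f_letter a))"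
      by (simp add: hd_fac)
    ultimately show ?thesis using v by simp
  qed
  have "X !! p = a"
  proof -
    have "f_letter a ! k = X !! (X.pos p + k)" if "k < length (f_letter a)" for k
      using that a by (metis nth_fac)
    from this[of 1] this[of 2] show ?thesis
      using nx X_pos1[of p] X_pos2[of p] X_pos[of "Suc p"] X_pos_Suc[of p]
      by (cases a; cases "X !! p") (simp_all add: numeral_2_eq_2 numeral_3_eq_3)
  qed
  then have "X.pos p + length (f_letter a) = X.pos (Suc p)" by (simp add: X.pos_Suc)
  then have "fac X (Suc p) (length v) = v" using Cons.IH v by simp
  then show ?case using fac_add[of X p 1 "length v"] \<open>X !! p = a\<close> by (simp add: fac_map)
qed simp

lemma f_morphism_ne: "f_letter a \<noteq> []"
  by (cases a) simp_all

text \<open>Letterwise \<open>0 rev(f(a)) = f(a) 0\<close>. Together with injectivity,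
  \<open>f(v) 0\<close> is a palindrome exactly for palindromes \<open>v\<close>; hence images are
  taken together with the next \<open>0\<close>.\<close>

lemma rev_f_morphism: "rev (f_morphism w @ [L0]) = f_morphism (rev w) @ [L0]"
proof (induction w)
  case (Cons a w)
  have "L0 # rev (f_letter a) = f_letter a @ [L0]" by (cases a) simp_all
  then show ?case
    using Cons by (simp add: f_morphism_append)
qed simp

lemma f_morphism_length: "2 * length w \<le> length (f_morphism w)"
proof (induction w)
  case (Cons a w)
  then show ?case by (cases a) simp_all
qed simp

lemma f_morphism_inj: "f_morphism v = f_morphism w \<Longrightarrow> v = w"
proof (induction v arbitrary: w)
  case Nil
  then show ?case using f_morphism_ne by (cases w) auto
next
  case (Cons a v)
  then obtain b w' where w: "w = b # w'"
    using f_morphism_ne[of a] by (cases w) auto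
  have *: "f_morphism u \<noteq> L2 # t" for u t
  proof (cases u)
    case (Cons c u')
    then show ?thesis by (cases c) simp_all
  qed simp
  have "a = b \<and> f_morphism v = f_morphism w'"
    using Cons.prems *[of v] *[of w'] *[of v, symmetric] *[of w', symmetric]
    unfolding w by (cases a; cases b) simp_all
  then show ?case using Cons.IH w by blast
qed

text \<open>The parity of the number of letters \<open>2\<close> in a prefix decides which of the two alphabets a block of
  the ternary sequence starts with.\<close>

primrec sg :: "nat \<Rightarrow> bool" where
  "sg 0 = False"
| "sg (Suc i) = (sg i \<noteq> (X !! i = L2))"

text \<open>The images of \<open>0\<close>, \<open>1\<close>, \<open>2\<close> contain no, two and
  one letter \<open>2\<close>, so \<open>f\<close> preserves the parity.\<close>

lemma sg_pos: "sg (X.pos p) = sg p"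
proof (induction p)
  case (Suc p)
  have "sg (X.pos p + 2) = (sg (X.pos p) \<noteq> (X !! p \<noteq> L0))"
    using X_pos1[of p] by (simp add: numeral_2_eq_2)
  moreover have "sg (X.pos p + 3) = sg (X.pos p)" if "X !! p = L1"
  proof -
    have "X.pos p + 3 = Suc (Suc (Suc (X.pos p)))" "X !! Suc (Suc (X.pos p)) = L2"
      using X_pos2[OF that] by simp_all
    then show ?thesis using X_pos1[of p] X_pos[of p] that by (simp only: sg.simps) simp
  qed
  ultimately show ?case
    using Suc by (cases "X !! p") (simp_all add: X_pos_Suc)
qed simp

text \<open>Letters \<open>2\<close> occur arbitrarily far out, so both signs do;
  \<open>X.pos\<close> preserves signs, so each \<open>f^k(0)\<close> occurs with both signs
  arbitrarily far out. Every factor lies in such a prefix of \<open>X\<close>, and the signs inside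
  a copy differ from those inside the prefix by a constant.\<close>

lemma X_recurrent_sg: "\<exists>j\<ge>N. fac X j n = fac X i n \<and> sg j = b"
proof -
  let ?F = "\<lambda>k. (f_morphism ^^ k) [L0]"
  have F: "\<exists>j\<ge>N. fac X j (length (?F k)) = ?F k \<and> sg j = b" for k N b
  proof (induction k arbitrary: N)
    case 0
    have "\<exists>q\<ge>N. X !! q \<noteq> L0" using X_after_L0[of N] by (metis le_SucI order_refl)
    then obtain q where q: "N \<le> q" "X !! q \<noteq> L0" by blast
    have q': "X !! Suc (X.pos q) = L2" using X_pos1[of q] q by simp
    have "\<exists>q\<ge>N. sg q = b"
    proof (cases "sg (Suc (X.pos q)) = b")
      case True
      then show ?thesis using q X.pos_ge[of q] by (intro exI[of _ "Suc (X.pos q)"]) simp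
    next
      case False
      then have "sg (Suc (Suc (X.pos q))) = b" using q' by (simp del: snth.simps)
      then show ?thesis using q X.pos_ge[of q] by (intro exI[of _ "Suc (Suc (X.pos q))"]) simp
    qed
    then obtain q where "N \<le> q" "sg q = b" by blast
    then show ?case using X.pos_ge[of q]
      by (intro exI[of _ "X.pos q"]) (simp add: fac_1 sg_pos)
  next
    case (Suc k)
    then obtain j where j: "j \<ge> N" "fac X j (length (?F k)) = ?F k" "sg j = b" by blast
    define l where "l = X.pos (j + length (?F k)) - X.pos j"
    have "fac X (X.pos j) l = ?F (Suc k)"
      unfolding l_def using fac_X_pos[of j "length (?F k)"] j by simp
    moreover from this have "l = length (?F (Suc k))" by (metis length_fac)
    ultimately show ?case using j X.pos_ge[of j] by (intro exI[of _ "X.pos j"]) (auto simp: sg_pos)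
  qed
  let ?k = "i + n"
  have l: "i + n \<le> length (?F ?k)" using length_f_pow[of ?k] by simp
  have F0: "fac X 0 (length (?F ?k)) = ?F ?k" using stake_X[of ?k] by (simp add: fac_def)
  have shift: "fac X (j + i) n = fac X i n \<and> sg (j + i) = (sg j \<noteq> sg i)"
    if "fac X j (length (?F ?k)) = ?F ?k" for j
  proof -
    have "\<forall>k<length (?F ?k). X !! (j + k) = X !! (0 + k)"
      using that F0 by (simp only: fac_eq_iff[symmetric])
    then have eq: "X !! (j + k) = X !! k" if "k < length (?F ?k)" for k using that by simp
    have "sg (j + k) = (sg j \<noteq> sg k)" if "k \<le> length (?F ?k)" for k
      using that by (induction k) (auto simp: eq simp del: snth.simps)
    moreover have "fac X (j + i) n = fac X i n" using l eq by (simp add: fac_eq_iff add.assoc)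
    ultimately show ?thesis using l by simp
  qed
  obtain j where j: "j \<ge> N" "fac X j (length (?F ?k)) = ?F ?k" "sg j = (b \<noteq> sg i)" using F by blast
  then show ?thesis using shift[OF j(2)] by (intro exI[of _ "j + i"]) auto
qed

lemma X_recurrent: "\<exists>j\<ge>N. fac X j n = fac X i n"
  using X_recurrent_sg by blast

text \<open>The words \<open>P k\<close>, obtained from \<open>0\<close> by iterating
  \<open>f(v) 0\<close>, are palindromic prefixes of \<open>X\<close> of unbounded length; mirroring
  a factor inside one of them yields its reversal.\<close>

lemma X_rev_closed: "\<exists>j. fac X j n = rev (fac X i n)"
proof -
  define P where "P k = ((\<lambda>w. f_morphism w @ [L0]) ^^ k) [L0]" for k
  have P_Suc: "P (Suc k) = f_morphism (P k) @ [L0]" for k by (simp add: P_def)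
  have pal_P: "rev (P k) = P k" for k
  proof (induction k)
    case (Suc k)
    then show ?case by (simp only: P_Suc rev_f_morphism)
  qed (simp add: P_def)
  have len: "k < length (P k)" for k
  proof (induction k)
    case (Suc k)
    then show ?case using f_morphism_length[of "P k"] by (simp add: P_Suc)
  qed (simp add: P_def)
  have pre: "fac X 0 (length (P k)) = P k" for k
  proof (induction k)
    case (Suc k)
    have f: "fac X 0 (X.pos (length (P k))) = f_morphism (P k)"
      using fac_X_pos[of 0 "length (P k)"] Suc by simp
    then have l: "length (P (Suc k)) = X.pos (length (P k)) + 1"
      by (metis P_Suc length_append_singleton length_fac Suc_eq_plus1)
    show ?case unfolding l fac_add using f by (simp add: P_Suc fac_map)
  qed (use X_pos[of 0] in \<open>simp add: P_def fac_map\<close>)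
  define l where "l = length (P (i + n))"
  have l: "i + n < l" using len[of "i + n"] by (simp add: l_def)
  have "pal (fac X 0 l)" using pre pal_P by (simp add: l_def pal_def)
  then have "\<forall>k<l. X !! (0 + k) = X !! (0 + (l - 1 - k))" by (simp only: pal_fac_iff)
  then have *: "X !! k = X !! (l - 1 - k)" if "k < l" for k
    using that by (simp only: add_0)
  have "fac X (l - i - n) n = rev (fac X i n)"
  proof (rule nth_equalityI)
    fix k assume "k < length (fac X (l - i - n) n)"
    then have k: "k < n" by simp
    then have "X !! (l - i - n + k) = X !! (l - 1 - (l - i - n + k))"
      using l by (intro *) simp
    moreover have "l - 1 - (l - i - n + k) = i + (n - 1 - k)" using l k by simp
    ultimately show "fac X (l - i - n) n ! k = rev (fac X i n) ! k"
      using k by (simp add: rev_nth)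
  qed simp
  then show ?thesis by blast
qed

section \<open>Complete returns to palindromes of the fixed point\<close>

definition good_X :: "letter list \<Rightarrow> bool" where
  "good_X w \<longleftrightarrow> (\<forall>i j. i < j \<and> fac X i (length w) = w \<and> fac X j (length w) = w \<and>
      (\<forall>k. i < k \<and> k < j \<longrightarrow> fac X k (length w) \<noteq> w) \<longrightarrow> pal (fac X i (j - i + length w)))"

text \<open>By recurrence a return can be moved away from the start of \<open>X\<close>, so that
  preimages have a left neighbour; 5 is just a convenient bound.\<close>

lemma good_XI:
  assumes "\<And>i j. \<lbrakk>5 \<le> i; i < j; fac X i (length w) = w; fac X j (length w) = w;
      \<And>k. i < k \<Longrightarrow> k < j \<Longrightarrow> fac X k (length w) \<noteq> w\<rbrakk> \<Longrightarrow> pal (fac X i (j - i + length w))"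
  shows "good_X w"
  unfolding good_X_def
proof (intro allI impI, elim conjE)
  fix i j assume ij: "i < j" "fac X i (length w) = w" "fac X j (length w) = w"
    and no: "\<forall>k. i < k \<and> k < j \<longrightarrow> fac X k (length w) \<noteq> w"
  let ?n = "length w"
  obtain i' where i': "5 \<le> i'" "fac X i' (j - i + ?n) = fac X i (j - i + ?n)"
    using X_recurrent by blast
  have eq: "fac X (i' + k) ?n = fac X (i + k) ?n" if "k \<le> j - i" for k
    using fac_sub[OF i'(2)] that by simp
  have "pal (fac X i' (i' + (j - i) - i' + ?n))"
  proof (rule assms[OF i'(1)])
    show "fac X k ?n \<noteq> w" if "i' < k" "k < i' + (j - i)" for k
    proof -
      have "fac X k ?n = fac X (i + (k - i')) ?n" using eq[of "k - i'"] that by simp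
      moreover have "i < i + (k - i')" "i + (k - i') < j" using that by auto
      ultimately show ?thesis using no by simp
    qed
  qed (use ij eq[of 0] eq[of "j - i"] in auto)
  then show "pal (fac X i (j - i + ?n))" using i'(2) by simp
qed

lemma length_f_fac: "length (f_morphism (fac X p m)) = X.pos (p + m) - X.pos p"
  by (metis fac_X_pos length_fac)

lemma fac_X_pos': "fac X (X.pos p) (X.pos (p + m) - X.pos p + 1) = f_morphism (fac X p m) @ [L0]"
proof -
  have "fac X (X.pos p + (X.pos (p + m) - X.pos p)) 1 = [L0]"
    by (simp add: fac_map)
  then show ?thesis unfolding fac_add fac_X_pos by simp
qed

lemma X_image_eq:
  assumes "fac X r m = fac X p m" "k + l \<le> X.pos (p + m) - X.pos p + 1"
  shows "X.pos (r + m) - X.pos r = X.pos (p + m) - X.pos p"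
    and "fac X (X.pos r + k) l = fac X (X.pos p + k) l"
proof -
  show *: "X.pos (r + m) - X.pos r = X.pos (p + m) - X.pos p"
    using assms(1) length_f_fac by metis
  have "fac X (X.pos r) (X.pos (p + m) - X.pos p + 1) = fac X (X.pos p) (X.pos (p + m) - X.pos p + 1)"
    using fac_X_pos'[of r m] fac_X_pos'[of p m] assms(1) * by simp
  then show "fac X (X.pos r + k) l = fac X (X.pos p + k) l"
    using assms(2) by (rule fac_sub)
qed

text \<open>Occurrences of \<open>u\<close> and of \<open>v\<close> correspond in order,
  \<open>u\<close> being \<open>f(v) 0\<close> trimmed by \<open>e\<close> or extended by
  \<open>a\<close> letters at both ends. So complete returns correspond, and a return to
  \<open>u\<close> arises by the same symmetric trimming or extension from the palindrome
  \<open>f(w) 0\<close>, where \<open>w\<close> is the return to \<open>v\<close>.\<close>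

lemma X_transfer:
  assumes "pal u" and v: "good_X v" and ae: "a = 0 \<or> e = 0"
    and fwd: "\<And>i. 5 \<le> i \<Longrightarrow> fac X i (length u) = u \<Longrightarrow> \<exists>r. i + a = X.pos r + e \<and>
        fac X r (length v) = v \<and> i + length u + e = X.pos (r + length v) + 1 + a"
    and bwd: "\<And>r. 5 + a \<le> X.pos r + e \<Longrightarrow> fac X r (length v) = v \<Longrightarrow>
        fac X (X.pos r + e - a) (length u) = u"
  shows "good_X u"
proof (rule good_XI)
  fix i j assume i5: "5 \<le> i" and ij: "i < j" and u: "fac X i (length u) = u" "fac X j (length u) = u"
    and no: "\<And>k. i < k \<Longrightarrow> k < j \<Longrightarrow> fac X k (length u) \<noteq> u"
  let ?n = "length u" and ?m = "length v"
  obtain r where r: "i + a = X.pos r + e" "fac X r ?m = v" "i + ?n + e = X.pos (r + ?m) + 1 + a"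
    using fwd[OF i5 u(1)] by blast
  obtain r' where r': "j + a = X.pos r' + e" "fac X r' ?m = v" "j + ?n + e = X.pos (r' + ?m) + 1 + a"
    using fwd[OF _ u(2)] i5 ij by auto
  have "X.pos r < X.pos r'" using ij r(1) r'(1) by linarith
  then have rr: "r < r'" by simp
  have nov: "fac X k ?m \<noteq> v" if k: "r < k" "k < r'" for k
  proof
    assume v: "fac X k ?m = v"
    have "X.pos r < X.pos k" "X.pos k < X.pos r'" using k by simp_all
    then have "5 + a \<le> X.pos k + e" "i < X.pos k + e - a" "X.pos k + e - a < j"
      using i5 r(1) r'(1) by linarith+
    then show False using bwd[OF _ v] no by blast
  qed
  have E: "pal (fac X r (r' - r + ?m))"
    using v rr r r' nov unfolding good_X_def by blast
  define M where "M = X.pos (r' + ?m) - X.pos r + 1"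
  have rm: "r + (r' - r + ?m) = r' + ?m" using rr by simp
  have F: "pal (fac X (X.pos r) M)"
    using fac_X_pos'[of r "r' - r + ?m"] E rev_f_morphism[of "fac X r (r' - r + ?m)"]
    unfolding rm M_def pal_def by simp
  have le: "X.pos r < X.pos r'" "X.pos r' \<le> X.pos (r' + ?m)" using rr by simp_all
  show "pal (fac X i (j - i + ?n))"
  proof (cases "a = 0")
    case True
    then have "i = X.pos r + e" "j - i + ?n = M - 2 * e" "2 * e \<le> M"
      using r(1,3) r'(1,3) le ij unfolding M_def by linarith+
    then show ?thesis using pal_trim[OF F] by simp
  next
    case False
    then have e: "e = 0" using ae by simp
    then have eq: "X.pos r = i + a" "j - i + ?n = M + 2 * a"
      using r(1,3) r'(1,3) le ij unfolding M_def by linarith+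
    have n: "2 * a < ?n"
    proof -
      have "X.pos r \<le> X.pos (r + ?m)" by simp
      then show ?thesis using r e by linarith
    qed
    \<comment> \<open>The added letters are the left fringe of \<open>u\<close> at \<open>i\<close>
      and the right fringe of \<open>u\<close> at \<open>j\<close>, mirror images because
      \<open>u\<close> is a palindrome.\<close>
    show ?thesis unfolding eq(2)
    proof (rule pal_extend)
      show "pal (fac X (i + a) M)" using F eq by simp
      fix k assume k: "k < a"
      have kn: "k < ?n" "?n - 1 - k < ?n" using k n by auto
      have "X !! (i + k) = u ! k" using u(1) kn(1) by (metis nth_fac)
      also have "\<dots> = u ! (?n - 1 - k)"
        using rev_nth[OF kn(1)] \<open>pal u\<close> by (simp add: pal_def)
      also have "\<dots> = X !! (j + (?n - 1 - k))" using u(2) kn(2) by (metis nth_fac)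
      also have "j + (?n - 1 - k) = i + (M + 2 * a - 1 - k)" using eq(2) ij k n by linarith
      finally show "X !! (i + k) = X !! (i + (M + 2 * a - 1 - k))" .
    qed
  qed
qed

lemma good_X_Nil: "good_X []"
proof (rule good_XI)
  fix i j :: nat assume "i < j" "\<And>k. i < k \<Longrightarrow> k < j \<Longrightarrow> fac X k (length []) \<noteq> []"
  then have "j = Suc i" by (metis fac_0 lessI linorder_neqE_nat list.size(3) not_less_eq)
  then show "pal (fac X i (j - i + length []))" by (simp add: pal_def fac_map)
qed

lemma good_X_L0: "good_X [L0]"
  by (rule X_transfer[where v = "[]" and a = 0 and e = 0])
    (auto simp: pal_def good_X_Nil fac_1 elim!: X_L0D)

text \<open>\<open>1\<close> is \<open>f(0) 0\<close> without its end letters and occurs in no other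
  image.\<close>

lemma good_X_L1: "good_X [L1]"
proof (rule X_transfer[where v = "[L0]" and a = 0 and e = 1])
  show "\<exists>r. i + 0 = X.pos r + 1 \<and> fac X r (length [L0]) = [L0] \<and>
      i + length [L1] + 1 = X.pos (r + length [L0]) + 1 + 0"
    if w: "fac X i (length [L1]) = [L1]" for i
  proof -
    obtain p where "i = Suc (X.pos p)" "X !! p = L0" using w X_L1D[of i] by (auto simp: fac_1)
    then show ?thesis by (intro exI[of _ p]) (simp add: fac_1 X_pos_Suc)
  qed
  show "fac X (X.pos r + 1 - 0) (length [L1]) = [L1]" if "fac X r (length [L0]) = [L0]" for r
    using that X_pos1[of r] by (simp add: fac_1)
qed (auto simp: pal_def good_X_L0)

lemma X_double:
  assumes "X !! i \<noteq> L0" "X !! Suc i \<noteq> L0"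
  obtains p where "i = Suc (X.pos p)" "X !! p = L1"
proof -
  obtain p k where pk: "i = X.pos p + k" "k < length (f_letter (X !! p))" by (rule X.pos_cases)
  have "k \<noteq> 0" using pk assms(1) by (metis X_pos add_0_right)
  moreover have "Suc k < length (f_letter (X !! p))"
  proof (rule ccontr)
    assume "\<not> ?thesis"
    then have "Suc i = X.pos (Suc p)" using pk by (simp add: X.pos_Suc)
    then show False using assms(2) by simp
  qed
  ultimately have "k = 1 \<and> X !! p = L1" by (cases "X !! p") auto
  then show thesis using that pk by simp
qed

text \<open>\<open>22\<close> is \<open>f(1) 0\<close> without its end letters; the images of
  \<open>0\<close> and \<open>2\<close> have only one letter after the \<open>0\<close>.\<close>

lemma good_X_L22: "good_X [L2, L2]"
proof (rule X_transfer[where v = "[L1]" and a = 0 and e = 1])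
  have f2: "fac X i (length [L2, L2]) = [X !! i, X !! Suc i]" for i by (simp add: fac_map)
  show "\<exists>r. i + 0 = X.pos r + 1 \<and> fac X r (length [L1]) = [L1] \<and>
      i + length [L2, L2] + 1 = X.pos (r + length [L1]) + 1 + 0"
    if w: "fac X i (length [L2, L2]) = [L2, L2]" for i
  proof -
    obtain p where "i = Suc (X.pos p)" "X !! p = L1" using w X_double[of i] unfolding f2 by auto
    then show ?thesis by (intro exI[of _ p]) (simp add: fac_1 X_pos_Suc)
  qed
  show "fac X (X.pos r + 1 - 0) (length [L2, L2]) = [L2, L2]" if "fac X r (length [L1]) = [L1]" for r
    using that X_pos1[of r] X_pos2[of r] unfolding f2 by (auto simp: fac_1)
qed (auto simp: pal_def good_X_L1)

text \<open>A single \<open>2\<close> may come from the image of \<open>1\<close>, where it occurs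
  twice, or from that of \<open>2\<close>, so it has no unique preimage. Its complete returns are
  found directly: \<open>22\<close>, \<open>202\<close> and \<open>20102\<close>.\<close>

lemma good_X_L2: "good_X [L2]"
proof (rule good_XI)
  fix i j assume i: "5 \<le> i" "i < j" "fac X i (length [L2]) = [L2]" "fac X j (length [L2]) = [L2]"
    and no: "\<And>k. i < k \<Longrightarrow> k < j \<Longrightarrow> fac X k (length [L2]) \<noteq> [L2]"
  have Xi: "X !! i = L2" "X !! j = L2" using i by (simp_all add: fac_1)
  have no': "X !! k \<noteq> L2" if "i < k" "k < j" for k using no[OF that] by (simp add: fac_1)
  have fi: "fac X i 2 = [X !! i, X !! (i+1)]" "fac X i 3 = [X !! i, X !! (i+1), X !! (i+2)]"
    "fac X i 5 = [X !! i, X !! (i+1), X !! (i+2), X !! (i+3), X !! (i+4)]"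
    by (simp_all add: fac_map upt_rec numeral_eq_Suc)
  show "pal (fac X i (j - i + length [L2]))"
  proof (cases "X !! (i + 1) = L2")
    case True
    then have "j = i + 1" using no'[of "i + 1"] i by (cases "j = i + 1") auto
    then have e: "j - i + length [L2] = 2" by simp
    show ?thesis unfolding e fi using True Xi by (simp add: pal_def)
  next
    case False
    then have 1: "X !! (i + 1) = L0" using X_around_L1(1)[of i] Xi by (cases "X !! (i + 1)") auto
    then obtain p where p: "i + 1 = X.pos p" by (rule X_L0D)
    show ?thesis
    proof (cases "X !! p = L0")
      case False
      then have 2: "X !! (i + 2) = L2" using X_pos1[of p] p by (simp flip: p)
      then have "j = i + 2" using no'[of "i + 2"] i 1 Xi by (cases "j = i + 1"; cases "j = i + 2") auto
      then have e: "j - i + length [L2] = 3" by simp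
      show ?thesis unfolding e fi using Xi 1 2 by (simp add: pal_def)
    next
      case True
      then have 2: "X !! (i + 2) = L1" using X_pos1[of p] by (simp flip: p)
      have p3: "X.pos (Suc p) = i + 3" using p True by (simp add: X_pos_Suc flip: p)
      have 3: "X !! (i + 3) = L0" using X_pos[of "Suc p"] p3 by simp
      have 4: "X !! (i + 4) = L2" using X_pos1[of "Suc p"] p3 X_after_L0[OF True] by (simp add: add.commute)
      have "\<not> i + 4 < j" using no'[of "i + 4"] 4 by auto
      moreover have "j \<noteq> i + 1" "j \<noteq> i + 2" "j \<noteq> i + 3" using Xi 1 2 3 by auto
      ultimately have "j = i + 4" using i by linarith
      then have e: "j - i + length [L2] = 5" by simp
      show ?thesis unfolding e fi using Xi 1 2 3 4 by (simp add: pal_def)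
    qed
  qed
qed

lemma X_sides_nonzero:
  assumes "0 < m" "X !! r = L0" "X !! (r + m - 1) = L0" "0 < r"
  shows "X !! (r - 1) \<noteq> L0" "X !! (r + m) \<noteq> L0"
  using X_after_L0[of "r - 1"] X_after_L0[of "r + m - 1"] assms by auto

text \<open>\<open>1\<close> stands only between zeros, so two adjacent letters different from
  \<open>0\<close> are both \<open>2\<close>.\<close>

lemma X_sides_L2:
  assumes "X !! (r - 1) \<noteq> L0" "X !! (r + m) \<noteq> L0" "0 < r"
    and "0 < m \<Longrightarrow> X !! r \<noteq> L0 \<and> X !! (r + m - 1) = X !! r"
  shows "X !! (r - 1) = L2" "X !! (r + m) = L2"
proof -
  obtain r0 where r0: "r = Suc r0" using assms(3) by (cases r) auto
  have "X !! (r - 1) = L2 \<and> X !! (r + m) = L2"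
  proof (cases "m = 0")
    case True
    then show ?thesis
      using assms X_after_L1[of r0] X_around_L1(1)[of r0] r0
      by (cases "X !! r0"; cases "X !! r") auto
  next
    case m: False
    have "X !! r \<noteq> L1" using X_around_L1(1)[of r0] assms(1) r0 by auto
    then have r2: "X !! r = L2" using assms(4) m by (cases "X !! r") auto
    have "X !! (r - 1) \<noteq> L1" using X_before_L2[of r0] r0 r2 by auto
    moreover have "X !! (r + m) \<noteq> L1"
      using X_around_L1(1)[of "r + m - 1"] m assms(4) r2 by auto
    ultimately show ?thesis using assms by (cases "X !! (r - 1)"; cases "X !! (r + m)") auto
  qed
  then show "X !! (r - 1) = L2" "X !! (r + m) = L2" by auto
qed

lemma pal_ends:
  assumes "pal (fac X p m)" "fac X r m = fac X p m" "0 < m"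
  shows "X !! r = X !! p" "X !! (r + m - 1) = X !! p"
proof -
  have "X !! (r + 0) = X !! (p + 0)" "X !! (r + (m - 1)) = X !! (p + (m - 1))"
    using assms(2,3) unfolding fac_eq_iff by (meson diff_less zero_less_one)+
  moreover have "X !! (p + 0) = X !! (p + (m - 1 - 0))"
    using assms(1,3) unfolding pal_fac_iff by blast
  ultimately show "X !! r = X !! p" "X !! (r + m - 1) = X !! p" using assms(3) by simp_all
qed

text \<open>A palindrome with a letter \<open>0\<close> is \<open>t f(v) 0 t'\<close> with a shorter palindrome \<open>v\<close>, where \<open>t\<close> and its reversal
  \<open>t'\<close> are free of \<open>0\<close>. Either \<open>t\<close> and \<open>t'\<close> determine the letters around \<open>v\<close>, or they are determined by \<open>v\<close>.\<close>

lemma good_X_step: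
  assumes IH: "\<And>v p. length v < length u \<Longrightarrow> pal v \<Longrightarrow> fac X p (length v) = v \<Longrightarrow> good_X v"
    and pal_u: "pal u" and i: "5 \<le> i" "fac X i (length u) = u" and zero: "L0 \<in> set u"
  shows "good_X u"
proof -
  define n where "n = length u"
  have un: "u ! k = X !! (i + k)" if "k < n" for k using i(2) that by (metis n_def nth_fac)
  have palu: "X !! (i + (n - 1 - k)) = X !! (i + k)" if "k < n" for k
    using pal_u i(2) pal_fac_iff[of X i n] that unfolding n_def by (metis (no_types))
  define a where "a = (LEAST k. k < n \<and> X !! (i + k) = L0)"
  have "\<exists>k<n. X !! (i + k) = L0" using zero un by (metis in_set_conv_nth n_def)
  then have a: "a < n" "X !! (i + a) = L0" unfolding a_def by (metis (mono_tags, lifting) LeastI)+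
  have min: "X !! (i + k) \<noteq> L0" if "k < a" for k
    using not_less_Least[of k "\<lambda>k. k < n \<and> X !! (i + k) = L0"] that a(1) unfolding a_def[symmetric] by auto
  have za: "X !! (i + (n - 1 - a)) = L0" using palu[OF a(1)] a(2) by simp
  have an: "a \<le> n - 1 - a" using min[of "n - 1 - a"] za by (metis not_less)
  obtain p where p: "i + a = X.pos p" using a(2) by (rule X_L0D)
  obtain q where q: "i + (n - 1 - a) = X.pos q" using za by (rule X_L0D)
  have "X.pos p \<le> X.pos q" using p q an by linarith
  then have pq: "p \<le> q" by simp
  define m where "m = q - p"
  have qm: "q = p + m" using pq by (simp add: m_def)
  define v where "v = fac X p m"
  have lv: "length v = m" by (simp add: v_def)
  define c where "c = X.pos q - X.pos p + 1"
  have n_eq: "n = c + 2 * a" using p q an a(1) \<open>X.pos p \<le> X.pos q\<close> unfolding c_def by linarith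
  have core: "fac X (X.pos p) c = f_morphism v @ [L0]"
    using fac_X_pos'[of p m] by (simp add: c_def qm v_def)
  have cl: "length (f_morphism v) + 1 = c" using core by (metis length_append_singleton length_fac Suc_eq_plus1)
  have m_less: "2 * m < c" using f_morphism_length[of v] cl lv by simp
  have "pal (fac X (i + a) (n - 2 * a))"
    using pal_trim[of X i n a] pal_u i(2) n_eq by (simp add: n_def)
  then have "pal (f_morphism v @ [L0])" using core p n_eq by simp
  then have "f_morphism (rev v) @ [L0] = f_morphism v @ [L0]" by (simp only: rev_f_morphism pal_def)
  then have pal_v: "pal v" using f_morphism_inj unfolding pal_def by blast
  have "0 < p" using p i(1) by (cases p) auto
  then obtain p0 where p0: "p = Suc p0" by (cases p) auto
  \<comment> \<open>The previous image starts with \<open>0\<close>, so the fringe is a proper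
    suffix of it: at most two letters, and two only for the image of \<open>1\<close>.\<close>
  have a3: "a < X.pos p - X.pos p0"
  proof (rule ccontr)
    assume A: "\<not> ?thesis"
    moreover have "X.pos p0 < X.pos p" using p0 by simp
    ultimately have "X.pos p0 = i + (X.pos p0 - i)" "X.pos p0 - i < a" using p by linarith+
    then show False using min X_pos[of p0] by metis
  qed
  then have a2: "a \<le> 2" "a = 2 \<Longrightarrow> X !! p0 = L1" using p0 by (auto simp: X_pos_Suc split: if_splits)
  have decode: "\<exists>r. i' + a = X.pos r \<and> fac X r m = v \<and> i' + n = X.pos (r + m) + 1 + a"
    if i': "fac X i' n = u" for i'
  proof -
    have eq: "fac X (i' + k) l = fac X (i + k) l" if "k + l \<le> n" for k l
      using fac_sub[of X i' n X i k l] that i' i(2) by (simp add: n_def)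
    have "X !! (i' + a) = L0" using eq[of a 1] a by (simp add: fac_1)
    then obtain r where r: "i' + a = X.pos r" by (rule X_L0D)
    have "fac X (X.pos r) c = f_morphism v @ [L0]" using eq[of a c] n_eq core p r by simp
    then have rv: "fac X r m = v" using X_decode[of r v] lv cl by simp
    then have "X.pos (r + m) - X.pos r + 1 = c" using cl length_f_fac[of r m] by simp
    moreover have "X.pos r \<le> X.pos (r + m)" by simp
    ultimately have "i' + n = X.pos (r + m) + 1 + a" using r n_eq by linarith
    then show ?thesis using r rv by blast
  qed
  have letters: "X !! (i' + k) = X !! (i + k)" if "fac X i' n = u" "k < n" for i' k
    using that un by (metis nth_fac)
  \<comment> \<open>A fringe that is a whole image but for its \<open>0\<close> makes
    \<open>u\<close> the word \<open>f(bvb) 0\<close> without its end letters.\<close>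
  have trimmed: "good_X u"
    if d: "\<And>i' r. 5 \<le> i' \<Longrightarrow> fac X i' n = u \<Longrightarrow> i' + a = X.pos r \<Longrightarrow> fac X r m = v \<Longrightarrow> i' + n = X.pos (r + m) + 1 + a
        \<Longrightarrow> X !! (r - 1) = b \<and> X !! (r + m) = b" and b: "a + 1 = length (f_letter b)" and a1: "0 < a" for b
  proof -
    define w where "w = b # v @ [b]"
    have w: "length w = m + 2" "pal w" using pal_v by (simp_all add: w_def lv pal_def)
    have ww: "fac X (r - 1) (length w) = w" if "0 < r" "fac X r m = v" "X !! (r - 1) = b" "X !! (r + m) = b" for r
    proof -
      have "fac X (r - 1) (1 + (m + 1)) = w"
        unfolding fac_add using that by (simp add: fac_1 w_def)
      then show ?thesis using w by simp
    qed
    have X0: "X !! p0 = b" "X !! (p + m) = b"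
      using d[of i p] i p qm n_eq q p0 \<open>X.pos p \<le> X.pos q\<close> by (auto simp: n_def v_def c_def)
    have w0: "fac X p0 (length w) = w" using ww[of p] p0 X0 by (simp add: v_def)
    have pp: "X.pos (Suc r) = X.pos r + a + 1" if "X !! r = b" for r
      using that b by (simp add: X.pos_Suc)
    show ?thesis
    proof (rule X_transfer[where v = w and a = 0 and e = 1])
      \<comment> \<open>\<open>bvb\<close> is shorter than \<open>u\<close>: its length is
        \<open>m + 2\<close>, while \<open>n = c + 2 * a\<close> with \<open>2 * m < c\<close> and
        \<open>0 < a\<close>.\<close>
      show "good_X w" using IH[OF _ w(2) w0] w(1) n_eq m_less a1 by (simp add: n_def)
      show "\<exists>r. i' + 0 = X.pos r + 1 \<and> fac X r (length w) = w \<and> i' + length u + 1 = X.pos (r + length w) + 1 + 0"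
        if i': "5 \<le> i'" "fac X i' (length u) = u" for i'
      proof -
        obtain r where r: "i' + a = X.pos r" "fac X r m = v" "i' + n = X.pos (r + m) + 1 + a"
          using decode i' by (auto simp: n_def)
        have bb: "X !! (r - 1) = b" "X !! (r + m) = b" using d[OF i'(1) _ r] i'(2) by (auto simp: n_def)
        have "0 < r" using r(1) i'(1) by (cases r) auto
        then obtain r0 where r0: "r = Suc r0" by (cases r) auto
        have "X.pos (Suc r0) = X.pos r0 + a + 1" "X.pos (Suc (r + m)) = X.pos (r + m) + a + 1"
          using pp bb r0 by auto
        then have "i' = X.pos r0 + 1" "i' + n + 1 = X.pos (Suc (r + m)) + 1"
          using r(1,3) r0 by auto
        moreover have "Suc (r + m) = r0 + length w" using w r0 by simp
        ultimately show ?thesis using ww[OF \<open>0 < r\<close> r(2) bb] r0 by (auto simp: n_def)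
      qed
      show "fac X (X.pos r + 1 - 0) (length u) = u" if r: "fac X r (length w) = w" for r
      proof -
        have "X.pos (p0 + length w) = X.pos (p + m) + a + 1"
          using pp[OF X0(2)] p0 w by simp
        moreover have "X.pos p = X.pos p0 + a + 1" using pp[OF X0(1)] p0 by simp
        ultimately have l: "1 + n \<le> X.pos (p0 + length w) - X.pos p0 + 1" and i0: "i = X.pos p0 + 1"
          using n_eq p \<open>X.pos p \<le> X.pos q\<close> unfolding c_def qm by linarith+
        have "fac X (X.pos r + 1) n = fac X (X.pos p0 + 1) n"
          by (rule X_image_eq(2)[OF _ l]) (use r w0 in simp)
        then show ?thesis using i(2) i0 by (simp add: n_def)
      qed
    qed (use pal_u in auto)
  qed
  have left: "X !! (i' + (a - 1)) = X !! (i + (a - 1))" "X !! (i' + n - a) = X !! (i + (a - 1))"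
    if "fac X i' n = u" "0 < a" for i'
  proof -
    have k: "a - 1 < n" "n - 1 - (a - 1) < n" using a(1) that by auto
    show "X !! (i' + (a - 1)) = X !! (i + (a - 1))" by (rule letters[OF that(1) k(1)])
    have "X !! (i' + (n - 1 - (a - 1))) = X !! (i + (a - 1))"
      using letters[OF that(1) k(2)] palu[OF k(1)] by simp
    moreover have "i' + (n - 1 - (a - 1)) = i' + n - a" using that a(1) by simp
    ultimately show "X !! (i' + n - a) = X !! (i + (a - 1))" by simp
  qed
  \<comment> \<open>An empty fringe leaves \<open>u = f(v) 0\<close>; \<open>22\<close> and
    \<open>1\<close> identify the neighbours as \<open>1\<close> and \<open>0\<close>; a single
    \<open>2\<close> only excludes the neighbour \<open>0\<close>.\<close>
  consider "a = 0" | "a = 2" | "a = 1" "X !! i = L1" | "a = 1" "X !! i = L2"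
    using a2(1) min[of 0] by (cases "X !! i") (auto, linarith+)
  then show ?thesis
  proof cases
    case 1
    show ?thesis
    proof (rule X_transfer[where v = v and a = 0 and e = 0])
      show "good_X v" using IH[OF _ pal_v, of p] m_less n_eq lv by (simp add: n_def v_def)
      show "\<exists>r. i' + 0 = X.pos r + 0 \<and> fac X r (length v) = v \<and> i' + length u + 0 = X.pos (r + length v) + 1 + 0"
        if "fac X i' (length u) = u" for i'
        using decode[of i'] that 1 lv by (auto simp: n_def)
      show "fac X (X.pos r + 0 - 0) (length u) = u" if r: "fac X r (length v) = v" for r
      proof -
        have "0 + n \<le> X.pos (p + m) - X.pos p + 1" using n_eq 1 by (simp add: c_def qm)
        from X_image_eq(2)[OF _ this, of r] have "fac X (X.pos r) n = fac X (X.pos p) n"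
          using r lv by (simp add: v_def)
        then show ?thesis using i p 1 by (simp add: n_def)
      qed
    qed (use pal_u in auto)
  next
    case 2
    show ?thesis
    proof (rule trimmed[of L1])
      fix i' r assume i': "5 \<le> i'" "fac X i' n = u" and r: "i' + a = X.pos r" "fac X r m = v"
        "i' + n = X.pos (r + m) + 1 + a"
      have "i = X.pos (Suc p0) - 2" "i + 1 = X.pos (Suc p0) - 1" using p p0 2 by auto
      then have X0: "X !! i = L2" "X !! (i + 1) = L2"
        using X_before2_pos[of p0] X_before_pos[of p0] a2(2)[OF 2] by simp_all
      have n2: "2 < n" using n_eq 2 m_less by simp
      have L: "X !! i' = L2" using letters[OF i'(2), of 0] n2 X0 by simp
      have "X !! (i' + (n - 1)) = L2" using letters[OF i'(2), of "n - 1"] palu[of 0] n2 X0 by simp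
      then have R: "X !! (X.pos (r + m) + 2) = L2" using r(3) 2 n2 by simp
      have R1: "X !! (X.pos (r + m) + 1) = L2" using left(2)[OF i'(2)] X0 r(3) 2 by simp
      have "0 < r" using r(1) i'(1) by (cases r) auto
      then obtain r0 where r0: "r = Suc r0" by (cases r) auto
      have "X !! r0 = L1"
        using X_before2_pos[of r0] L r(1) r0 2 by (metis add_diff_cancel_right' letter.distinct(3))
      moreover have "X !! (r + m) = L1"
        using R R1 X_pos1[of "r + m"] X_pos[of "Suc (r + m)"] X_pos_Suc[of "r + m"]
        by (cases "X !! (r + m)") auto
      ultimately show "X !! (r - 1) = L1 \<and> X !! (r + m) = L1" using r0 by simp
    qed (use 2 in auto)
  next
    case 3
    show ?thesis
    proof (rule trimmed[of L0])
      fix i' r assume i': "5 \<le> i'" "fac X i' n = u" and r: "i' + a = X.pos r" "fac X r m = v"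
        "i' + n = X.pos (r + m) + 1 + a"
      have L: "X !! i' = L1" using left(1)[OF i'(2)] 3 by simp
      have R: "X !! Suc (X.pos (r + m)) = L1" using left(2)[OF i'(2)] 3 r(3) by simp
      have "0 < r" using r(1) i'(1) by (cases r) auto
      then obtain r0 where r0: "r = Suc r0" by (cases r) auto
      have "X !! r0 = L0"
        using X_before_pos[of r0] L r(1) r0 3 by (metis add_diff_cancel_right' letter.distinct(5))
      moreover have "X !! (r + m) = L0"
        using R X_pos1[of "r + m"] by (auto split: if_splits)
      ultimately show "X !! (r - 1) = L0 \<and> X !! (r + m) = L0" using r0 by simp
    qed (use 3 in auto)
  next
    case 4
    have sides: "X !! (r - 1) \<noteq> L0 \<and> X !! (r + m) \<noteq> L0 \<and> 0 < r"
      if i': "5 \<le> i'" "fac X i' n = u" and r: "i' + a = X.pos r" "i' + n = X.pos (r + m) + 1 + a" for i' r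
    proof -
      have L: "X !! i' = L2" using left(1)[OF i'(2)] 4 by simp
      have R: "X !! Suc (X.pos (r + m)) = L2" using left(2)[OF i'(2)] 4 r(2) by simp
      have "0 < r" using r(1) i'(1) by (cases r) auto
      then obtain r0 where r0: "r = Suc r0" by (cases r) auto
      have "X !! r0 \<noteq> L0"
        using X_before_pos[of r0] L r(1) r0 4 by (metis add_diff_cancel_right' letter.distinct(5))
      moreover have "X !! (r + m) \<noteq> L0"
        using R X_pos1[of "r + m"] by (auto split: if_splits)
      ultimately show ?thesis using r0 by simp
    qed
    have vl: "X !! (r + m - 1) = X !! p" "X !! r = X !! p" if "fac X r m = v" "0 < m" for r
      using pal_ends[of p m r] pal_v that by (simp_all add: v_def)
    \<comment> \<open>If \<open>v\<close> has \<open>0\<close> at its ends, its neighbours are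
      nonzero at every occurrence and the \<open>2\<close> on either side is forced; otherwise both
      neighbours are \<open>2\<close>.\<close>
    show ?thesis
    proof (cases "0 < m \<and> X !! p = L0")
      case True
      show ?thesis
      proof (rule X_transfer[where v = v and a = 1 and e = 0])
        show "good_X v" using IH[OF _ pal_v, of p] m_less n_eq lv by (simp add: n_def v_def)
        show "\<exists>r. i' + 1 = X.pos r + 0 \<and> fac X r (length v) = v \<and> i' + length u + 0 = X.pos (r + length v) + 1 + 1"
          if "fac X i' (length u) = u" for i'
          using decode[of i'] that 4 lv by (auto simp: n_def)
        show "fac X (X.pos r + 0 - 1) (length u) = u" if r5: "5 + 1 \<le> X.pos r + 0" and r': "fac X r (length v) = v" for r
        proof -
          have r: "fac X r m = v" using r' lv by simp
          have "0 < r" using r5 by (cases r) auto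
          then obtain r0 where r0: "r = Suc r0" by (cases r) auto
          have nz: "X !! r0 \<noteq> L0" "X !! (r + m) \<noteq> L0"
            using X_sides_nonzero[of m r] vl[OF r] True r0 by auto
          then have L: "X !! (X.pos r - 1) = L2" using X_before_pos[of r0] r0 by simp
          have R: "X !! Suc (X.pos (r + m)) = L2" using X_pos1 nz by simp
          have cc: "0 + c \<le> X.pos (p + m) - X.pos p + 1" by (simp add: c_def qm)
          have e1: "X.pos (r + m) - X.pos r = X.pos (p + m) - X.pos p"
            and e2: "fac X (X.pos r + 0) c = fac X (X.pos p + 0) c"
            using X_image_eq[OF _ cc, of r] r by (auto simp: v_def)
          have rc: "X.pos r + c = Suc (X.pos (r + m))"
          proof -
            have "X.pos r \<le> X.pos (r + m)" "X.pos p \<le> X.pos (p + m)" by simp_all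
            then show ?thesis using e1 unfolding c_def qm by linarith
          qed
          have n': "n = 1 + (c + 1)" using n_eq 4 by simp
          have "fac X (X.pos r - 1) n = [L2] @ fac X (X.pos p) c @ [L2]"
            unfolding n' fac_add using r5 L R e2 rc by (simp add: fac_1)
          moreover have "fac X i n = [L2] @ fac X (X.pos p) c @ [L2]"
          proof -
            have "i + 1 = X.pos p" using p 4 by simp
            moreover have "X !! (X.pos p + c) = L2"
            proof -
              have "i + n - a = X.pos p + c" using 4 p n_eq by linarith
              then show ?thesis using left(2)[of i] i(2) 4 by (simp add: n_def)
            qed
            ultimately show ?thesis unfolding n' fac_add using 4 by (simp add: fac_1)
          qed
          ultimately show ?thesis using i(2) by (simp add: n_def)
        qed
      qed (use pal_u in auto)
    next
      case False
      show ?thesis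
      proof (rule trimmed[of L2])
        fix i' r assume i': "5 \<le> i'" "fac X i' n = u" and r: "i' + a = X.pos r" "fac X r m = v"
          "i' + n = X.pos (r + m) + 1 + a"
        have s: "X !! (r - 1) \<noteq> L0" "X !! (r + m) \<noteq> L0" "0 < r" using sides[OF i' r(1,3)] by auto
        show "X !! (r - 1) = L2 \<and> X !! (r + m) = L2"
          using X_sides_L2[OF s] vl[OF r(2)] False by auto
      qed (use 4 in auto)
    qed
  qed
qed

lemma good_X_pal:
  "pal w \<Longrightarrow> fac X i (length w) = w \<Longrightarrow> good_X w"
proof (induction "length w" arbitrary: w i rule: less_induct)
  case less
  obtain j where j: "5 \<le> j" "fac X j (length w) = w" using X_recurrent less.prems(2) by metis
  show ?case
  proof (cases "L0 \<in> set w")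
    case True
    show ?thesis by (rule good_X_step[OF _ less.prems(1) j True]) (rule less.hyps)
  next
    \<comment> \<open>Without \<open>0\<close> the word lies behind the \<open>0\<close> of one
      image: only the empty word, \<open>1\<close>, \<open>2\<close> and \<open>22\<close> are
      left.\<close>
    case False
    have nz: "X !! (j + k) \<noteq> L0" if "k < length w" for k
      using False j(2) that by (metis nth_fac nth_mem)
    consider "length w = 0" | "length w = 1" | "length w = 2" | "3 \<le> length w" by linarith
    then show ?thesis
    proof cases
      case 1
      then show ?thesis using good_X_Nil by simp
    next
      case 2
      then have "w = [X !! j]" using j(2) by (simp add: fac_1)
      then show ?thesis using nz[of 0] 2 good_X_L1 good_X_L2 by (cases "X !! j") auto
    next
      case 3
      have "fac X j 2 = [X !! j, X !! Suc j]" by (simp add: fac_map upt_rec)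
      then have w: "w = [X !! j, X !! Suc j]" using j(2) 3 by simp
      have "X !! j \<noteq> L0" "X !! Suc j \<noteq> L0" using nz[of 0] nz[of 1] 3 by auto
      then obtain p where "j = Suc (X.pos p)" "X !! p = L1" by (rule X_double)
      then have "w = [L2, L2]" using w X_pos1[of p] X_pos2[of p] by simp
      then show ?thesis using good_X_L22 by simp
    next
      case 4
      have nz3: "X !! j \<noteq> L0" "X !! Suc j \<noteq> L0" "X !! Suc (Suc j) \<noteq> L0"
      proof -
        have "0 < length w" "1 < length w" "2 < length w" using 4 by linarith+
        then show "X !! j \<noteq> L0" "X !! Suc j \<noteq> L0" "X !! Suc (Suc j) \<noteq> L0"
          using nz[of 0] nz[of 1] nz[of 2] by simp_all
      qed
      then obtain p where "j = Suc (X.pos p)" "X !! p = L1" using X_double by metis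
      then have "Suc (Suc j) = X.pos (Suc p)" by (simp add: X_pos_Suc)
      then show ?thesis using nz3(3) by (metis X_pos)
    qed
  qed
qed

section \<open>The ternary sequence as a coding of the fixed point\<close>

lemma stake_flat:
  "(\<And>i. ws !! i \<noteq> []) \<Longrightarrow> stake (length (concat (stake n ws))) (flat ws) = concat (stake n ws)"
proof (induction n arbitrary: ws)
  case (Suc n)
  have ne: "shd ws \<noteq> []" using Suc.prems[of 0] by (simp add: snth.simps)
  have "stl ws !! i \<noteq> []" for i using Suc.prems[of "Suc i"] by (simp add: snth.simps)
  then have IH: "stake (length (concat (stake n (stl ws)))) (flat (stl ws)) = concat (stake n (stl ws))"
    by (rule Suc.IH)
  have "flat ws = shd ws @- flat (stl ws)" using ne by (rule flat_unfold)
  then show ?case using IH by (simp add: stake_shift)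
qed simp

lemma g_letter_ne: "g_letter a \<noteq> []"
  by (cases a) simp_all

interpretation Y: coded y_seq "\<lambda>i. g_letter (X !! i)"
proof
  have "stake i (smap g_letter X) = map (\<lambda>i. g_letter (X !! i)) [0..<i]" for i
    by (simp add: stake_map comp_def)
  then show "stake (length (concat (map (\<lambda>i. g_letter (X !! i)) [0..<i]))) y_seq
      = concat (map (\<lambda>i. g_letter (X !! i)) [0..<i])" for i
    using stake_flat[of "smap g_letter X" i] g_letter_ne by (simp add: y_seq_def X_def)
qed (rule g_letter_ne)

section \<open>The exchange of 1 and 2, and the blocks of the ternary sequence\<close>

definition sw_letter :: "bool \<Rightarrow> letter \<Rightarrow> letter" where
  "sw_letter b x = (if b then swap_letter x else x)"

definition sw :: "bool \<Rightarrow> letter list \<Rightarrow> letter list" where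
  "sw b = map (sw_letter b)"

lemma swap_swap [simp]: "swap_letter (swap_letter x) = x"
  by (cases x) simp_all

lemma sw_letter_simps [simp]:
  "sw_letter b L0 = L0" "sw_letter False x = x" "sw_letter True x = swap_letter x"
  "sw_letter b (sw_letter c x) = sw_letter (b \<noteq> c) x"
  "sw_letter b x = L0 \<longleftrightarrow> x = L0" "sw_letter b x = sw_letter b y \<longleftrightarrow> x = y"
  unfolding sw_letter_def by (cases x; cases y; simp)+

lemma sw_simps [simp]:
  "sw b [] = []" "sw b (x # w) = sw_letter b x # sw b w" "sw b (v @ w) = sw b v @ sw b w"
  "length (sw b w) = length w" "sw b (sw c w) = sw (b \<noteq> c) w" "sw False w = w"
  "take n (sw b w) = sw b (take n w)" "drop n (sw b w) = sw b (drop n w)" "rev (sw b w) = sw b (rev w)"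
  by (simp_all add: sw_def take_map drop_map rev_map comp_def map_idI)

lemma nth_sw [simp]: "k < length w \<Longrightarrow> sw b w ! k = sw_letter b (w ! k)"
  by (simp add: sw_def)

lemma sw_eq_iff [simp]: "sw b v = sw b w \<longleftrightarrow> v = w"
  by (metis sw_simps(5) sw_simps(6))

lemma sw_swap_iff: "sw b v = w \<longleftrightarrow> v = sw b w"
  by auto

text \<open>\<open>T_letter a\<close> is the image of \<open>g(a)\<close> under \<open>tau\<close>
  from an even index; an odd index gives the exchanged word. Of the words \<open>g(a)\<close> only
  \<open>g(2)\<close> has odd length, so the exchange changes after each \<open>2\<close>.\<close>

fun T_letter :: "letter \<Rightarrow> letter list" where
  "T_letter L0 = word_A @ word_A @ word_D"
| "T_letter L1 = word_A @ word_A @ word_C"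
| "T_letter L2 = word_A @ word_A"

fun T_word :: "letter list \<Rightarrow> letter list" where
  "T_word [] = []"
| "T_word (a # w) = T_letter a @ sw (a = L2) (T_word w)"

lemmas word_defs = word_A_def word_B_def word_C_def word_D_def

lemma Y_parity: "odd (Y.pos i) = sg i"
proof (induction i)
  case (Suc i)
  then show ?case by (cases "X !! i") (simp_all add: Y.pos_Suc)
qed simp

interpretation Z: coded z_seq "\<lambda>i. sw (sg i) (T_letter (X !! i))"
proof
  show "sw (sg i) (T_letter (X !! i)) \<noteq> []" for i
    by (cases "X !! i") (simp_all add: word_defs)
  let ?t = "\<lambda>k. tau k (y_seq !! k)"
  have z: "stake (length (concat (map ?t [0..<n]))) z_seq = concat (map ?t [0..<n])" for n
  proof -
    have "stake n (smap ?t nats) = map ?t [0..<n]" by (simp add: stake_map)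
    moreover have "tau k a \<noteq> []" for k a by (cases a) (simp_all add: tau_def word_defs)
    ultimately show ?thesis
      using stake_flat[of "smap ?t nats" n] by (simp add: z_seq_def)
  qed
  have "concat (map ?t [0..<Y.pos i]) = concat (map (\<lambda>i. sw (sg i) (T_letter (X !! i))) [0..<i])" for i
  proof (induction i)
    case (Suc i)
    have "[0..<Y.pos (Suc i)] = [0..<Y.pos i] @ [Y.pos i..<Y.pos (Suc i)]"
      using upt_add_eq_append[of 0 "Y.pos i" "length (g_letter (X !! i))"] by (simp add: Y.pos_Suc)
    moreover have "concat (map ?t [Y.pos i..<Y.pos (Suc i)]) = sw (sg i) (T_letter (X !! i))"
      using Y.snth_pos[of 0 i] Y.snth_pos[of 1 i] Y_parity[of i]
      by (cases "X !! i"; cases "sg i")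
        (simp_all add: Y.pos_Suc upt_rec[of "Y.pos i"] upt_rec[of "Suc (Y.pos i)"] tau_def word_defs)
    ultimately show ?case using Suc by simp
  qed simp
  then show "stake (length (concat (map (\<lambda>i. sw (sg i) (T_letter (X !! i))) [0..<i]))) z_seq
      = concat (map (\<lambda>i. sw (sg i) (T_letter (X !! i))) [0..<i])" for i
    using z[of "Y.pos i"] by simp
qed

abbreviation Z :: "letter stream" where "Z \<equiv> z_seq"

lemma Z_word: "fac Z (Z.pos p) (Z.pos (p + m) - Z.pos p) = sw (sg p) (T_word (fac X p m))"
proof (induction m arbitrary: p)
  case (Suc m)
  have "Z.pos (Suc p) \<le> Z.pos (Suc p + m)" by simp
  then have e: "Z.pos (p + Suc m) - Z.pos p = length (T_letter (X !! p)) + (Z.pos (Suc p + m) - Z.pos (Suc p))"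
    by (simp add: Z.pos_Suc)
  have "fac Z (Z.pos p) (length (T_letter (X !! p))) = sw (sg p) (T_letter (X !! p))"
    using Z.fac_pos[of p "Suc p"] by (simp add: Z.pos_Suc)
  moreover have "Z.pos p + length (T_letter (X !! p)) = Z.pos (Suc p)" by (simp add: Z.pos_Suc)
  ultimately show ?case
    unfolding e fac_add using Suc[of "Suc p"] by (simp add: fac_Suc)
qed simp

lemma Z_pos_Suc: "Z.pos (Suc p) = Z.pos p + (case X !! p of L0 \<Rightarrow> 19 | L1 \<Rightarrow> 24 | L2 \<Rightarrow> 16)"
  by (cases "X !! p") (simp_all add: Z.pos_Suc word_defs)

text \<open>The prefix of length 14 common to all blocks after their first two letters; it recognises the blocks.\<close>

definition marker :: "letter list" where
  "marker = [L1, L0, L1, L1, L0, L1, L0, L0, L1, L0, L1, L1, L0, L1]"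

lemma T_letter_marker: "\<exists>t. T_letter a = [L0, L0] @ marker @ t"
  by (cases a) (simp_all add: word_defs marker_def)

lemma Z_block: "k < length (T_letter (X !! p)) \<Longrightarrow> Z !! (Z.pos p + k) = sw_letter (sg p) (T_letter (X !! p) ! k)"
  using Z.snth_pos[of k p] by simp

lemma Z_pair:
  "k < length (T_word [X !! p, X !! Suc p]) \<Longrightarrow>
    Z !! (Z.pos p + k) = sw_letter (sg p) (T_word [X !! p, X !! Suc p] ! k)"
proof -
  assume k: "k < length (T_word [X !! p, X !! Suc p])"
  let ?W = "T_word [X !! p, X !! Suc p]"
  have W: "fac Z (Z.pos p) (Z.pos (p + 2) - Z.pos p) = sw (sg p) ?W"
    using Z_word[of p 2] by (simp add: fac_Suc numeral_2_eq_2)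
  then have l: "Z.pos (p + 2) - Z.pos p = length ?W"
    by (metis length_fac sw_simps(4))
  have "Z !! (Z.pos p + k) = fac Z (Z.pos p) (Z.pos (p + 2) - Z.pos p) ! k" using k l by (simp only: nth_fac)
  also have "\<dots> = sw_letter (sg p) (?W ! k)" unfolding W using k by (rule nth_sw)
  finally show ?thesis .
qed

definition is_marker :: "nat \<Rightarrow> bool" where
  "is_marker i \<longleftrightarrow> (\<exists>b. fac Z i 14 = sw b marker)"

lemma Z_marker: "fac Z (Z.pos p + 2) 14 = sw (sg p) marker"
proof (rule nth_equalityI)
  fix k assume "k < length (fac Z (Z.pos p + 2) 14)"
  then have k: "k < 14" by simp
  obtain t where t: "T_letter (X !! p) = [L0, L0] @ marker @ t" using T_letter_marker by blast
  have l: "length marker = 14" by (simp add: marker_def)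
  show "fac Z (Z.pos p + 2) 14 ! k = sw (sg p) marker ! k"
    using Z_block[of "2 + k" p] k l by (simp add: t add.assoc nth_append)
qed (simp add: marker_def)

text \<open>Each block has at least 16 letters, so 14 letters starting in one block end in the next
  at the latest, and a check of all pairs of blocks suffices.\<close>

lemma marker_only:
  "k < length (T_letter a) \<Longrightarrow> take 14 (drop k (T_word [a, b])) = sw c marker \<Longrightarrow> k = 2"
proof -
  have "\<forall>k\<in>set [0..<length (T_letter a)]. take 14 (drop k (T_word [a, b])) = sw c marker \<longrightarrow> k = 2"
    by (cases a; cases b; cases c) (simp_all add: word_defs marker_def upt_rec)
  then show "k < length (T_letter a) \<Longrightarrow> take 14 (drop k (T_word [a, b])) = sw c marker \<Longrightarrow> k = 2"
    by auto
qed

lemma is_marker_iff: "is_marker i \<longleftrightarrow> (\<exists>p. i = Z.pos p + 2)"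
proof
  assume "is_marker i"
  then obtain b where b: "fac Z i 14 = sw b marker" by (auto simp: is_marker_def)
  obtain p k where pk: "i = Z.pos p + k" "k < length (sw (sg p) (T_letter (X !! p)))" by (rule Z.pos_cases)
  let ?W = "T_word [X !! p, X !! Suc p]"
  have l: "k + 14 \<le> length ?W"
    using pk(2) by (cases "X !! p"; cases "X !! Suc p") (simp_all add: word_defs)
  have "take 14 (drop k ?W) = sw (sg p) (fac Z i 14)"
    by (rule nth_equalityI) (use l pk(1) in \<open>simp_all add: Z_pair add.assoc del: T_word.simps\<close>)
  then have "take 14 (drop k ?W) = sw (sg p \<noteq> b) marker" using b by simp
  then have "k = 2" using marker_only pk(2) by simp
  then show "\<exists>p. i = Z.pos p + 2" using pk by blast
qed (use Z_marker in \<open>unfold is_marker_def, blast\<close>)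

text \<open>The letters next to a marker, read outwards. The first four are common to all
  neighbouring blocks and all ten to the blocks of \<open>1\<close> and \<open>2\<close>.\<close>

definition outer :: "letter list" where
  "outer = [L0, L0, L2, L0, L2, L2, L0, L2, L0, L0]"

lemma less_10: "t < 10 \<Longrightarrow> t \<in> {0, 1, 2, 3, 4, 5, 6, 7, 8, 9::nat}"
  by auto

lemma Z_right:
  assumes "t < 4 \<or> t < 10 \<and> X !! q \<noteq> L0"
  shows "Z !! (Z.pos q + 16 + t) = sw_letter (sg q) (outer ! t)"
proof -
  have "T_word [a, b] ! (16 + t) = outer ! t \<and> 16 + t < length (T_word [a, b])"
    if "t < 4 \<or> t < 10 \<and> a \<noteq> L0" for a b
    using that less_10[of t] by (cases a; cases b) (auto simp: word_defs outer_def)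
  then show ?thesis using Z_pair[of "16 + t" q] assms by (simp add: add.assoc)
qed

text \<open>After \<open>AA\<close> the block of \<open>0\<close> continues, into the next block,
  with \<open>00200\<close>, those of \<open>1\<close> and \<open>2\<close> with
  \<open>00202\<close>: the fifth letter singles out \<open>0\<close>.\<close>

lemma Z_right_4: "Z !! (Z.pos q + 20) = L0 \<longleftrightarrow> X !! q = L0"
proof -
  have "(T_word [a, b] ! 20 = L0 \<longleftrightarrow> a = L0) \<and> 20 < length (T_word [a, b])" for a b
    by (cases a; cases b) (auto simp: word_defs)
  then show ?thesis using Z_pair[of 20 q] by simp
qed

text \<open>Behind \<open>AA\<close>, the word \<open>00202202\<close> is followed for
  \<open>1\<close> by \<open>001\<close> from a block of the same sign, and for \<open>2\<close> by
  \<open>002\<close> from the second half of the exchanged \<open>AA\<close>. This first difference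
  is the letter itself.\<close>

lemma Z_right_10: "X !! q \<noteq> L0 \<Longrightarrow> Z !! (Z.pos q + 26) = sw_letter (sg q) (X !! q)"
proof -
  have "(a \<noteq> L0 \<longrightarrow> T_word [a, b] ! 26 = a) \<and> 26 < length (T_word [a, b])" for a b
    by (cases a; cases b) (auto simp: word_defs)
  then show "X !! q \<noteq> L0 \<Longrightarrow> ?thesis" using Z_pair[of 26 q] by simp
qed

lemma Z_left:
  assumes "t < 4 \<or> t < 10 \<and> X !! r \<noteq> L0"
  shows "Z !! (Z.pos (Suc r) + 1 - t) = sw_letter (sg (Suc r)) (outer ! t)"
proof -
  have "T_word [a, b] ! (length (T_letter a) + 1 - t) = sw_letter (a = L2) (outer ! t)
      \<and> length (T_letter a) + 1 - t < length (T_word [a, b]) \<and> t < length (T_letter a)"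
    if "t < 4 \<or> t < 10 \<and> a \<noteq> L0" for a b
    using that less_10[of t] by (cases a; cases b) (auto simp: word_defs outer_def)
  from this[of "X !! r" "X !! Suc r"] show ?thesis
    using Z_pair[of "length (T_letter (X !! r)) + 1 - t" r] assms
    by (simp add: Z.pos_Suc)
qed

lemma Z_left_4: "Z !! (Z.pos (Suc r) - 3) = L0 \<longleftrightarrow> X !! r = L0"
proof -
  have "(T_letter a ! (length (T_letter a) - 3) = L0 \<longleftrightarrow> a = L0) \<and> 3 < length (T_letter a)" for a
    by (cases a) (auto simp: word_defs)
  note T = this[of "X !! r"]
  then have "length (T_letter (X !! r)) - 3 < length (T_letter (X !! r))" by linarith
  from Z_block[OF this] show ?thesis using T by (simp add: Z.pos_Suc)
qed

lemma Z_left_10: "X !! r \<noteq> L0 \<Longrightarrow> Z !! (Z.pos (Suc r) - 9) = sw_letter (sg (Suc r)) (X !! r)"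
proof -
  have "(a \<noteq> L0 \<longrightarrow> T_letter a ! (length (T_letter a) - 9) = sw_letter (a = L2) a) \<and> 9 < length (T_letter a)" for a
    by (cases a) (auto simp: word_defs)
  note T = this[of "X !! r"]
  then have "length (T_letter (X !! r)) - 9 < length (T_letter (X !! r))" by linarith
  from Z_block[OF this] show "X !! r \<noteq> L0 \<Longrightarrow> ?thesis" using T by (simp add: Z.pos_Suc)
qed

section \<open>Images between markers, and their reversal\<close>

fun parity :: "letter list \<Rightarrow> bool" where
  "parity [] = False"
| "parity (a # w) = (parity w \<noteq> (a = L2))"

lemma sg_add: "sg (p + m) = (sg p \<noteq> parity (fac X p m))"
proof (induction m arbitrary: p)
  case (Suc m)
  then show ?case using Suc[of "Suc p"] by (auto simp: fac_Suc simp del: snth.simps)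
qed simp

text \<open>All blocks start with \<open>00\<close>, so the cuts can be moved by two letters. A
  shifted block starts with the palindrome \<open>marker\<close> and, followed by the next marker,
  is a palindrome up to exchange.\<close>

definition block :: "letter \<Rightarrow> letter list" where
  "block a = drop 2 (T_letter a) @ [L0, L0]"

text \<open>The image of a word, from its first marker to the end of the next marker after it.\<close>

fun body :: "letter list \<Rightarrow> letter list" where
  "body [] = marker"
| "body (a # w) = block a @ sw (a = L2) (body w)"

lemma length_block: "length (block a) = length (T_letter a)"
  by (cases a) (simp_all add: block_def word_defs)

lemma Z_block_shift: "fac Z (Z.pos p + 2) (length (block (X !! p))) = sw (sg p) (block (X !! p))"
proof (rule nth_equalityI)
  fix k assume "k < length (fac Z (Z.pos p + 2) (length (block (X !! p))))"
  then have k: "k < length (block (X !! p))" by simp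
  have "block a ! k = T_word [a, b] ! (2 + k) \<and> 2 + k < length (T_word [a, b])"
    if "k < length (block a)" for a b
  proof -
    obtain t where "T_letter b = [L0, L0] @ marker @ t" using T_letter_marker by blast
    then have t: "T_word [a, b] = T_letter a @ [L0, L0] @ sw (a = L2) (marker @ t)" by simp
    have l: "2 \<le> length (T_letter a)" by (cases a) (simp_all add: word_defs)
    show ?thesis
    proof (cases "k < length (T_letter a) - 2")
      case True
      then show ?thesis unfolding t block_def by (auto simp: nth_append)
    next
      case False
      then have "k - (length (T_letter a) - 2) < 2" using that l by (simp add: length_block)
      then show ?thesis using False that l
        unfolding t block_def by (auto simp: nth_append less_Suc_eq numeral_2_eq_2)
    qed
  qed
  from this[OF k] show "fac Z (Z.pos p + 2) (length (block (X !! p))) ! k = sw (sg p) (block (X !! p)) ! k"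
    using Z_pair[of "2 + k" p] k by (simp add: add.assoc)
qed simp

lemma Z_body: "fac Z (Z.pos p + 2) (Z.pos (p + m) - Z.pos p + 14) = sw (sg p) (body (fac X p m))"
proof (induction m arbitrary: p)
  case 0
  show ?case using Z_marker[of p] by simp
next
  case (Suc m)
  have "Z.pos (Suc p) \<le> Z.pos (Suc p + m)" by simp
  then have e: "Z.pos (p + Suc m) - Z.pos p + 14
      = length (block (X !! p)) + (Z.pos (Suc p + m) - Z.pos (Suc p) + 14)"
    by (simp add: Z.pos_Suc length_block)
  have "Z.pos p + 2 + length (block (X !! p)) = Z.pos (Suc p) + 2"
    by (simp add: Z.pos_Suc length_block)
  then show ?case
    unfolding e fac_add[of Z "Z.pos p + 2" "length (block (X !! p))" "Z.pos (Suc p + m) - Z.pos (Suc p) + 14"]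
      Z_block_shift
    using Suc[of "Suc p"] by (simp add: fac_Suc)
qed

lemma length_body: "length (body (fac X p m)) = Z.pos (p + m) - Z.pos p + 14"
  using Z_body[of p m] by (metis length_fac sw_simps(4))

lemma body_marker: "\<exists>t. body w = marker @ t"
proof (cases w)
  case (Cons a v)
  obtain t where "T_letter a = [L0, L0] @ marker @ t" using T_letter_marker by blast
  then show ?thesis using Cons by (simp add: block_def)
qed simp

lemma sw_marker_eq: "sw b marker = sw c marker \<longleftrightarrow> b = c"
  by (cases b; cases c) (simp_all add: marker_def)

text \<open>The shifted block of \<open>2\<close> is a prefix of the other two. The closing marker
  resolves this, as the \<open>0\<close> after \<open>f(v)\<close> does in \<open>X_decode\<close>,
  and the first marker reveals the sign \<open>b\<close>.\<close>

lemma body_prefix: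
  "length v \<le> length w \<Longrightarrow> take (length (body v)) (body w) = sw b (body v) \<Longrightarrow> \<not> b \<and> take (length v) w = v"
proof (induction v arbitrary: w b)
  case Nil
  obtain t where "body w = marker @ t" using body_marker by blast
  then have "sw False marker = sw b marker" using Nil by simp
  then show ?case unfolding sw_marker_eq by simp
next
  case (Cons a v)
  then obtain c w' where w: "w = c # w'" by (cases w) auto
  obtain t where t: "body v = marker @ t" using body_marker by blast
  obtain t' where t': "body w' = marker @ t'" using body_marker by blast
  have p: "take (length (block a @ sw (a = L2) (body v))) (block c @ sw (c = L2) (body w'))
      = sw b (block a @ sw (a = L2) (body v))"
    using Cons.prems(2) w by simp
  have "a = c \<and> \<not> b"
    using p unfolding t t'
    by (cases a; cases c; cases b) (simp_all add: block_def word_defs marker_def)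
  then have "take (length (body v)) (body w') = sw False (body v)" using p by simp
  then show ?case using Cons.IH[of w' False] Cons.prems(1) w \<open>a = c \<and> \<not> b\<close> by simp
qed

definition block_end :: "letter \<Rightarrow> letter list" where
  "block_end a = drop 14 (block a) @ sw (a = L2) marker"

lemma block_split: "block a @ sw (a = L2) marker = marker @ block_end a"
  by (cases a) (simp_all add: block_end_def block_def word_defs marker_def)

lemma rev_block: "rev (block a) = sw (a = L2) (block_end a)"
  by (cases a) (simp_all add: block_end_def block_def word_defs marker_def)

lemma body_snoc: "body (w @ [a]) = body w @ sw (parity w) (block_end a)"
proof (induction w)
  case (Cons b w)
  then show ?case by (cases "parity w"; cases "b = L2") simp_all
qed (simp add: block_split)

text \<open>The analogue of \<open>rev_f_morphism\<close>: the signs at the first and the last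
  marker differ by the parity of \<open>w\<close>. So the image of a palindrome with an even number
  of letters \<open>2\<close> is an \<open>R\<close>-palindrome, otherwise an
  \<open>S\<close>-palindrome.\<close>

lemma rev_body: "rev (body w) = sw (parity w) (body (rev w))"
proof (induction w)
  case (Cons a w)
  have "parity (rev w) = parity w" 
  proof -
    have "parity (v @ u) = (parity v \<noteq> parity u)" for u v by (induction v) auto
    then have "parity (rev w) = parity w" for w by (induction w) auto
    then show ?thesis .
  qed
  then show ?case
    using Cons by (cases "parity w"; cases "a = L2") (simp_all add: body_snoc rev_block)
qed (simp add: marker_def)

section \<open>Returns to palindromes of the ternary sequence\<close>

text \<open>\<open>False\<close> stands for palindromes under \<open>R\<close> and
  \<open>True\<close> for those under \<open>S\<close>.\<close>

definition gp :: "letter list \<Rightarrow> bool" where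
  "gp w \<longleftrightarrow> (\<exists>b. rev w = sw b w)"

lemma gp_fac_iff: "gp (fac s i n) \<longleftrightarrow> (\<exists>b. \<forall>k<n. s !! (i + (n - 1 - k)) = sw_letter b (s !! (i + k)))"
  unfolding gp_def by (auto simp: list_eq_iff_nth_eq rev_nth)

lemma gp_sw [simp]: "gp (sw b w) \<longleftrightarrow> gp w"
proof -
  have "gp (sw b w)" if w: "gp w" for b w
  proof -
    obtain c where "rev w = sw c w" using w by (auto simp: gp_def)
    then have "rev (sw b w) = sw c (sw b w)" by (cases b; cases c) simp_all
    then show ?thesis unfolding gp_def by blast
  qed
  from this[of w b] this[of "sw b w" b] show ?thesis by auto
qed

lemma gp_trim:
  assumes "gp (fac s i n)" "2 * d \<le> n"
  shows "gp (fac s (i + d) (n - 2 * d))"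
proof -
  obtain b where b: "\<forall>k<n. s !! (i + (n - 1 - k)) = sw_letter b (s !! (i + k))"
    using assms(1) by (auto simp: gp_fac_iff)
  have "s !! (i + d + (n - 2 * d - 1 - k)) = sw_letter b (s !! (i + d + k))" if "k < n - 2 * d" for k
  proof -
    have "n - 1 - (d + k) = d + (n - 2 * d - 1 - k)" "d + k < n" using that by auto
    then show ?thesis using b by (metis add.assoc)
  qed
  then show ?thesis unfolding gp_fac_iff by blast
qed

text \<open>Core and fringes must be mirrored with the same sign \<open>b\<close>; symmetry of each
  separately would not do.\<close>

lemma gp_extend:
  assumes core: "\<And>k. k < M \<Longrightarrow> s !! (i + a + (M - 1 - k)) = sw_letter b (s !! (i + a + k))"
    and ends: "\<And>k. k < a \<Longrightarrow> s !! (i + (M + 2 * a - 1 - k)) = sw_letter b (s !! (i + k))"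
  shows "gp (fac s i (M + 2 * a))"
  unfolding gp_fac_iff
proof (intro exI[of _ b] allI impI)
  fix k assume k: "k < M + 2 * a"
  consider "k < a" | "a \<le> k" "k < a + M" | "a + M \<le> k" by linarith
  then show "s !! (i + (M + 2 * a - 1 - k)) = sw_letter b (s !! (i + k))"
  proof cases
    case 2
    then have "i + a + (k - a) = i + k" "i + a + (M - 1 - (k - a)) = i + (M + 2 * a - 1 - k)" "k - a < M"
      by auto
    then show ?thesis using core[of "k - a"] by (simp only:)
  next
    case 3
    then have e: "M + 2 * a - 1 - (M + 2 * a - 1 - k) = k" "M + 2 * a - 1 - k < a" using k by auto
    have "s !! (i + k) = sw_letter b (s !! (i + (M + 2 * a - 1 - k)))"
      using ends[OF e(2)] unfolding e(1) .
    then show ?thesis by (cases b) simp_all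
  qed (rule ends)
qed

text \<open>The class of a palindrome under \<open>G_sym\<close> consists of the word and its
  exchange, so these are the occurrences of the class (see \<open>cls_iff_occ\<close>).\<close>

definition occ :: "letter list \<Rightarrow> nat \<Rightarrow> bool" where
  "occ u i \<longleftrightarrow> (\<exists>b. fac Z i (length u) = sw b u)"

definition good_Z :: "letter list \<Rightarrow> bool" where
  "good_Z u \<longleftrightarrow> (\<forall>i j. i < j \<and> occ u i \<and> occ u j \<and> (\<forall>k. i < k \<and> k < j \<longrightarrow> \<not> occ u k)
      \<longrightarrow> gp (fac Z i (j - i + length u)))"

lemma Z_image:
  assumes "fac X r m = fac X p m"
  shows "Z.pos (r + m) - Z.pos r = Z.pos (p + m) - Z.pos p"
    and "k + l \<le> Z.pos (p + m) - Z.pos p + 14 \<Longrightarrow>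
      fac Z (Z.pos r + 2 + k) l = sw (sg r \<noteq> sg p) (fac Z (Z.pos p + 2 + k) l)"
proof -
  show *: "Z.pos (r + m) - Z.pos r = Z.pos (p + m) - Z.pos p"
    using assms length_body[of r m] length_body[of p m] by simp
  define c where "c = Z.pos (p + m) - Z.pos p + 14"
  have r: "fac Z (Z.pos r + 2) c = sw (sg r) (body (fac X p m))"
    and p: "fac Z (Z.pos p + 2) c = sw (sg p) (body (fac X p m))"
    unfolding c_def using Z_body[of r m] Z_body[of p m] assms * by simp_all
  have eq: "fac Z (Z.pos r + 2) c = sw (sg r \<noteq> sg p) (fac Z (Z.pos p + 2) c)"
    unfolding r p by (cases "sg r"; cases "sg p") simp_all
  show "fac Z (Z.pos r + 2 + k) l = sw (sg r \<noteq> sg p) (fac Z (Z.pos p + 2 + k) l)"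
    if kl: "k + l \<le> Z.pos (p + m) - Z.pos p + 14"
  proof -
    have s: "fac Z (x + k) l = take l (drop k (fac Z x c))" for x
      using kl by (simp add: drop_fac take_fac c_def)
    show ?thesis unfolding s eq by simp
  qed
qed

lemma Z_recurrent: "\<exists>j\<ge>N. fac Z j n = fac Z i n"
proof -
  have i: "i \<le> Z.pos i" "i + n \<le> Z.pos (i + n)" by (rule Z.pos_ge)+
  obtain r where r: "N \<le> r" "fac X r (i + n) = fac X 0 (i + n)" "sg r = False"
    using X_recurrent_sg by blast
  have "fac Z (Z.pos r) (Z.pos (r + (i + n)) - Z.pos r) = sw (sg r) (T_word (fac X r (i + n)))"
    by (rule Z_word)
  moreover have "fac Z (Z.pos 0) (Z.pos (0 + (i + n)) - Z.pos 0) = sw (sg 0) (T_word (fac X 0 (i + n)))"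
    by (rule Z_word)
  moreover have "Z.pos (r + (i + n)) - Z.pos r = Z.pos (0 + (i + n)) - Z.pos 0"
    by (rule Z_image(1)[OF r(2)])
  ultimately have "fac Z (Z.pos r) (Z.pos (i + n)) = fac Z 0 (Z.pos (i + n))"
    using r by simp
  then have "fac Z (Z.pos r + i) n = fac Z (0 + i) n"
    by (rule fac_sub) (rule i)
  then show ?thesis using r(1) Z.pos_ge[of r] by (intro exI[of _ "Z.pos r + i"]) simp
qed

text \<open>As in \<open>good_XI\<close>, the bound keeps returns away from the start.\<close>

lemma good_ZI:
  assumes "\<And>i j. \<lbrakk>30 \<le> i; i < j; occ u i; occ u j; \<And>k. i < k \<Longrightarrow> k < j \<Longrightarrow> \<not> occ u k\<rbrakk>
      \<Longrightarrow> gp (fac Z i (j - i + length u))"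
  shows "good_Z u"
  unfolding good_Z_def
proof (intro allI impI, elim conjE)
  fix i j assume ij: "i < j" "occ u i" "occ u j"
    and no: "\<forall>k. i < k \<and> k < j \<longrightarrow> \<not> occ u k"
  let ?n = "length u"
  obtain i' where i': "30 \<le> i'" "fac Z i' (j - i + ?n) = fac Z i (j - i + ?n)"
    using Z_recurrent by blast
  have eq: "occ u (i' + k) \<longleftrightarrow> occ u (i + k)" if "k \<le> j - i" for k
    using fac_sub[OF i'(2), of k ?n] that by (simp add: occ_def)
  have "gp (fac Z i' (i' + (j - i) - i' + ?n))"
  proof (rule assms[OF i'(1)])
    show "\<not> occ u k" if "i' < k" "k < i' + (j - i)" for k
    proof -
      have "occ u k \<longleftrightarrow> occ u (i + (k - i'))" using eq[of "k - i'"] that by simp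
      moreover have "i < i + (k - i')" "i + (k - i') < j" using that by auto
      ultimately show ?thesis using no by simp
    qed
  qed (use ij eq[of 0] eq[of "j - i"] in auto)
  then show "gp (fac Z i (j - i + ?n))" using i'(2) by simp
qed

text \<open>The pattern of \<open>X_transfer\<close>. The copies of \<open>u\<close> at the two ends
  of a return may differ by the exchange, so the symmetry of \<open>u\<close> does not mirror the
  fringes. They are given instead by letters of \<open>outer\<close> with the signs at the two ends,
  which differ by the parity of the return in \<open>X\<close>.\<close>

lemma Z_transfer:
  assumes v: "good_X v" and ae: "a = 0 \<or> e = 0"
    and fwd: "\<And>i. 30 \<le> i \<Longrightarrow> occ u i \<Longrightarrow> \<exists>r. i + a = Z.pos r + 2 + e \<and>
        fac X r (length v) = v \<and> i + length u + e = Z.pos (r + length v) + 16 + a \<and>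
        (\<forall>t<a. Z !! (Z.pos r + 1 - t) = sw_letter (sg r) (outer ! t) \<and>
          Z !! (Z.pos (r + length v) + 16 + t) = sw_letter (sg (r + length v)) (outer ! t))"
    and bwd: "\<And>r. 30 + a \<le> Z.pos r + 2 + e \<Longrightarrow> fac X r (length v) = v \<Longrightarrow> occ u (Z.pos r + 2 + e - a)"
  shows "good_Z u"
proof (rule good_ZI)
  fix i j assume i30: "30 \<le> i" and ij: "i < j" and u: "occ u i" "occ u j"
    and no: "\<And>k. i < k \<Longrightarrow> k < j \<Longrightarrow> \<not> occ u k"
  let ?n = "length u" and ?m = "length v"
  obtain r where r: "i + a = Z.pos r + 2 + e" "fac X r ?m = v" "i + ?n + e = Z.pos (r + ?m) + 16 + a"
      "\<And>t. t < a \<Longrightarrow> Z !! (Z.pos r + 1 - t) = sw_letter (sg r) (outer ! t)"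
    using fwd[OF i30 u(1)] by blast
  obtain r' where r': "j + a = Z.pos r' + 2 + e" "fac X r' ?m = v" "j + ?n + e = Z.pos (r' + ?m) + 16 + a"
      "\<And>t. t < a \<Longrightarrow> Z !! (Z.pos (r' + ?m) + 16 + t) = sw_letter (sg (r' + ?m)) (outer ! t)"
    using fwd[OF _ u(2)] i30 ij by auto
  have "Z.pos r < Z.pos r'" using ij r(1) r'(1) by linarith
  then have rr: "r < r'" by simp
  have nov: "fac X k ?m \<noteq> v" if k: "r < k" "k < r'" for k
  proof
    assume v: "fac X k ?m = v"
    have "Z.pos r < Z.pos k" "Z.pos k < Z.pos r'" using k by simp_all
    then have "30 + a \<le> Z.pos k + 2 + e" "i < Z.pos k + 2 + e - a" "Z.pos k + 2 + e - a < j"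
      using i30 r(1) r'(1) by linarith+
    then show False using bwd[OF _ v] no by blast
  qed
  define E where "E = fac X r (r' - r + ?m)"
  have E: "pal E"
    using v rr r r' nov unfolding good_X_def E_def by blast
  define M where "M = Z.pos (r' + ?m) - Z.pos r + 14"
  have rm: "r + (r' - r + ?m) = r' + ?m" using rr by simp
  have F: "fac Z (Z.pos r + 2) M = sw (sg r) (body E)"
    using Z_body[of r "r' - r + ?m"] unfolding rm M_def E_def .
  have sg: "sg (r' + ?m) = (sg r \<noteq> parity E)"
    using sg_add[of r "r' - r + ?m"] unfolding rm E_def .
  have "rev (body E) = sw (parity E) (body E)" using E rev_body[of E] by (simp add: pal_def)
  then have rF: "rev (fac Z (Z.pos r + 2) M) = sw (parity E) (fac Z (Z.pos r + 2) M)"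
    unfolding F by (cases "sg r"; cases "parity E") simp_all
  have le: "Z.pos r < Z.pos r'" "Z.pos r' \<le> Z.pos (r' + ?m)" using rr by simp_all
  show "gp (fac Z i (j - i + ?n))"
  proof (cases "a = 0")
    case True
    then have "i = Z.pos r + 2 + e" "j - i + ?n = M - 2 * e" "2 * e \<le> M"
      using r(1,3) r'(1,3) le ij unfolding M_def by linarith+
    moreover have "gp (fac Z (Z.pos r + 2) M)" using rF unfolding gp_def by blast
    ultimately show ?thesis using gp_trim[of Z "Z.pos r + 2" M e] by simp
  next
    case False
    then have e: "e = 0" using ae by simp
    then have eq: "Z.pos r + 2 = i + a" "j - i + ?n = M + 2 * a"
      using r(1,3) r'(1,3) le ij unfolding M_def by linarith+
    show ?thesis unfolding eq(2)
    proof (rule gp_extend)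
      fix k assume k: "k < M"
      have "rev (fac Z (i + a) M) ! k = sw (parity E) (fac Z (i + a) M) ! k"
        using rF unfolding eq(1) by (simp only:)
      then show "Z !! (i + a + (M - 1 - k)) = sw_letter (parity E) (Z !! (i + a + k))"
        using k by (simp add: rev_nth)
    next
      fix k assume k: "k < a"
      have t: "a - 1 - k < a" using k by simp
      have "Z.pos r + 1 - (a - 1 - k) = i + k" using eq(1) k by linarith
      then have L: "Z !! (i + k) = sw_letter (sg r) (outer ! (a - 1 - k))" using r(4)[OF t] by (simp only:)
      have "Z.pos (r' + ?m) + 16 + (a - 1 - k) = i + (M + 2 * a - 1 - k)"
        using eq r'(3) e ij k by linarith
      then have "Z !! (i + (M + 2 * a - 1 - k)) = sw_letter (sg (r' + ?m)) (outer ! (a - 1 - k))"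
        using r'(4)[OF t] by (simp only:)
      then show "Z !! (i + (M + 2 * a - 1 - k)) = sw_letter (parity E) (Z !! (i + k))"
        unfolding L sg by (cases "sg r"; cases "parity E") simp_all
    qed
  qed
qed

lemma Z_decode:
  assumes "fac Z (Z.pos r + 2) (length (body v)) = sw b (body v)"
  shows "fac X r (length v) = v" "sg r = b" "Z.pos (r + length v) - Z.pos r + 14 = length (body v)"
proof -
  \<comment> \<open>No block is empty, so \<open>N\<close> letters of \<open>X\<close> have an image
    that covers \<open>body v\<close>.\<close>
  define N where "N = length v + length (body v)"
  have "N \<le> Z.pos (r + N) - Z.pos r + 14"
  proof -
    have "k \<le> Z.pos (r + k) - Z.pos r" for k
    proof (induction k)
      case (Suc k)
      moreover have "Z.pos (r + k) < Z.pos (r + Suc k)" "Z.pos r \<le> Z.pos (r + k)" by simp_all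
      ultimately show ?case by linarith
    qed simp
    from this[of N] show ?thesis by simp
  qed
  then have "length (body v) \<le> Z.pos (r + N) - Z.pos r + 14" by (simp add: N_def)
  then have "fac Z (Z.pos r + 2) (length (body v)) = take (length (body v)) (sw (sg r) (body (fac X r N)))"
    unfolding Z_body[symmetric] by (simp add: take_fac)
  then have "sw (sg r) (take (length (body v)) (body (fac X r N))) = sw b (body v)"
    using assms by simp
  then have "take (length (body v)) (body (fac X r N)) = sw (sg r) (sw b (body v))"
    by (metis sw_simps(5,6))
  then have *: "take (length (body v)) (body (fac X r N)) = sw (sg r \<noteq> b) (body v)"
    by (simp only: sw_simps(5))
  have "\<not> (sg r \<noteq> b) \<and> take (length v) (fac X r N) = v"
    by (rule body_prefix[OF _ *]) (simp add: N_def)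
  then show 1: "fac X r (length v) = v" and "sg r = b" by (auto simp: take_fac N_def)
  show "Z.pos (r + length v) - Z.pos r + 14 = length (body v)"
    using length_body[of r "length v"] 1 by simp
qed

text \<open>A palindrome containing the marker is \<open>t body(v) t'\<close> up to the exchange of \<open>1\<close> and \<open>2\<close>. The
  offset \<open>a\<close> of the first marker tells what \<open>t\<close> reveals about the neighbours of \<open>v\<close>: nothing if \<open>a \<le> 4\<close>,
  whether they are \<open>0\<close> if \<open>5 \<le> a \<le> 10\<close>, and everything if \<open>a \<ge> 11\<close>.\<close>

lemma good_Z_marker:
  assumes gp_u: "gp u" and i: "30 \<le> i" "fac Z i (length u) = u"
    and mk: "\<exists>k. k + 14 \<le> length u \<and> is_marker (i + k)"
  shows "good_Z u"
proof -
  define n where "n = length u"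
  have u: "u = fac Z i n" using i(2) by (simp add: n_def)
  obtain b0 where b0: "Z !! (i + (n - 1 - k)) = sw_letter b0 (Z !! (i + k))" if "k < n" for k
    using gp_u unfolding u gp_fac_iff by blast
  define a where "a = (LEAST k. k + 14 \<le> n \<and> is_marker (i + k))"
  have a: "a + 14 \<le> n" "is_marker (i + a)"
    using LeastI_ex[OF mk] unfolding a_def n_def by blast+
  have min: "\<not> (k + 14 \<le> n \<and> is_marker (i + k))" if "k < a" for k
    using that unfolding a_def by (rule not_less_Least)
  \<comment> \<open>The marker is a palindrome, so the reflection of the first marker in
    \<open>u\<close> is again a marker, the last one.\<close>
  have mrefl: "is_marker (i + (n - 14 - a))"
  proof -
    obtain b where b: "fac Z (i + a) 14 = sw b marker" using a(2) by (auto simp: is_marker_def)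
    have "fac Z (i + (n - 14 - a)) 14 = sw b0 (rev (fac Z (i + a) 14))"
    proof (rule nth_equalityI)
      fix k assume "k < length (fac Z (i + (n - 14 - a)) 14)"
      then have k: "k < 14" by simp
      have "n - 1 - (a + (13 - k)) = n - 14 - a + k" "a + (13 - k) < n" using k a(1) by auto
      then have "Z !! (i + (n - 14 - a + k)) = sw_letter b0 (Z !! (i + (a + (13 - k))))"
        using b0[of "a + (13 - k)"] by (simp only:)
      moreover have "14 - Suc k = 13 - k" by simp
      ultimately show "fac Z (i + (n - 14 - a)) 14 ! k = sw b0 (rev (fac Z (i + a) 14)) ! k"
        using k by (simp add: rev_nth add.assoc)
    qed simp
    also have "\<dots> = sw (b0 \<noteq> b) marker" using b by (simp add: marker_def)
    finally show ?thesis unfolding is_marker_def by blast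
  qed
  obtain p where p: "i + a = Z.pos p + 2" using a(2) is_marker_iff by blast
  obtain q where q: "i + (n - 14 - a) = Z.pos q + 2" using mrefl is_marker_iff by blast
  have "a \<le> n - 14 - a"
  proof (rule ccontr)
    assume "\<not> ?thesis"
    then show False using min[of "n - 14 - a"] mrefl a(1) by simp
  qed
  then have "Z.pos p \<le> Z.pos q" using p q by linarith
  then have pq: "p \<le> q" by simp
  define m where "m = q - p"
  have qm: "q = p + m" using pq by (simp add: m_def)
  define v where "v = fac X p m"
  have lv: "length v = m" by (simp add: v_def)
  define c where "c = Z.pos q - Z.pos p + 14"
  have n_eq: "n = c + 2 * a" using p q a(1) \<open>Z.pos p \<le> Z.pos q\<close> \<open>a \<le> n - 14 - a\<close> unfolding c_def by linarith
  have core: "fac Z (Z.pos p + 2) c = sw (sg p) (body v)"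
    using Z_body[of p m] by (simp add: c_def qm v_def)
  have cl: "length (body v) = c" using length_body[of p m] by (simp add: v_def c_def qm)
  \<comment> \<open>The symmetry of the core equates \<open>body (rev v)\<close> and
    \<open>body v\<close> up to exchange, and \<open>body\<close> can be decoded.\<close>
  have pal_v: "pal v"
  proof -
    have "gp (fac Z (i + a) (n - 2 * a))"
      using gp_trim[of Z i n a] gp_u n_eq by (simp add: u)
    then have "gp (body v)" using core p n_eq by simp
    then obtain b where "rev (body v) = sw b (body v)" by (auto simp: gp_def)
    then have "sw (parity v) (body (rev v)) = sw b (body v)" using rev_body[of v] by simp
    then have "body (rev v) = sw (parity v) (sw b (body v))" by (metis sw_simps(5,6))
    then have e: "body (rev v) = sw (parity v \<noteq> b) (body v)" by (simp only: sw_simps(5))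
    then have "length (body (rev v)) = length (body v)" by (simp only: sw_simps(4))
    then have "take (length (body v)) (body (rev v)) = sw (parity v \<noteq> b) (body v)"
      using e by (metis order_refl take_all)
    then show ?thesis using body_prefix[of v "rev v"] by (simp add: pal_def)
  qed
  have good_v: "good_X v"
    using good_X_pal[OF pal_v, of p] by (simp add: lv) (simp add: v_def)
  \<comment> \<open>Data of an occurrence of \<open>u\<close> at \<open>i'\<close>: \<open>r\<close>
    is the block of its first marker and \<open>b\<close> the exchange relative to the occurrence at
    \<open>i\<close>.\<close>
  define D where "D i' r b \<longleftrightarrow> i' + a = Z.pos r + 2 \<and> fac X r m = v \<and> 0 < r \<and>
      i' + n = Z.pos (r + m) + 16 + a \<and> (\<forall>k<n. Z !! (i' + k) = sw_letter b (Z !! (i + k)))" for i' r b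
  have decode: "\<exists>r b. D i' r b" if i': "30 \<le> i'" "occ u i'" for i'
  proof -
    obtain b where "fac Z i' n = sw b u" using i'(2) unfolding occ_def n_def by blast
    then have b: "fac Z i' n = sw b (fac Z i n)" unfolding u[symmetric] .
    have eq: "fac Z (i' + k) l = sw b (fac Z (i + k) l)" if "k + l \<le> n" for k l
    proof -
      have "fac Z (x + k) l = take l (drop k (fac Z x n))" for x
        using that by (simp add: drop_fac take_fac)
      then show ?thesis using b by simp
    qed
    obtain b' where "fac Z (i + a) 14 = sw b' marker" using a(2) by (auto simp: is_marker_def)
    then have "fac Z (i' + a) 14 = sw (b \<noteq> b') marker" using eq[OF a(1)] by simp
    then have "is_marker (i' + a)" unfolding is_marker_def by blast
    then obtain r where r: "i' + a = Z.pos r + 2" using is_marker_iff by blast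
    have "fac Z (Z.pos r + 2) c = sw b (sw (sg p) (body v))" using eq[of a c] n_eq core p r by simp
    then have "fac Z (Z.pos r + 2) (length (body v)) = sw (b \<noteq> sg p) (body v)"
      unfolding cl by (simp only: sw_simps(5))
    note d = Z_decode[OF this, unfolded lv cl]
    have "Z.pos r \<le> Z.pos (r + m)" by simp
    then have "i' + n = Z.pos (r + m) + 16 + a" using d(3) r n_eq by linarith
    moreover have "0 < r" using r i'(1) by (cases r) auto
    moreover have "Z !! (i' + k) = sw_letter b (Z !! (i + k))" if "k < n" for k
      using b that by (metis length_fac nth_fac nth_sw)
    ultimately show ?thesis using r d(1) unfolding D_def by blast
  qed
  obtain D0: "D i p False" and "0 < p"
  proof -
    have "0 < p" using p i(1) by (cases p) auto
    moreover have "i + n = Z.pos (p + m) + 16 + a" using q \<open>a \<le> n - 14 - a\<close> a(1) unfolding qm[symmetric] by linarith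
    ultimately show thesis using that p by (simp add: D_def v_def)
  qed
  then obtain p0 where p0: "p = Suc p0" by (cases p) auto
  have trimmed: "good_Z u" if d: "\<And>i' r B. D i' r B \<Longrightarrow> X !! (r - 1) = b \<and> X !! (r + m) = b" and a0: "0 < a" for b
  proof -
    define w where "w = b # v @ [b]"
    have w: "length w = m + 2" "pal w" using pal_v by (simp_all add: w_def lv pal_def)
    have ww: "fac X (r - 1) (length w) = w" if "D i' r B" for i' r B
    proof -
      have "fac X (r - 1) (1 + (m + 1)) = w"
        unfolding fac_add using that d[OF that] by (simp add: fac_1 w_def D_def)
      then show ?thesis using w by simp
    qed
    define l where "l = length (T_letter b)"
    have posl: "Z.pos (Suc r) = Z.pos r + l" if "X !! r = b" for r
      using that by (simp add: Z.pos_Suc l_def)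
    have X0: "X !! p0 = b" "X !! (p + m) = b" using d[OF D0] p0 by auto
    \<comment> \<open>A fringe as long as the block of \<open>b\<close> would contain an earlier
      marker.\<close>
    have al: "a < l"
    proof (rule ccontr)
      assume "\<not> a < l"
      then have "i + (a - l) = Z.pos p0 + 2" using p posl[OF X0(1)] p0 by simp
      then have "is_marker (i + (a - l))" using is_marker_iff by blast
      moreover have "0 < l" unfolding l_def by (cases b) (simp_all add: word_defs)
      ultimately show False using min[of "a - l"] a(1) a0 by simp
    qed
    have w0: "fac X p0 (length w) = w" using ww[OF D0] p0 by simp
    show ?thesis
    proof (rule Z_transfer[where v = w and a = 0 and e = "l - a"])
      show "good_X w" by (rule good_X_pal[OF w(2) w0])
      show "\<exists>r. i' + 0 = Z.pos r + 2 + (l - a) \<and> fac X r (length w) = w \<and>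
          i' + length u + (l - a) = Z.pos (r + length w) + 16 + 0 \<and>
          (\<forall>t<0. Z !! (Z.pos r + 1 - t) = sw_letter (sg r) (outer ! t) \<and>
          Z !! (Z.pos (r + length w) + 16 + t) = sw_letter (sg (r + length w)) (outer ! t))"
        if i': "30 \<le> i'" "occ u i'" for i'
      proof -
        obtain r B where D: "D i' r B" using decode[OF i'] by blast
        obtain r0 where r0: "r = Suc r0" using D unfolding D_def by (cases r) auto
        have e: "i' + a = Z.pos r + 2" "i' + n = Z.pos (r + m) + 16 + a"
          using D unfolding D_def by blast+
        have "Z.pos r = Z.pos r0 + l" "Z.pos (Suc (r + m)) = Z.pos (r + m) + l"
          using posl[of r0] posl[of "r + m"] d[OF D] r0 by simp_all
        then have "i' = Z.pos r0 + 2 + (l - a)" "i' + n + (l - a) = Z.pos (Suc (r + m)) + 16"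
          using e al by linarith+
        moreover have "r0 + length w = Suc (r + m)" using w r0 by simp
        ultimately show ?thesis using ww[OF D] r0 by (intro exI[of _ r0]) (simp add: n_def)
      qed
      show "occ u (Z.pos r + 2 + (l - a) - 0)" if r: "fac X r (length w) = w" for r
      proof -
        have "Z.pos (p0 + length w) = Z.pos (p + m) + l" "Z.pos p = Z.pos p0 + l"
          using posl[OF X0(2)] posl[OF X0(1)] p0 w by simp_all
        then have le: "l - a + n \<le> Z.pos (p0 + length w) - Z.pos p0 + 14" and i0: "i = Z.pos p0 + 2 + (l - a)"
          using n_eq p qm al \<open>Z.pos p \<le> Z.pos q\<close> unfolding c_def by auto
        have "fac Z (Z.pos r + 2 + (l - a)) n = sw (sg r \<noteq> sg p0) (fac Z i n)"
          unfolding i0 by (rule Z_image(2)[OF _ le]) (use r w0 in simp)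
        then show ?thesis unfolding u[symmetric] occ_def n_def[symmetric] by auto
      qed
    qed simp
  qed
  \<comment> \<open>The fringe is the same at all occurrences of \<open>v\<close>, up to the signs
    on its two sides, so \<open>u\<close> occurs wherever \<open>v\<close> does.\<close>
  have extended: "good_Z u"
    if sides: "\<And>r. 0 < r \<Longrightarrow> fac X r m = v \<Longrightarrow> a \<le> 4 \<or> a \<le> 10 \<and> X !! (r - 1) \<noteq> L0 \<and> X !! (r + m) \<noteq> L0"
  proof -
    have lets: "Z !! (Z.pos r + 1 - t) = sw_letter (sg r) (outer ! t) \<and>
        Z !! (Z.pos (r + m) + 16 + t) = sw_letter (sg (r + m)) (outer ! t)"
      if r: "0 < r" "fac X r m = v" and t: "t < a" for r t
    proof -
      obtain r0 where r0: "r = Suc r0" using r(1) by (cases r) auto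
      have "t < 4 \<or> t < 10 \<and> X !! r0 \<noteq> L0" "t < 4 \<or> t < 10 \<and> X !! (r + m) \<noteq> L0"
        using sides[OF r] t r0 by auto
      then show ?thesis using Z_left[of t r0] Z_right[of t "r + m"] r0 by simp
    qed
    show ?thesis
    proof (rule Z_transfer[where v = v and a = a and e = 0])
      show "\<exists>r. i' + a = Z.pos r + 2 + 0 \<and> fac X r (length v) = v \<and>
          i' + length u + 0 = Z.pos (r + length v) + 16 + a \<and>
          (\<forall>t<a. Z !! (Z.pos r + 1 - t) = sw_letter (sg r) (outer ! t) \<and>
          Z !! (Z.pos (r + length v) + 16 + t) = sw_letter (sg (r + length v)) (outer ! t))"
        if i': "30 \<le> i'" "occ u i'" for i'
      proof -
        obtain r B where "D i' r B" using decode[OF i'] by blast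
        then show ?thesis using lets[of r] unfolding lv D_def by (intro exI[of _ r]) (auto simp: n_def)
      qed
      show "occ u (Z.pos r + 2 + 0 - a)" if r30: "30 + a \<le> Z.pos r + 2 + 0" and r': "fac X r (length v) = v" for r
      proof -
        have r: "fac X r m = v" "0 < r" using r' r30 lv by (auto intro: Nat.gr0I)
        have rp: "fac X r m = fac X p m" using r by (simp add: v_def)
        have im: "fac Z (Z.pos r + 2 + 0) c = sw (sg r \<noteq> sg p) (fac Z (Z.pos p + 2 + 0) c)"
          by (rule Z_image(2)[OF rp]) (simp add: c_def qm)
        have rc: "Z.pos r + 2 + c = Z.pos (r + m) + 16"
        proof -
          have "Z.pos r \<le> Z.pos (r + m)" "Z.pos p \<le> Z.pos (p + m)" by simp_all
          then show ?thesis using Z_image(1)[OF rp] unfolding c_def qm by linarith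
        qed
        have pc: "Z.pos p + 2 + c = Z.pos (p + m) + 16"
          using \<open>Z.pos p \<le> Z.pos q\<close> unfolding c_def qm by linarith
        have sgm: "sg (r + m) = (sg r \<noteq> parity v)" "sg (p + m) = (sg p \<noteq> parity v)"
          using sg_add[of r m] sg_add[of p m] r by (simp_all add: v_def)
        have Lr: "fac Z (Z.pos r + 2 - a) a = sw (sg r) (rev (take a outer))"
          and Lp: "fac Z (Z.pos p + 2 - a) a = sw (sg p) (rev (take a outer))"
          and Rr: "fac Z (Z.pos (r + m) + 16) a = sw (sg (r + m)) (take a outer)"
          and Rp: "fac Z (Z.pos (p + m) + 16) a = sw (sg (p + m)) (take a outer)"
        proof -
          have a10: "a \<le> length outer" using sides[OF r(2,1)] by (auto simp: outer_def)
          have L: "fac Z (Z.pos r + 2 - a) a = sw (sg r) (rev (take a outer))"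
            if r: "0 < r" "fac X r m = v" "a \<le> Z.pos r + 2" for r
          proof (rule nth_equalityI)
            fix k assume "k < length (fac Z (Z.pos r + 2 - a) a)"
            then have k: "k < a" by simp
            then have "Z.pos r + 2 - a + k = Z.pos r + 1 - (a - 1 - k)" "a - 1 - k < a" using r(3) by auto
            then show "fac Z (Z.pos r + 2 - a) a ! k = sw (sg r) (rev (take a outer)) ! k"
              using lets[OF r(1,2), of "a - 1 - k"] k a10 by (simp add: rev_nth)
          qed (use a10 in simp)
          have R: "fac Z (Z.pos (r + m) + 16) a = sw (sg (r + m)) (take a outer)"
            if r: "0 < r" "fac X r m = v" for r
            by (rule nth_equalityI) (use lets[OF r] a10 in simp_all)
          show "fac Z (Z.pos r + 2 - a) a = sw (sg r) (rev (take a outer))"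
            using L[OF r(2,1)] r30 by simp
          show "fac Z (Z.pos p + 2 - a) a = sw (sg p) (rev (take a outer))"
            using L[of p] \<open>0 < p\<close> p by (simp add: v_def)
          show "fac Z (Z.pos (r + m) + 16) a = sw (sg (r + m)) (take a outer)" by (rule R[OF r(2,1)])
          show "fac Z (Z.pos (p + m) + 16) a = sw (sg (p + m)) (take a outer)"
            using R[of p] \<open>0 < p\<close> by (simp add: v_def)
        qed
        have split: "fac Z (x + 2 - a) n = fac Z (x + 2 - a) a @ fac Z (x + 2) c @ fac Z (x + 2 + c) a"
          if "a \<le> x + 2" for x
        proof -
          have "n = a + (c + a)" using n_eq by simp
          then show ?thesis using that by (simp only: fac_add) simp
        qed
        have "fac Z (Z.pos r + 2 - a) n = sw (sg r \<noteq> sg p) (fac Z (Z.pos p + 2 - a) n)"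
        proof -
          have "a \<le> Z.pos r + 2" "a \<le> Z.pos p + 2" using r30 p by linarith+
          then show ?thesis
            unfolding split[OF \<open>a \<le> Z.pos r + 2\<close>] split[OF \<open>a \<le> Z.pos p + 2\<close>] rc pc Lr Lp Rr Rp sgm
            using im by (cases "sg r"; cases "sg p"; cases "parity v") simp_all
        qed
        moreover have "Z.pos p + 2 - a = i" using p by simp
        ultimately have "fac Z (Z.pos r + 2 + 0 - a) n = sw (sg r \<noteq> sg p) u" unfolding u by simp
        then show ?thesis unfolding occ_def n_def[symmetric] by blast
      qed
    qed (use good_v in auto)
  qed
  show ?thesis
  proof (cases "a \<le> 4")
    case True
    then show ?thesis by (intro extended) simp
  next
    case a5: False
    \<comment> \<open>Offset \<open>a - 5\<close> is the fifth letter to the left of the first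
      marker, where \<open>Z_left_4\<close> and \<open>Z_right_4\<close> detect a neighbour
      \<open>0\<close>.\<close>
    have kn: "a - 5 < n" "n - 1 - (a - 5) < n" using a(1) by auto
    have zero: "(X !! (r - 1) = L0 \<longleftrightarrow> Z !! (i + (a - 5)) = L0) \<and> (X !! (r + m) = L0 \<longleftrightarrow> Z !! (i + (a - 5)) = L0)"
      if D: "D i' r B" for i' r B
    proof -
      obtain r0 where r0: "r = Suc r0" using D unfolding D_def by (cases r) auto
      have "Z.pos r - 3 = i' + (a - 5)" "Z.pos (r + m) + 20 = i' + (n - 1 - (a - 5))"
        using D a5 a(1) unfolding D_def by auto
      moreover have "Z !! (i' + k) = sw_letter B (Z !! (i + k))" if "k < n" for k
        using D that unfolding D_def by blast
      from this[OF kn(1)] this[OF kn(2)]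
      have "Z !! (i' + (a - 5)) = L0 \<longleftrightarrow> Z !! (i + (a - 5)) = L0"
        "Z !! (i' + (n - 1 - (a - 5))) = L0 \<longleftrightarrow> Z !! (i + (a - 5)) = L0"
        unfolding b0[OF kn(1)] by (simp_all only: sw_letter_simps)
      ultimately show ?thesis using Z_left_4[of r0] Z_right_4[of "r + m"] r0 by simp
    qed
    show ?thesis
    proof (cases "Z !! (i + (a - 5)) = L0")
      case True
      then show ?thesis using a5 zero by (intro trimmed[of L0]) auto
    next
      case nz: False
      show ?thesis
      proof (cases "a \<le> 10")
        case a10: True
        \<comment> \<open>If \<open>v\<close> begins with \<open>0\<close>, its neighbours are
          nonzero at all occurrences, so the fringe is forced; otherwise the nonzero neighbours are
          both \<open>2\<close>.\<close>
        show ?thesis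
        proof (cases "0 < m \<and> X !! p = L0")
          case True
          have "X !! (r - 1) \<noteq> L0 \<and> X !! (r + m) \<noteq> L0" if "0 < r" "fac X r m = v" for r
            using X_sides_nonzero[of m r] pal_ends[of p m r] pal_v that True by (auto simp: v_def)
          then show ?thesis using a10 by (intro extended) auto
        next
          case False
          have "X !! (r - 1) = L2 \<and> X !! (r + m) = L2" if D: "D i' r B" for i' r B
            using X_sides_L2[of r m] zero[OF D] nz pal_ends[of p m r] pal_v D False
            by (auto simp: v_def D_def)
          then show ?thesis using a5 by (intro trimmed[of L2]) auto
        qed
      next
        case a11: False
        have kn: "a < n" "n - 1 - a < n" "a - 11 < n" "n - 1 - (a - 11) < n" using a(1) by auto
        \<comment> \<open>Offset \<open>a - 11\<close> is where \<open>Z_left_10\<close> and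
          \<open>Z_right_10\<close> tell the neighbours \<open>1\<close> and \<open>2\<close> apart,
          up to the sign.\<close>
        define y where "y = Z !! (i + (a - 11))"
        have first: "Z !! (Z.pos r + 2) = sw_letter (sg r) L1" "Z !! (Z.pos r + 15) = sw_letter (sg r) L1" for r
        proof -
          have "fac Z (Z.pos r + 2) 14 ! 0 = sw (sg r) marker ! 0" "fac Z (Z.pos r + 2) 14 ! 13 = sw (sg r) marker ! 13"
            by (simp_all only: Z_marker)
          then show "Z !! (Z.pos r + 2) = sw_letter (sg r) L1" "Z !! (Z.pos r + 15) = sw_letter (sg r) L1"
            by (simp_all add: marker_def add.commute)
        qed
        have sw1: "sw_letter b L1 = sw_letter b' L1 \<longleftrightarrow> b = b'" for b b'
          by (cases b; cases b') simp_all
        \<comment> \<open>The first letter of the first marker and the last letter of the last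
          marker mirror each other, and both are \<open>1\<close> up to the sign of their marker.
          This ties \<open>b0\<close> to the parity.\<close>
        have "Z.pos q + 15 = i + (n - 1 - a)" using q \<open>a \<le> n - 14 - a\<close> a(1) by linarith
        then have "sw_letter (sg q) L1 = sw_letter b0 (sw_letter (sg p) L1)"
          using b0[OF kn(1)] first(1)[of p] first(2)[of q] p by (simp only:)
        then have par: "b0 = parity v"
          using sg_add[of p m] sw1 unfolding qm v_def by (auto simp: sw_letter_simps(4))
        have "X !! (r - 1) = sw_letter (sg p) y \<and> X !! (r + m) = sw_letter (sg p) y" if D: "D i' r B" for i' r B
        proof -
          obtain r0 where r0: "r = Suc r0" using D unfolding D_def by (cases r) auto
          have DZ: "Z !! (i' + k) = sw_letter B (Z !! (i + k))" if "k < n" for k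
            using D that unfolding D_def by blast
          have ra: "i' + a = Z.pos r + 2" using D unfolding D_def by blast
          have "sw_letter (sg r) L1 = sw_letter B (sw_letter (sg p) L1)"
            using DZ[OF kn(1)] first(1)[of r] first(1)[of p] ra p by (simp only:)
          then have sr: "sg r = (B \<noteq> sg p)" using sw1 by (simp add: sw_letter_simps(4))
          have srm: "sg (r + m) = (sg r \<noteq> parity v)" using sg_add[of r m] D by (simp add: D_def)
          have nz': "X !! r0 \<noteq> L0" "X !! (r + m) \<noteq> L0" using zero[OF D] nz r0 by auto
          have "Z.pos (Suc r0) - 9 = i' + (a - 11)" using ra r0 a11 by simp
          then have "sw_letter (sg r) (X !! r0) = sw_letter B y"
            using Z_left_10[OF nz'(1)] DZ[OF kn(3)] r0 by (simp add: y_def)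
          then have 1: "X !! r0 = sw_letter (sg p) y"
            unfolding sr by (cases B; cases "sg p"; cases "X !! r0"; cases y) simp_all
          have "i' + n = Z.pos (r + m) + 16 + a" using D unfolding D_def by blast
          then have "Z.pos (r + m) + 26 = i' + (n - 1 - (a - 11))" using a11 a(1) by simp
          then have "sw_letter (sg (r + m)) (X !! (r + m)) = sw_letter B (sw_letter b0 y)"
            using Z_right_10[OF nz'(2)] DZ[OF kn(4)] b0[OF kn(3)] unfolding y_def by (simp only:)
          then have "X !! (r + m) = sw_letter (sg p) y"
            unfolding srm sr par
            by (cases B; cases "sg p"; cases "parity v"; cases "X !! (r + m)"; cases y) simp_all
          then show ?thesis using 1 r0 by simp
        qed
        then show ?thesis using a11 by (intro trimmed[of "sw_letter (sg p) y"]) auto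
      qed
    qed
  qed
qed

section \<open>Returns to palindromes without marker\<close>

text \<open>Written with conditionals, so that evaluation can stop at the first difference.\<close>

fun starts_with :: "letter list \<Rightarrow> letter list \<Rightarrow> bool" where
  "starts_with [] r = True"
| "starts_with (x # w) [] = False"
| "starts_with (x # w) (y # r) = (if x = y then starts_with w r else False)"

definition starts_sw :: "letter list \<Rightarrow> letter list \<Rightarrow> bool" where
  "starts_sw w r = (if starts_with w r then True else starts_with (map swap_letter w) r)"

fun has_marker :: "letter list \<Rightarrow> bool" where
  "has_marker [] = False"
| "has_marker (x # w) = (if starts_sw marker (x # w) then True else has_marker w)"

definition gp_check :: "letter list \<Rightarrow> bool" where
  "gp_check w \<longleftrightarrow> (if rev w = w then True else rev w = map swap_letter w)"

text \<open>\<open>acc\<close> holds the letters already passed, in reverse. Reaching the end of the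
  list is a failure, so success also shows that the complete return fits into the window.\<close>

fun ret_ok :: "letter list \<Rightarrow> letter list \<Rightarrow> letter list \<Rightarrow> bool" where
  "ret_ok w acc [] = False"
| "ret_ok w acc (c # r) =
     (if starts_sw w (c # r) then gp_check (rev acc @ take (length w) (c # r)) else ret_ok w (c # acc) r)"

fun all_prefixes :: "nat \<Rightarrow> letter list \<Rightarrow> letter list \<Rightarrow> letter list \<Rightarrow> bool" where
  "all_prefixes 0 acc z r = True"
| "all_prefixes (Suc n) acc z [] = False"
| "all_prefixes (Suc n) acc z (c # r) =
    (if (if gp_check (rev (c # acc)) then \<not> has_marker (rev (c # acc)) else False)
     then (if ret_ok (rev (c # acc)) [hd z] (tl z) then all_prefixes n (c # acc) z r else False)
     else all_prefixes n (c # acc) z r)"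

text \<open>The length bound 36 is that of \<open>marker_free_length\<close>.\<close>

fun all_starts :: "nat \<Rightarrow> letter list \<Rightarrow> bool" where
  "all_starts 0 z = True"
| "all_starts (Suc k) z = (if all_prefixes 36 [] z z then all_starts k (tl z) else False)"

text \<open>Each position of the ternary sequence lies in the image of some \<open>f(f(a))\<close>; the image of \<open>f(f(ab))0102\<close>, where
  \<open>0102\<close> starts every \<open>f(f(c))\<close>, is long enough for all returns to palindromes without marker.\<close>

definition window :: "letter \<Rightarrow> letter \<Rightarrow> letter list" where
  "window a b = T_word (f_morphism (f_morphism [a, b]) @ [L0, L1, L0, L2])"

section \<open>Correctness of the check\<close>

lemma starts_with_iff: "starts_with w r \<longleftrightarrow> length w \<le> length r \<and> take (length w) r = w"
  by (induction w r rule: starts_with.induct) auto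

lemma starts_sw_iff: "starts_sw w r \<longleftrightarrow> length w \<le> length r \<and> (\<exists>b. take (length w) r = sw b w)"
proof -
  have "sw True w = map swap_letter w" by (simp add: sw_def)
  then have "(\<exists>b. take (length w) r = sw b w)
      \<longleftrightarrow> take (length w) r = w \<or> take (length w) r = map swap_letter w"
    by (metis (full_types) sw_simps(6))
  then show ?thesis by (auto simp: starts_sw_def starts_with_iff)
qed

lemma gp_check_iff: "gp_check w \<longleftrightarrow> gp w"
proof -
  have "sw True w = map swap_letter w" by (simp add: sw_def)
  then show ?thesis unfolding gp_check_def gp_def by (metis (full_types) sw_simps(6))
qed

lemma has_markerD: "has_marker w \<Longrightarrow> \<exists>k b. k + 14 \<le> length w \<and> take 14 (drop k w) = sw b marker"
proof (induction w)
  case (Cons x w)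
  show ?case
  proof (cases "starts_sw marker (x # w)")
    case True
    have "length marker = 14" by (simp add: marker_def)
    then obtain b where "14 \<le> length (x # w)" "take 14 (x # w) = sw b marker"
      using True unfolding starts_sw_iff by auto
    then show ?thesis by (intro exI[of _ 0] exI[of _ b]) (simp only: drop_0 add_0)
  next
    case False
    then obtain k b where "k + 14 \<le> length w" "take 14 (drop k w) = sw b marker" using Cons by auto
    then show ?thesis by (intro exI[of _ "Suc k"] exI[of _ b]) simp
  qed
qed simp

lemma ret_okD:
  "ret_ok w acc r \<Longrightarrow> \<exists>d. starts_sw w (drop d r) \<and> gp (rev acc @ take (d + length w) r)
      \<and> d < length r \<and> (\<forall>d'<d. \<not> starts_sw w (drop d' r))"
proof (induction w acc r rule: ret_ok.induct)
  case (2 w acc c r)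
  show ?case
  proof (cases "starts_sw w (c # r)")
    case True
    then show ?thesis using 2(2) by (intro exI[of _ 0]) (simp add: gp_check_iff)
  next
    case False
    then obtain d where d: "starts_sw w (drop d r)" "gp (rev (c # acc) @ take (d + length w) r)"
      "d < length r" "\<forall>d'<d. \<not> starts_sw w (drop d' r)"
      using 2 by auto
    have "\<not> starts_sw w (drop d' (c # r))" if "d' < Suc d" for d'
      using that False d(4) by (cases d') auto
    then show ?thesis using d(1-3) by (intro exI[of _ "Suc d"]) simp
  qed
qed simp

lemma all_prefixesD:
  "all_prefixes N acc z r \<Longrightarrow> z = rev acc @ r \<Longrightarrow> length acc < n \<Longrightarrow> n \<le> length acc + N \<Longrightarrow>
    n \<le> length z \<and> (gp (take n z) \<and> \<not> has_marker (take n z) \<longrightarrow> ret_ok (take n z) [hd z] (tl z))"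
proof (induction N arbitrary: acc r)
  case (Suc N)
  then obtain c r' where r: "r = c # r'" by (cases r) auto
  have rest: "all_prefixes N (c # acc) z r'" using Suc.prems(1) r by (auto split: if_splits)
  show ?case
  proof (cases "n = Suc (length acc)")
    case True
    then have t: "take n z = rev (c # acc)" "n \<le> length z" using Suc.prems(2) r by simp_all
    have "ret_ok (rev (c # acc)) [hd z] (tl z)" if "gp (rev (c # acc))" "\<not> has_marker (rev (c # acc))"
      using Suc.prems(1) that unfolding r by (simp add: gp_check_iff split: if_splits)
    then show ?thesis using t by simp
  next
    case False
    then show ?thesis using Suc.IH[OF rest] Suc.prems(2-4) r by simp
  qed
qed simp

lemma all_startsD: "all_starts m z \<Longrightarrow> k < m \<Longrightarrow> all_prefixes 36 [] (drop k z) (drop k z)"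
proof (induction m arbitrary: z k)
  case (Suc m)
  then have "all_prefixes 36 [] z z" "all_starts m (tl z)" by (auto split: if_splits)
  then show ?case using Suc.IH[of "tl z" "k - 1"] Suc.prems(2)
    by (cases k) (auto simp: drop_Suc)
qed simp


text \<open>One evaluation for each pair of adjacent letters that occurs in \<open>X\<close>; the
  starts range over the image of the first letter.\<close>

lemma windows_L0_L1: "all_starts (length (T_word (f_morphism (f_morphism [L0])))) (window L0 L1)"
  by code_simp
lemma windows_L0_L2: "all_starts (length (T_word (f_morphism (f_morphism [L0])))) (window L0 L2)"
  by code_simp
lemma windows_L1_L0: "all_starts (length (T_word (f_morphism (f_morphism [L1])))) (window L1 L0)"
  by code_simp
lemma windows_L2_L0: "all_starts (length (T_word (f_morphism (f_morphism [L2])))) (window L2 L0)"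
  by code_simp
lemma windows_L2_L2: "all_starts (length (T_word (f_morphism (f_morphism [L2])))) (window L2 L2)"
  by code_simp

lemma windows:
  "all_starts (length (T_word (f_morphism (f_morphism [X !! c])))) (window (X !! c) (X !! Suc c))"
proof -
  consider "X !! c = L0" "X !! Suc c = L1" | "X !! c = L0" "X !! Suc c = L2" | "X !! c = L1" "X !! Suc c = L0"
    | "X !! c = L2" "X !! Suc c = L0" | "X !! c = L2" "X !! Suc c = L2"
    using X_after_L0[of c] X_after_L1[of c] X_around_L1(1)[of c]
    by (cases "X !! c"; cases "X !! Suc c") auto
  then show ?thesis
    using windows_L0_L1 windows_L0_L2 windows_L1_L0 windows_L2_L0 windows_L2_L2 by cases (simp_all only:)
qed

text \<open>A position is located in a block of \<open>Z\<close> and then twice in an image under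
  \<open>f\<close>. Apart from the two letters only the sign at the start of the double image
  matters; it exchanges the whole window.\<close>

lemma Z_window:
  obtains c k where "i = Z.pos (X.pos (X.pos c)) + k"
    "k < length (T_word (f_morphism (f_morphism [X !! c])))"
    "\<And>l n. l + n \<le> length (window (X !! c) (X !! Suc c)) \<Longrightarrow>
      fac Z (Z.pos (X.pos (X.pos c)) + l) n
        = sw (sg (X.pos (X.pos c))) (take n (drop l (window (X !! c) (X !! Suc c))))"
proof -
  let ?P = "\<lambda>c. X.pos (X.pos c)"
  have ff: "fac X (?P c) (?P (c + m) - ?P c) = f_morphism (f_morphism (fac X c m))" for c m
  proof -
    have "X.pos c \<le> X.pos (c + m)" by simp
    then show ?thesis
      using fac_X_pos[of "X.pos c" "X.pos (c + m) - X.pos c"] fac_X_pos[of c m] by simp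
  qed
  obtain c' k' where c': "i = Z.pos c' + k'" "k' < length (sw (sg c') (T_letter (X !! c')))" by (rule Z.pos_cases)
  obtain d l' where d: "c' = X.pos d + l'" "l' < length (f_letter (X !! d))" by (rule X.pos_cases)
  obtain c l where c: "d = X.pos c + l" "l < length (f_letter (X !! c))" by (rule X.pos_cases)
  have "X.pos c \<le> d" "d < X.pos (Suc c)" using c by (auto simp: X.pos_Suc)
  have "X.pos d \<le> c'" "c' < X.pos (Suc d)" using d by (auto simp: X.pos_Suc)
  moreover have "?P c \<le> X.pos d" using \<open>X.pos c \<le> d\<close> by simp
  moreover have "X.pos (Suc d) \<le> ?P (Suc c)" using \<open>d < X.pos (Suc c)\<close> by simp
  ultimately have cc: "?P c \<le> c'" "c' < ?P (Suc c)" by linarith+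
  have i1: "Z.pos (?P c) \<le> Z.pos c'" "Z.pos (Suc c') \<le> Z.pos (?P (Suc c))" using cc by simp_all
  have i2: "i < Z.pos (Suc c')" "Z.pos c' \<le> i" using c' by (simp_all add: Z.pos_Suc)
  have len: "Z.pos (?P (Suc c)) - Z.pos (?P c) = length (T_word (f_morphism (f_morphism [X !! c])))"
  proof -
    have "?P c \<le> ?P (Suc c)" by simp
    then have "fac Z (Z.pos (?P c)) (Z.pos (?P (Suc c)) - Z.pos (?P c))
        = sw (sg (?P c)) (T_word (fac X (?P c) (?P (Suc c) - ?P c)))"
      using Z_word[of "?P c" "?P (Suc c) - ?P c"] by simp
    then have "length (fac Z (Z.pos (?P c)) (Z.pos (?P (Suc c)) - Z.pos (?P c)))
        = length (sw (sg (?P c)) (T_word (fac X (?P c) (?P (Suc c) - ?P c))))"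
      by (rule arg_cong)
    then show ?thesis using ff[of c 1] by (simp add: fac_1)
  qed
  define M where "M = ?P (Suc (Suc c)) - ?P c + 4"
  have wX: "fac X (?P c) M = f_morphism (f_morphism [X !! c, X !! Suc c]) @ [L0, L1, L0, L2]"
  proof -
    have le: "?P c \<le> ?P (Suc (Suc c))" by simp
    have "take 4 (f_morphism (f_morphism [a])) = [L0, L1, L0, L2] \<and> 4 \<le> length (f_morphism (f_morphism [a]))" for a
      by (cases a) simp_all
    from this[of "X !! Suc (Suc c)"] ff[of "Suc (Suc c)" 1]
    have "fac X (?P (Suc (Suc c))) 4 = [L0, L1, L0, L2]"
      by (metis fac_1(2) length_fac take_fac)
    then show ?thesis
      unfolding M_def fac_add using ff[of c 2] le by (simp add: fac_Suc numeral_2_eq_2)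
  qed
  have W: "fac Z (Z.pos (?P c)) (length (window (X !! c) (X !! Suc c))) = sw (sg (?P c)) (window (X !! c) (X !! Suc c))"
  proof -
    let ?W = "window (X !! c) (X !! Suc c)"
    have W: "fac Z (Z.pos (?P c)) (Z.pos (?P c + M) - Z.pos (?P c)) = sw (sg (?P c)) ?W"
      using Z_word[of "?P c" M] unfolding wX window_def .
    have "Z.pos (?P c + M) - Z.pos (?P c) = length ?W"
      using arg_cong[OF W, of length] by (simp only: length_fac sw_simps(4))
    then show ?thesis using W by (simp only:)
  qed
  show thesis
  proof (rule that)
    show "i = Z.pos (?P c) + (i - Z.pos (?P c))" using i1 i2 by linarith
    show "i - Z.pos (?P c) < length (T_word (f_morphism (f_morphism [X !! c])))"
      unfolding len[symmetric] using i1 i2 by linarith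
    fix l n assume l: "l + n \<le> length (window (X !! c) (X !! Suc c))"
    have "fac Z (Z.pos (?P c) + l) n = take n (drop l (fac Z (Z.pos (?P c)) (length (window (X !! c) (X !! Suc c)))))"
      using l by (simp add: drop_fac take_fac)
    then show "fac Z (Z.pos (?P c) + l) n = sw (sg (?P c)) (take n (drop l (window (X !! c) (X !! Suc c))))"
      unfolding W by simp
  qed
qed

text \<open>In the extreme case the factor starts one letter after the start of a marker whose block
  has the maximal length 24. The next marker starts 23 letters later, so
  \<open>n < 23 + 14\<close>.\<close>

lemma marker_free_length:
  assumes "\<And>k. k + 14 \<le> n \<Longrightarrow> \<not> is_marker (i + k)"
  shows "n \<le> 36"
proof -
  obtain p k where p: "i = Z.pos p + k" "k < length (sw (sg p) (T_letter (X !! p)))" by (rule Z.pos_cases)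
  have k24: "Z.pos (Suc p) \<le> Z.pos p + 24" by (simp add: Z_pos_Suc split: letter.split)
  have i: "i < Z.pos (Suc p)" "Z.pos p \<le> i" using p by (simp_all add: Z.pos_Suc)
  show ?thesis
  proof (cases "k \<le> 2")
    case True
    have "is_marker (i + (2 - k))" unfolding is_marker_iff using True p by auto
    then have "\<not> 2 - k + 14 \<le> n" using assms by blast
    then show ?thesis by linarith
  next
    case False
    have "is_marker (i + (Z.pos (Suc p) + 2 - i))" unfolding is_marker_iff using i by auto
    then have "\<not> Z.pos (Suc p) + 2 - i + 14 \<le> n" using assms by blast
    then show ?thesis using False k24 p i by linarith
  qed
qed

text \<open>All positions up to the first return found by \<open>ret_ok\<close> lie in the window,
  where occurrences are the same up to its sign; so the return in \<open>Z\<close> is the one that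
  was checked.\<close>

lemma good_Z_small:
  assumes gp_u: "gp u" and u: "fac Z i0 (length u) = u" and u0: "0 < length u"
    and nm: "\<And>k. k + 14 \<le> length u \<Longrightarrow> \<not> is_marker (i0 + k)"
  shows "good_Z u"
proof (rule good_ZI)
  fix i j assume ij: "i < j" and o: "occ u i" "occ u j" and no: "\<And>k. i < k \<Longrightarrow> k < j \<Longrightarrow> \<not> occ u k"
  define n where "n = length u"
  have n36: "n \<le> 36" using marker_free_length[of n i0] nm by (simp add: n_def)
  obtain c k where ck: "i = Z.pos (X.pos (X.pos c)) + k"
    "k < length (T_word (f_morphism (f_morphism [X !! c])))"
    "\<And>l n. l + n \<le> length (window (X !! c) (X !! Suc c)) \<Longrightarrow>
      fac Z (Z.pos (X.pos (X.pos c)) + l) n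
        = sw (sg (X.pos (X.pos c))) (take n (drop l (window (X !! c) (X !! Suc c))))"
    using Z_window[of i] by blast
  define B where "B = Z.pos (X.pos (X.pos c))"
  define \<sigma> where "\<sigma> = sg (X.pos (X.pos c))"
  define z where "z = drop k (window (X !! c) (X !! Suc c))"
  \<comment> \<open>The condition \<open>0 < l + m\<close> excludes that \<open>k\<close> exceeds
    the length of the window, where the length of \<open>z\<close> would be truncated to 0.\<close>
  have facz: "fac Z (i + l) m = sw \<sigma> (take m (drop l z))" if "l + m \<le> length z" "0 < l + m" for l m
  proof -
    have "k + l + m \<le> length (window (X !! c) (X !! Suc c))"
      using that unfolding z_def length_drop by linarith
    from ck(3)[OF this] show ?thesis
      by (simp add: ck(1) z_def \<sigma>_def add.assoc add.commute[of l k])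
  qed
  have ap: "all_prefixes 36 [] z z"
    unfolding z_def by (rule all_startsD[OF windows ck(2)])
  have n0: "0 < n" using u0 by (simp add: n_def)
  have nz: "n \<le> length z" and ro: "gp (take n z) \<and> \<not> has_marker (take n z) \<longrightarrow> ret_ok (take n z) [hd z] (tl z)"
    using all_prefixesD[OF ap, of n] n0 n36 by auto
  obtain b where b: "fac Z i n = sw b u" using o(1) by (auto simp: occ_def n_def)
  have tz: "take n z = sw (\<sigma> \<noteq> b) u"
  proof -
    have "sw \<sigma> (take n z) = sw b u" using facz[of 0 n] nz n0 b by simp
    then have "take n z = sw \<sigma> (sw b u)" by (rule sw_swap_iff[THEN iffD1])
    then show ?thesis by (simp only: sw_simps(5))
  qed
  have "gp (take n z)" using tz gp_u by simp
  moreover have "\<not> has_marker (take n z)"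
  proof
    assume "has_marker (take n z)"
    then obtain l b' where l: "l + 14 \<le> n" "take 14 (drop l (take n z)) = sw b' marker"
      using has_markerD[of "take n z"] nz by auto
    have "take 14 (drop l (fac Z i0 n)) = fac Z (i0 + l) 14"
      using l(1) by (simp add: drop_fac take_fac)
    then have "sw (\<sigma> \<noteq> b) (fac Z (i0 + l) 14) = sw b' marker" using l(2) tz u by (simp add: n_def)
    then have "fac Z (i0 + l) 14 = sw (\<sigma> \<noteq> b) (sw b' marker)" by (rule sw_swap_iff[THEN iffD1])
    then have "is_marker (i0 + l)" unfolding is_marker_def sw_simps(5) by blast
    then show False using nm l(1) by (simp add: n_def)
  qed
  ultimately have "ret_ok (take n z) [hd z] (tl z)" using ro by blast
  then obtain d where d: "starts_sw (take n z) (drop d (tl z))"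
      "gp (rev [hd z] @ take (d + length (take n z)) (tl z))"
      "\<forall>d'<d. \<not> starts_sw (take n z) (drop d' (tl z))"
    using ret_okD by blast
  obtain x z' where z': "z = x # z'" using nz n0 by (cases z) auto
  have ln: "length (take n z) = n" using nz by simp
  have dl: "Suc d + n \<le> length z" using d(1) n0 unfolding starts_sw_iff ln z' by auto
  \<comment> \<open>\<open>ret_ok\<close> searches \<open>tl z\<close>, so offset \<open>l\<close>
    there is position \<open>i + Suc l\<close>; the occurrence at \<open>i\<close> itself is thereby
    skipped.\<close>
  have occ_iff: "occ u (i + Suc l) \<longleftrightarrow> starts_sw (take n z) (drop l (tl z))" if l: "l \<le> d" for l
  proof -
    have e: "fac Z (i + Suc l) n = sw \<sigma> (take n (drop l (tl z)))"
      using facz[of "Suc l" n] dl l by (simp add: z')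
    have "occ u (i + Suc l) \<longleftrightarrow> (\<exists>b'. sw \<sigma> (take n (drop l (tl z))) = sw b' u)"
      unfolding occ_def n_def[symmetric] e ..
    also have "\<dots> \<longleftrightarrow> (\<exists>b'. take n (drop l (tl z)) = sw b' (take n z))"
    proof
      assume "\<exists>b'. sw \<sigma> (take n (drop l (tl z))) = sw b' u"
      then obtain b' where "sw \<sigma> (take n (drop l (tl z))) = sw b' u" by blast
      then have "take n (drop l (tl z)) = sw \<sigma> (sw b' u)" by (rule sw_swap_iff[THEN iffD1])
      also have "u = sw (\<sigma> \<noteq> b) (take n z)" unfolding tz by simp
      finally have "take n (drop l (tl z)) = sw (\<sigma> \<noteq> (b' \<noteq> (\<sigma> \<noteq> b))) (take n z)"
        by (simp only: sw_simps(5))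
      then show "\<exists>b'. take n (drop l (tl z)) = sw b' (take n z)" by blast
    next
      assume "\<exists>b'. take n (drop l (tl z)) = sw b' (take n z)"
      then show "\<exists>b'. sw \<sigma> (take n (drop l (tl z))) = sw b' u"
        unfolding tz by (auto simp only: sw_simps(5))
    qed
    also have "\<dots> \<longleftrightarrow> starts_sw (take n z) (drop l (tl z))"
      unfolding starts_sw_iff ln using dl l z' by auto
    finally show ?thesis .
  qed
  have "j = i + Suc d"
  proof (rule ccontr)
    assume "j \<noteq> i + Suc d"
    then consider "j < i + Suc d" | "i + Suc d < j" by linarith
    then show False
    proof cases
      case 1
      define l where "l = j - i - 1"
      have "j = i + Suc l" "l < d" using 1 ij by (auto simp: l_def)
      then show False using occ_iff[of l] d(3) o(2) by auto
    next
      case 2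
      then show False using no[of "i + Suc d"] occ_iff[of d] d(1) by auto
    qed
  qed
  moreover have "gp (fac Z i (Suc d + n))"
  proof -
    have "fac Z i (Suc d + n) = sw \<sigma> (take (Suc d + n) z)" using facz[of 0 "Suc d + n"] dl by simp
    moreover have "take (Suc d + n) z = rev [hd z] @ take (d + length (take n z)) (tl z)"
      using ln z' by simp
    ultimately show ?thesis using d(2) by (simp only: gp_sw)
  qed
  ultimately show "gp (fac Z i (j - i + length u))" by (simp add: n_def)
qed

lemma good_Z_pal:
  assumes "gp (fac Z i n)" "0 < n" shows "good_Z (fac Z i n)"
proof -
  obtain i' where i': "30 \<le> i'" "fac Z i' n = fac Z i n" using Z_recurrent by blast
  show ?thesis
  proof (cases "\<exists>k. k + 14 \<le> n \<and> is_marker (i' + k)")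
    case True
    then show ?thesis using good_Z_marker[of "fac Z i n" i'] assms i' by simp
  next
    case False
    then show ?thesis using good_Z_small[of "fac Z i n" i'] assms i' by simp
  qed
qed

section \<open>Symmetries of the ternary sequence\<close>

text \<open>Every prefix of \<open>X\<close> recurs at a position of either sign, where its image
  appears plain or exchanged accordingly.\<close>

lemma Z_sw_closed: "w \<in> lang Z \<Longrightarrow> sw b w \<in> lang Z"
proof -
  assume "w \<in> lang Z"
  then obtain i where i: "w = fac Z i (length w)" by (auto simp: lang_iff)
  define m where "m = i + length w"
  obtain r where r: "fac X r m = fac X 0 m" "sg r = b" using X_recurrent_sg by blast
  have le: "m \<le> Z.pos m" by (rule Z.pos_ge)
  have "fac Z (Z.pos r) (Z.pos m) = sw b (fac Z 0 (Z.pos m))"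
    using Z_word[of r m] Z_word[of 0 m] Z_image(1)[OF r(1)] r by simp
  then have "take (length w) (drop i (fac Z (Z.pos r) (Z.pos m))) = sw b (take (length w) (drop i (fac Z 0 (Z.pos m))))"
    by simp
  then have "fac Z (Z.pos r + i) (length w) = sw b (fac Z i (length w))"
    using le by (simp add: drop_fac take_fac m_def)
  then show ?thesis using i by (metis fac_in_lang)
qed

text \<open>Reversal is inherited from \<open>X\<close> through \<open>rev_body\<close>; the
  exchange that it introduces is undone by \<open>Z_sw_closed\<close>.\<close>

lemma Z_rev_closed: "w \<in> lang Z \<Longrightarrow> rev w \<in> lang Z"
proof -
  assume "w \<in> lang Z"
  then obtain i0 where "w = fac Z i0 (length w)" by (auto simp: lang_iff)
  \<comment> \<open>\<open>body\<close> omits the first two letters of a block, so \<open>w\<close>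
    is taken at a position from 2 on.\<close>
  then obtain i where i: "2 \<le> i" "w = fac Z i (length w)" using Z_recurrent by metis
  define m where "m = i + length w"
  obtain r where r: "fac X r m = rev (fac X 0 m)" using X_rev_closed by blast
  have le: "m \<le> Z.pos m" by (rule Z.pos_ge)
  have W: "fac Z 2 (Z.pos m + 14) = body (fac X 0 m)" using Z_body[of 0 m] by (simp add: numeral_2_eq_2)
  have "rev (fac Z 2 (Z.pos m + 14)) = sw (parity (fac X 0 m)) (body (fac X r m))"
    unfolding W rev_body r ..
  moreover have "body (fac X r m) \<in> lang Z"
  proof -
    have "body (fac X r m) = sw (sg r) (fac Z (Z.pos r + 2) (Z.pos (r + m) - Z.pos r + 14))"
      unfolding Z_body by simp
    then show ?thesis using Z_sw_closed[OF fac_in_lang] by metis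
  qed
  ultimately have *: "rev (fac Z 2 (Z.pos m + 14)) \<in> lang Z" using Z_sw_closed by simp
  have "Z.pos m + 14 = (i - 2) + (length w + (Z.pos m + 16 - m))" using le i(1) by (simp add: m_def)
  then have "fac Z 2 (Z.pos m + 14) = fac Z 2 (i - 2) @ w @ fac Z m (Z.pos m + 16 - m)"
  proof -
    have "2 + (i - 2) = i" "i + length w = m" using i(1) by (simp_all add: m_def)
    then show ?thesis
      unfolding \<open>Z.pos m + 14 = _\<close> fac_add using i(2) by (simp only:)
  qed
  then have "rev (fac Z 2 (Z.pos m + 14)) = rev (fac Z m (Z.pos m + 16 - m)) @ rev w @ rev (fac Z 2 (i - 2))"
    by simp
  then show ?thesis using * subfactor_in_lang by metis
qed

lemma map_swap: "map swap_letter w = sw True w"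
  by (simp add: sw_def)

lemma G_sym_iff: "\<eta> \<in> G_sym \<longleftrightarrow> (\<exists>b. \<eta> = sw b \<or> \<eta> = (\<lambda>w. rev (sw b w)))"
proof -
  have "id = sw False" "R_sym = (\<lambda>w. rev (sw False w))" "S_sym = (\<lambda>w. rev (sw True w))"
    "R_sym \<circ> S_sym = sw True"
    by (auto simp: fun_eq_iff R_sym_def S_sym_def map_swap)
  then show ?thesis unfolding G_sym_def by (auto, (metis (full_types))+)
qed

lemma G_sym_anti_iff:
  "\<Theta> \<in> G_sym \<and> word_antimorphism \<Theta> \<longleftrightarrow> (\<exists>b. \<Theta> = (\<lambda>w. rev (sw b w)))"
proof -
  have "\<not> word_antimorphism (sw b)" for b
  proof
    assume "word_antimorphism (sw b)"
    then have "sw b ([L0] @ [L1]) = sw b [L1] @ sw b [L0]" unfolding word_antimorphism_def by blast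
    then show False by (cases b) simp_all
  qed
  moreover have "word_antimorphism (\<lambda>w. rev (sw b w))" for b
    by (simp add: word_antimorphism_def)
  ultimately show ?thesis unfolding G_sym_iff by blast
qed

lemma G_sym_involution: "\<eta> \<in> G_sym \<Longrightarrow> \<eta> (\<eta> w) = w"
  unfolding G_sym_iff by auto

lemma G_sym_comp: "\<eta> \<in> G_sym \<Longrightarrow> \<theta> \<in> G_sym \<Longrightarrow> \<eta> \<circ> \<theta> \<in> G_sym"
proof -
  assume "\<eta> \<in> G_sym" "\<theta> \<in> G_sym"
  then obtain b c where "\<eta> = sw b \<or> \<eta> = (\<lambda>w. rev (sw b w))" "\<theta> = sw c \<or> \<theta> = (\<lambda>w. rev (sw c w))"
    unfolding G_sym_iff by blast
  then have "\<eta> \<circ> \<theta> = sw (b \<noteq> c) \<or> \<eta> \<circ> \<theta> = (\<lambda>w. rev (sw (b \<noteq> c) w))"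
    by (auto simp: fun_eq_iff)
  then show ?thesis unfolding G_sym_iff by blast
qed

lemma G_sym_morph: "\<eta> \<in> G_sym \<Longrightarrow> word_morphism \<eta> \<or> word_antimorphism \<eta>"
  unfolding G_sym_iff word_morphism_def word_antimorphism_def by auto

interpretation S: symmetric_sequence G_sym z_seq
proof
  show "length (\<eta> w) = length w" if "\<eta> \<in> G_sym" for \<eta> w
    using that unfolding G_sym_iff by auto
  show "id \<in> G_sym" by (simp add: G_sym_def)
  show "\<exists>\<theta>\<in>G_sym. \<forall>w. \<theta> (\<eta> w) = w" if "\<eta> \<in> G_sym" for \<eta>
    using that G_sym_involution by blast
  show "\<eta> w \<in> lang Z" if "\<eta> \<in> G_sym" "w \<in> lang Z" for \<eta> w
    using that Z_sw_closed Z_rev_closed unfolding G_sym_iff by blast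
  show "\<exists>\<Theta>\<in>G_sym. word_antimorphism \<Theta> \<and> \<Theta> [a] = [a]" for a
  proof -
    let ?R = "\<lambda>w. rev (sw False w)"
    have "?R \<in> G_sym \<and> word_antimorphism ?R" unfolding G_sym_anti_iff by blast
    moreover have "?R [a] = [a]" by simp
    ultimately show ?thesis by blast
  qed
qed (use G_sym_comp G_sym_morph Z_recurrent in auto)

lemma gpal_iff: "S.gpal w \<longleftrightarrow> gp w"
proof -
  have "S.gpal w \<longleftrightarrow> (\<exists>\<Theta>. (\<Theta> \<in> G_sym \<and> word_antimorphism \<Theta>) \<and> \<Theta> w = w)"
    unfolding S.gpal_def by blast
  also have "\<dots> \<longleftrightarrow> (\<exists>b. sw b (rev w) = w)" unfolding G_sym_anti_iff by auto
  also have "\<dots> \<longleftrightarrow> gp w"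
    unfolding gp_def sw_swap_iff ..
  finally show ?thesis .
qed

text \<open>Reversing a palindrome amounts to an exchange, so the four symmetries produce only the
  word and its exchange.\<close>

lemma cls_iff_occ:
  assumes "gp (fac Z i n)"
  shows "S.cls n j = S.cls n i \<longleftrightarrow> occ (fac Z i n) j"
proof -
  obtain c where c: "rev (fac Z i n) = sw c (fac Z i n)" using assms by (auto simp: gp_def)
  have "S.cls n j = S.cls n i \<longleftrightarrow> (\<exists>b. fac Z j n = sw b (fac Z i n) \<or> fac Z j n = sw b (rev (fac Z i n)))"
  proof -
    have "(\<exists>\<eta>\<in>G_sym. v = \<eta> w) \<longleftrightarrow> (\<exists>\<eta>. (\<exists>b. \<eta> = sw b \<or> \<eta> = (\<lambda>w. rev (sw b w))) \<and> v = \<eta> w)" for v w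
      by (simp only: Bex_def G_sym_iff)
    then show ?thesis unfolding S.cls_def S.class_eq_iff by auto
  qed
  also have "\<dots> \<longleftrightarrow> (\<exists>b. fac Z j n = sw b (fac Z i n))"
    unfolding c sw_simps(5) by blast
  finally show ?thesis by (simp add: occ_def)
qed

interpretation S: palindromic_returns G_sym z_seq
proof
  fix n i j assume n: "0 < n" and ij: "i < j" and g: "S.gpal (fac Z i n)" and c: "S.cls n j = S.cls n i"
    and no: "\<And>k. i < k \<Longrightarrow> k < j \<Longrightarrow> S.cls n k \<noteq> S.cls n i"
  have g': "gp (fac Z i n)" using g gpal_iff by simp
  have "good_Z (fac Z i n)" by (rule good_Z_pal[OF g' n])
  moreover have "occ (fac Z i n) i" using cls_iff_occ[OF g', of i] by simp
  moreover have "occ (fac Z i n) j" using cls_iff_occ[OF g', of j] c by simp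
  moreover have "\<not> occ (fac Z i n) k" if "i < k" "k < j" for k
    using cls_iff_occ[OF g', of k] no[OF that] by simp
  ultimately have "gp (fac Z i (j - i + length (fac Z i n)))" using ij unfolding good_Z_def by blast
  then show "S.gpal (fac Z i (j - i + n))" using gpal_iff by simp
qed

section \<open>Special factors of every length\<close>

text \<open>Two equal factors with different next letters yield longer ones under \<open>f\<close>.
  If one of these letters is \<open>0\<close>, the images differ right after \<open>f(w) 0\<close>,
  by \<open>1\<close> against \<open>2\<close>. Otherwise both go on with \<open>2\<close>, and the
  difference comes one letter later.\<close>

lemma X_right_special: "\<exists>m\<ge>k. \<exists>r r'. fac X r m = fac X r' m \<and> X !! (r + m) \<noteq> X !! (r' + m)"
proof (induction k)
  case 0
  have "X !! 0 = L0" "X !! 1 = L1" using X_pos[of 0] X_pos1[of 0] by simp_all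
  then show ?case by (intro exI[of _ 0] conjI exI[of _ 0] exI[of _ 1]) simp_all
next
  case (Suc k)
  then obtain m r r' where m: "k \<le> m" "fac X r m = fac X r' m" "X !! (r + m) \<noteq> X !! (r' + m)" by blast
  define c where "c = X.pos (r + m) - X.pos r"
  have c: "X.pos (r + m) = X.pos r + c" "X.pos (r' + m) = X.pos r' + c" "m \<le> c"
  proof -
    have "X.pos r \<le> X.pos (r + m)" "X.pos r' \<le> X.pos (r' + m)" by simp_all
    then show "X.pos (r + m) = X.pos r + c" "X.pos (r' + m) = X.pos r' + c"
      using X_image_eq(1)[OF m(2)[symmetric], of 0 0] unfolding c_def by linarith+
    show "m \<le> c" using f_morphism_length[of "fac X r m"] length_f_fac[of r m] by (simp add: c_def)
  qed
  have eq: "fac X (X.pos r) (c + 1) = fac X (X.pos r') (c + 1)"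
    using X_image_eq(2)[OF m(2), of 0 "c + 1"] c by simp
  show ?case
  proof (cases "X !! (r + m) = L0 \<or> X !! (r' + m) = L0")
    case True
    then have "X !! (X.pos r + (c + 1)) \<noteq> X !! (X.pos r' + (c + 1))"
      using X_pos1[of "r + m"] X_pos1[of "r' + m"] m(3) c by auto
    then show ?thesis using eq c(3) m(1) by (intro exI[of _ "c + 1"]) auto
  next
    case False
    have "X !! (X.pos r + (c + 1)) = L2" "X !! (X.pos r' + (c + 1)) = L2"
      using X_pos1[of "r + m"] X_pos1[of "r' + m"] False c by auto
    then have "fac X (X.pos r) (c + 1 + 1) = fac X (X.pos r') (c + 1 + 1)"
      using eq unfolding fac_add[of X _ "c + 1" 1] by (simp only: fac_1)
    moreover have "X !! (X.pos r + (c + 2)) \<noteq> X !! (X.pos r' + (c + 2))"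
    proof -
      have "X !! (X.pos q + 2) = (if X !! q = L1 then L2 else L0)" if "X !! q \<noteq> L0" for q
        using X_pos2[of q] X_pos[of "Suc q"] X_pos_Suc[of q] that by auto
      from this[of "r + m"] this[of "r' + m"] show ?thesis
        using False m(3) c by (cases "X !! (r + m)"; cases "X !! (r' + m)") (auto simp: add.assoc)
    qed
    ultimately show ?thesis using c(3) m(1)
      by (intro exI[of _ "c + 2"] conjI exI[of _ "X.pos r"] exI[of _ "X.pos r'"]) auto
  qed
qed

text \<open>A tree has a vertex, so each length needs a special factor. The images of a long right
  special factor of \<open>X\<close>, taken at positions of equal sign, agree on the core and differ
  later; the \<open>n\<close> letters before the first difference are right special.\<close>

lemma Z_special_exists: "\<exists>w. length w = n \<and> special Z w"
proof -
  obtain m r0 r0' where m: "n \<le> m" "fac X r0 m = fac X r0' m" "X !! (r0 + m) \<noteq> X !! (r0' + m)"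
    using X_right_special by blast
  obtain r where r: "fac X r (m + 1) = fac X r0 (m + 1)" "sg r = False" using X_recurrent_sg by blast
  obtain r' where r': "fac X r' (m + 1) = fac X r0' (m + 1)" "sg r' = False" using X_recurrent_sg by blast
  have rr: "fac X r m = fac X r' m" "X !! (r + m) \<noteq> X !! (r' + m)"
    using r r' m unfolding fac_add by (auto simp: fac_1)
  define c where "c = Z.pos (r + m) - Z.pos r + 14"
  have c: "Z.pos (r + m) + 16 = Z.pos r + 2 + c" "Z.pos (r' + m) + 16 = Z.pos r' + 2 + c" "n \<le> c"
  proof -
    have "Z.pos r \<le> Z.pos (r + m)" "Z.pos r' \<le> Z.pos (r' + m)" by simp_all
    then show "Z.pos (r + m) + 16 = Z.pos r + 2 + c" "Z.pos (r' + m) + 16 = Z.pos r' + 2 + c"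
      using Z_image(1)[OF rr(1)] unfolding c_def by linarith+
    have "k \<le> Z.pos (r + k) - Z.pos r" for k
    proof (induction k)
      case (Suc k)
      moreover have "Z.pos (r + k) < Z.pos (r + Suc k)" "Z.pos r \<le> Z.pos (r + k)" by simp_all
      ultimately show ?case by linarith
    qed simp
    then show "n \<le> c" using m(1) unfolding c_def by (meson le_trans trans_le_add1)
  qed
  have eq: "fac Z (Z.pos r + 2) c = fac Z (Z.pos r' + 2) c"
    using Z_image(2)[OF rr(1), of 0 c] Z_image(1)[OF rr(1)] r r' by (simp add: c_def)
  have sgm: "sg (r + m) = sg (r' + m)" using sg_add[of r m] sg_add[of r' m] rr r r' by simp
  \<comment> \<open>The distinguishing letters are the fifth and the eleventh after the last marker
    of the core, which ends before \<open>Z.pos (r + m) + 16\<close>.\<close>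
  have "\<exists>d. Z !! (Z.pos r + 2 + d) \<noteq> Z !! (Z.pos r' + 2 + d)"
  proof (cases "X !! (r + m) = L0 \<or> X !! (r' + m) = L0")
    case True
    then have "Z !! (Z.pos (r + m) + 20) \<noteq> Z !! (Z.pos (r' + m) + 20)"
      using Z_right_4[of "r + m"] Z_right_4[of "r' + m"] rr(2) by metis
    moreover have "Z.pos (r + m) + 20 = Z.pos r + 2 + (c + 4)" "Z.pos (r' + m) + 20 = Z.pos r' + 2 + (c + 4)"
      using c by linarith+
    ultimately show ?thesis by metis
  next
    case False
    then have "Z !! (Z.pos (r + m) + 26) \<noteq> Z !! (Z.pos (r' + m) + 26)"
      using Z_right_10[of "r + m"] Z_right_10[of "r' + m"] rr(2) sgm by simp
    moreover have "Z.pos (r + m) + 26 = Z.pos r + 2 + (c + 10)" "Z.pos (r' + m) + 26 = Z.pos r' + 2 + (c + 10)"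
      using c by linarith+
    ultimately show ?thesis by metis
  qed
  then obtain d where d: "Z !! (Z.pos r + 2 + d) \<noteq> Z !! (Z.pos r' + 2 + d)"
      "\<And>k. k < d \<Longrightarrow> Z !! (Z.pos r + 2 + k) = Z !! (Z.pos r' + 2 + k)"
    using exists_least_iff[of "\<lambda>d. Z !! (Z.pos r + 2 + d) \<noteq> Z !! (Z.pos r' + 2 + d)"] by blast
  have "c \<le> d"
  proof (rule ccontr)
    assume "\<not> c \<le> d"
    then show False using eq d(1) by (simp add: fac_eq_iff)
  qed
  then have dn: "n \<le> d" using c(3) by simp
  define w where "w = fac Z (Z.pos r + 2 + (d - n)) n"
  have w': "w = fac Z (Z.pos r' + 2 + (d - n)) n"
    unfolding w_def fac_eq_iff
  proof (intro allI impI)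
    fix k assume "k < n"
    then have "d - n + k < d" using dn by simp
    from d(2)[OF this] show "Z !! (Z.pos r + 2 + (d - n) + k) = Z !! (Z.pos r' + 2 + (d - n) + k)"
      by (simp add: add.assoc)
  qed
  have "w @ [Z !! (Z.pos r + 2 + d)] = fac Z (Z.pos r + 2 + (d - n)) (n + 1)"
    "w @ [Z !! (Z.pos r' + 2 + d)] = fac Z (Z.pos r' + 2 + (d - n)) (n + 1)"
    unfolding fac_add using dn w' by (simp_all add: w_def fac_1)
  then have "right_special Z w" unfolding right_special_def using d(1) fac_in_lang by metis
  then show ?thesis unfolding special_def by (intro exI[of _ w]) (simp add: w_def)
qed

theorem theorem13:
  shows "G_rich G_sym z_seq"
proof -
  have "symmetry_group G_sym"
    unfolding symmetry_group_def
  proof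
    show "group \<lparr>carrier = G_sym, monoid.mult = (\<circ>), one = id\<rparr>"
    proof (rule groupI)
      fix \<eta> assume "\<eta> \<in> carrier \<lparr>carrier = G_sym, monoid.mult = (\<circ>), one = id\<rparr>"
      then have "\<eta> \<in> G_sym" "\<eta> \<circ> \<eta> = id" using G_sym_involution by (auto simp: fun_eq_iff)
      then show "\<exists>\<theta>\<in>carrier \<lparr>carrier = G_sym, monoid.mult = (\<circ>), one = id\<rparr>.
          \<theta> \<otimes>\<^bsub>\<lparr>carrier = G_sym, monoid.mult = (\<circ>), one = id\<rparr>\<^esub> \<eta>
            = \<one>\<^bsub>\<lparr>carrier = G_sym, monoid.mult = (\<circ>), one = id\<rparr>\<^esub>"
        by auto
    qed (auto simp: G_sym_comp S.id_in comp_assoc)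
  qed (use G_sym_morph in blast)
  moreover have "closed_under G_sym z_seq"
    unfolding closed_under_def using S.closed by blast
  ultimately show ?thesis
    unfolding G_rich_def using S.rich_graphs Z_special_exists by (auto simp: Suc_le_eq)
qed

end
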